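(* Let $G$ be a countably infinite, amenable and residually finite group. Consider a free $G$-odometer $\overleftarrow{G}$ with group structure, equipped with its normalized Haar measure $\nu$. Then, for every integer $k\ge 2$, there exist an irregular Toeplitz array $x_0\in\{0,1\}^G$ and an almost one-to-one factor map $\beta:\overline{O_G(x_0)}\to\overleftarrow{G}$ verifying $\beta^{-1}(\{1_{\overleftarrow{G}}\})=\{x_0\}$, such that (1) for every $\xi\in\overleftarrow{G}$ the fiber $\beta^{-1}(\{\xi\})$ contains at most $k$ elements; (2) for $\nu$-almost every $\xi\in\overleftarrow{G}$ the fiber $\beta^{-1}(\{\xi\})$ contains exactly $k$ elements; (3) the subshift $(\overline{O_G(x_0)},G)$ admits exactly $k$ ergodic invariant probability measures, each of which is measure-theoretically isomorphic to the Haar measure $\nu$ on $\overleftarrow{G}$ via the map $\beta$.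
   Context: Let $(\Gamma_n)_{n\in\mathbb{N}}$ be a decreasing sequence of normal finite index subgroups of $G$. The associated $G$-odometer with group structure is $\overleftarrow{G}=\{(g_n\Gamma_n)_{n}\in\prod_n G/\Gamma_n: g_{n+1}\Gamma_n=g_n\Gamma_n\ \forall n\}$, a compact metrizable group, with $G$ acting by coordinatewise left multiplication. It is free if $\bigcap_n\Gamma_n=\{1_G\}$. The space $\{0,1\}^G$ carries the product topology and the shift action $(gx)(h)=x(hg)$; $\overline{O_G(x)}$ is the closure of the orbit of $x$. A factor map $\varphi:X\to Y$ is a continuous, surjective, $G$-equivariant map; it is almost one-to-one if $\{x\in X:\varphi^{-1}(\{\varphi(x)\})=\{x\}\}$ is dense in $X$. An array $x\in\{0,1\}^G$ is Toeplitz if for every $g\in G$ there is a finite index subgroup $\Gamma_g$ of $G$ with $x(g\gamma)=x(g)$ for all $\gamma\in\Gamma_g$. For a Toeplitz array $x$, the maximal equicontinuous factor of $(\overline{O_G(x)},G)$ is a $G$-odometer (uniquely ergodic); let $\pi$ be the corresponding factor map, $\nu$ the unique invariant probability measure of that odometer, and $\mathcal{T}$ the set of all Toeplitz arrays in $\overline{O_G(x)}$. Then $x$ is regular if $\nu(\pi(\mathcal{T}))=1$, and irregular otherwise. In (3), "isomorphic via $\beta$" means that for each such ergodic measure $\mu$ the map $\beta$ is a measure-theoretic isomorphism from $(\overline{O_G(x_0)},\mu,G)$ to $(\overleftarrow{G},\nu,G)$ (i.e. it pushes $\mu$ to $\nu$ and is a bi-measurable bijection between invariant sets of full measure). *)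

theory Defs
  imports "HOL-Probability.Probability" "HOL-Algebra.Product_Groups"
begin

section \<open>Groups\<close>

definition finite_index_subgroup :: "('g, 'm) monoid_scheme \<Rightarrow> 'g set \<Rightarrow> bool" where
  "finite_index_subgroup G H \<longleftrightarrow> subgroup H G \<and> finite (rcosets\<^bsub>G\<^esub> H)"

text \<open>Amenability of a countable discrete group: existence of a (left) Foelner sequence.
  Inverting the sets exchanges left and right Foelner sequences, so the side is immaterial.\<close>

definition amenable_group :: "('g, 'm) monoid_scheme \<Rightarrow> bool" where
  "amenable_group G \<longleftrightarrow>
     (\<exists>F :: nat \<Rightarrow> 'g set.
        (\<forall>n. finite (F n) \<and> F n \<noteq> {} \<and> F n \<subseteq> carrier G) \<and>
        (\<forall>g\<in>carrier G.
           (\<lambda>n. real (card (((g <#\<^bsub>G\<^esub> F n) - F n) \<union> (F n - (g <#\<^bsub>G\<^esub> F n)))) / real (card (F n)))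
             \<longlonglongrightarrow> 0))"

definition residually_finite_group :: "('g, 'm) monoid_scheme \<Rightarrow> bool" where
  "residually_finite_group G \<longleftrightarrow>
     (\<forall>g\<in>carrier G. g \<noteq> \<one>\<^bsub>G\<^esub> \<longrightarrow> (\<exists>N. N \<lhd> G \<and> finite (rcosets\<^bsub>G\<^esub> N) \<and> g \<notin> N))"


section \<open>Topological dynamical systems\<close>

text \<open>A system is given by a topology \<open>X\<close> and an action \<open>a g x\<close>, relevant only for
  \<open>g \<in> carrier G\<close> and \<open>x \<in> topspace X\<close>.\<close>

definition continuous_action ::
    "('g, 'm) monoid_scheme \<Rightarrow> 'x topology \<Rightarrow> ('g \<Rightarrow> 'x \<Rightarrow> 'x) \<Rightarrow> bool" where
  "continuous_action G X a \<longleftrightarrow>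
     (\<forall>g\<in>carrier G. continuous_map X X (a g)) \<and>
     (\<forall>x\<in>topspace X. a \<one>\<^bsub>G\<^esub> x = x) \<and>
     (\<forall>g\<in>carrier G. \<forall>h\<in>carrier G. \<forall>x\<in>topspace X. a (g \<otimes>\<^bsub>G\<^esub> h) x = a g (a h x))"

definition factor_map ::
    "('g, 'm) monoid_scheme \<Rightarrow> 'x topology \<Rightarrow> ('g \<Rightarrow> 'x \<Rightarrow> 'x) \<Rightarrow>
     'y topology \<Rightarrow> ('g \<Rightarrow> 'y \<Rightarrow> 'y) \<Rightarrow> ('x \<Rightarrow> 'y) \<Rightarrow> bool" where
  "factor_map G X a Y b f \<longleftrightarrow>
     continuous_map X Y f \<and> f ` topspace X = topspace Y \<and>
     (\<forall>g\<in>carrier G. \<forall>x\<in>topspace X. f (a g x) = b g (f x))"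

definition fiber :: "'x topology \<Rightarrow> ('x \<Rightarrow> 'y) \<Rightarrow> 'y \<Rightarrow> 'x set" where
  "fiber X f y = {x \<in> topspace X. f x = y}"

definition almost_one_to_one :: "'x topology \<Rightarrow> ('x \<Rightarrow> 'y) \<Rightarrow> bool" where
  "almost_one_to_one X f \<longleftrightarrow>
     X closure_of {x \<in> topspace X. fiber X f (f x) = {x}} = topspace X"

text \<open>On a compact space, equicontinuity does not depend on the metric chosen for the topology.\<close>

definition equicontinuous_system ::
    "('g, 'm) monoid_scheme \<Rightarrow> 'x topology \<Rightarrow> ('g \<Rightarrow> 'x \<Rightarrow> 'x) \<Rightarrow> bool" where
  "equicontinuous_system G X a \<longleftrightarrow>
     compact_space X \<and> continuous_action G X a \<and>
     (\<exists>d. Metric_space (topspace X) d \<and> Metric_space.mtopology (topspace X) d = X \<and>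
        (\<forall>\<epsilon>>0. \<exists>\<delta>>0. \<forall>x\<in>topspace X. \<forall>y\<in>topspace X. d x y < \<delta> \<longrightarrow>
           (\<forall>g\<in>carrier G. d (a g x) (a g y) < \<epsilon>)))"

text \<open>The universal property is tested against systems living on the type \<open>'x set\<close>. This is no
  restriction: a factor of a compact system on \<open>'x\<close> is conjugate to a system whose points are
  the fibres of the factor map.\<close>

definition maximal_equicontinuous_factor ::
    "('g, 'm) monoid_scheme \<Rightarrow> 'x topology \<Rightarrow> ('g \<Rightarrow> 'x \<Rightarrow> 'x) \<Rightarrow>
     'y topology \<Rightarrow> ('g \<Rightarrow> 'y \<Rightarrow> 'y) \<Rightarrow> ('x \<Rightarrow> 'y) \<Rightarrow> bool" where
  "maximal_equicontinuous_factor G X a Y b \<pi> \<longleftrightarrow>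
     equicontinuous_system G Y b \<and> factor_map G X a Y b \<pi> \<and>
     (\<forall>(Z :: 'x set topology) c f.
        equicontinuous_system G Z c \<and> factor_map G X a Z c f \<longrightarrow>
        (\<exists>h. factor_map G Y b Z c h \<and> (\<forall>x\<in>topspace X. f x = h (\<pi> x))))"


section \<open>Invariant measures\<close>

definition borel_of :: "'x topology \<Rightarrow> 'x measure" where
  "borel_of X = sigma (topspace X) {U. openin X U}"

definition invariant_prob_measure ::
    "('g, 'm) monoid_scheme \<Rightarrow> 'x topology \<Rightarrow> ('g \<Rightarrow> 'x \<Rightarrow> 'x) \<Rightarrow> 'x measure \<Rightarrow> bool" where
  "invariant_prob_measure G X a \<mu> \<longleftrightarrow>
     prob_space \<mu> \<and> sets \<mu> = sets (borel_of X) \<and>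
     (\<forall>g\<in>carrier G. a g \<in> measurable \<mu> \<mu> \<and> distr \<mu> \<mu> (a g) = \<mu>)"

definition ergodic_prob_measure ::
    "('g, 'm) monoid_scheme \<Rightarrow> 'x topology \<Rightarrow> ('g \<Rightarrow> 'x \<Rightarrow> 'x) \<Rightarrow> 'x measure \<Rightarrow> bool" where
  "ergodic_prob_measure G X a \<mu> \<longleftrightarrow>
     invariant_prob_measure G X a \<mu> \<and>
     (\<forall>A\<in>sets \<mu>. (\<forall>g\<in>carrier G. a g -` A \<inter> space \<mu> = A) \<longrightarrow>
        emeasure \<mu> A = 0 \<or> emeasure \<mu> A = 1)"

definition measure_isomorphism_via ::
    "('g, 'm) monoid_scheme \<Rightarrow> ('g \<Rightarrow> 'x \<Rightarrow> 'x) \<Rightarrow> 'x measure \<Rightarrow>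
     ('g \<Rightarrow> 'y \<Rightarrow> 'y) \<Rightarrow> 'y measure \<Rightarrow> ('x \<Rightarrow> 'y) \<Rightarrow> bool" where
  "measure_isomorphism_via G a \<mu> b \<nu> f \<longleftrightarrow>
     f \<in> measurable \<mu> \<nu> \<and> distr \<mu> \<nu> f = \<nu> \<and>
     (\<exists>A\<in>sets \<mu>. \<exists>B\<in>sets \<nu>.
        emeasure \<mu> A = 1 \<and> emeasure \<nu> B = 1 \<and>
        (\<forall>g\<in>carrier G. a g ` A = A) \<and> (\<forall>g\<in>carrier G. b g ` B = B) \<and>
        bij_betw f A B \<and>
        inv_into A f \<in> measurable (restrict_space \<nu> B) (restrict_space \<mu> A) \<and>
        (\<forall>g\<in>carrier G. \<forall>x\<in>A. f (a g x) = b g (f x)))"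


section \<open>Odometers\<close>

text \<open>The inverse limit is defined for arbitrary subgroups, in terms of left cosets; if all
  \<open>\<Gamma> n\<close> are normal, it carries a group structure.\<close>

definition odometer :: "('g, 'm) monoid_scheme \<Rightarrow> (nat \<Rightarrow> 'g set) \<Rightarrow> (nat \<Rightarrow> 'g set) set" where
  "odometer G \<Gamma> =
     {\<xi>. \<exists>g. (\<forall>n. g n \<in> carrier G \<and> \<xi> n = g n <#\<^bsub>G\<^esub> \<Gamma> n) \<and>
            (\<forall>n. g (Suc n) <#\<^bsub>G\<^esub> \<Gamma> n = g n <#\<^bsub>G\<^esub> \<Gamma> n)}"

definition odometer_topology ::
    "('g, 'm) monoid_scheme \<Rightarrow> (nat \<Rightarrow> 'g set) \<Rightarrow> (nat \<Rightarrow> 'g set) topology" where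
  "odometer_topology G \<Gamma> =
     subtopology (product_topology (\<lambda>_. discrete_topology UNIV) UNIV) (odometer G \<Gamma>)"

definition odometer_action ::
    "('g, 'm) monoid_scheme \<Rightarrow> 'g \<Rightarrow> (nat \<Rightarrow> 'g set) \<Rightarrow> (nat \<Rightarrow> 'g set)" where
  "odometer_action G g \<xi> = (\<lambda>n. g <#\<^bsub>G\<^esub> \<xi> n)"

definition odometer_group ::
    "('g, 'm) monoid_scheme \<Rightarrow> (nat \<Rightarrow> 'g set) \<Rightarrow> (nat \<Rightarrow> 'g set) monoid" where
  "odometer_group G \<Gamma> = (product_group UNIV (\<lambda>n. G Mod \<Gamma> n))\<lparr>carrier := odometer G \<Gamma>\<rparr>"

definition decreasing_finite_index ::
    "('g, 'm) monoid_scheme \<Rightarrow> (nat \<Rightarrow> 'g set) \<Rightarrow> bool" where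
  "decreasing_finite_index G \<Gamma> \<longleftrightarrow>
     (\<forall>n. finite_index_subgroup G (\<Gamma> n)) \<and> (\<forall>n. \<Gamma> (Suc n) \<subseteq> \<Gamma> n)"

text \<open>Characterisation of the normalised Haar measure of a compact group \<open>K\<close> with topology \<open>T\<close>.\<close>

definition normalized_haar_measure ::
    "('k, 'm) monoid_scheme \<Rightarrow> 'k topology \<Rightarrow> 'k measure \<Rightarrow> bool" where
  "normalized_haar_measure K T \<nu> \<longleftrightarrow>
     prob_space \<nu> \<and> sets \<nu> = sets (borel_of T) \<and>
     (\<forall>z\<in>carrier K. \<forall>A\<in>sets \<nu>. emeasure \<nu> (z <#\<^bsub>K\<^esub> A) = emeasure \<nu> A)"


section \<open>Arrays\<close>

text \<open>Arrays in \<open>{0,1}^G\<close> are represented by Boolean functions that are extensional on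
  \<open>carrier G\<close>.\<close>

definition full_shift :: "('g, 'm) monoid_scheme \<Rightarrow> ('g \<Rightarrow> bool) topology" where
  "full_shift G = product_topology (\<lambda>_. discrete_topology UNIV) (carrier G)"

definition shift_action :: "('g, 'm) monoid_scheme \<Rightarrow> 'g \<Rightarrow> ('g \<Rightarrow> bool) \<Rightarrow> ('g \<Rightarrow> bool)" where
  "shift_action G g x = (\<lambda>h\<in>carrier G. x (h \<otimes>\<^bsub>G\<^esub> g))"

definition orbit_closure :: "('g, 'm) monoid_scheme \<Rightarrow> ('g \<Rightarrow> bool) \<Rightarrow> ('g \<Rightarrow> bool) set" where
  "orbit_closure G x = full_shift G closure_of ((\<lambda>g. shift_action G g x) ` carrier G)"

definition orbit_subshift :: "('g, 'm) monoid_scheme \<Rightarrow> ('g \<Rightarrow> bool) \<Rightarrow> ('g \<Rightarrow> bool) topology" where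
  "orbit_subshift G x = subtopology (full_shift G) (orbit_closure G x)"

definition toeplitz :: "('g, 'm) monoid_scheme \<Rightarrow> ('g \<Rightarrow> bool) \<Rightarrow> bool" where
  "toeplitz G x \<longleftrightarrow>
     x \<in> topspace (full_shift G) \<and>
     (\<forall>g\<in>carrier G. \<exists>H. finite_index_subgroup G H \<and> (\<forall>\<gamma>\<in>H. x (g \<otimes>\<^bsub>G\<^esub> \<gamma>) = x g))"

text \<open>The maximal equicontinuous factor of a Toeplitz subshift is an odometer, possibly without
  group structure. It is unique up to conjugacy, so regularity does not depend on the
  presentation \<open>(\<Gamma>, \<pi>)\<close>; \<open>\<nu>\<close> is determined by \<open>\<Gamma>\<close>.\<close>

definition regular_toeplitz :: "('g, 'm) monoid_scheme \<Rightarrow> ('g \<Rightarrow> bool) \<Rightarrow> bool" where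
  "regular_toeplitz G x \<longleftrightarrow>
     toeplitz G x \<and>
     (\<exists>\<Gamma> \<pi> \<nu>.
        decreasing_finite_index G \<Gamma> \<and>
        maximal_equicontinuous_factor G (orbit_subshift G x) (shift_action G)
          (odometer_topology G \<Gamma>) (odometer_action G) \<pi> \<and>
        invariant_prob_measure G (odometer_topology G \<Gamma>) (odometer_action G) \<nu> \<and>
        emeasure \<nu> (\<pi> ` {y \<in> orbit_closure G x. toeplitz G y}) = 1)"

definition irregular_toeplitz :: "('g, 'm) monoid_scheme \<Rightarrow> ('g \<Rightarrow> bool) \<Rightarrow> bool" where
  "irregular_toeplitz G x \<longleftrightarrow> toeplitz G x \<and> \<not> regular_toeplitz G x"

end

theory Submission
  imports Defs "HOL-Combinatorics.Permutations"
begin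

text \<open>The group \<open>G\<close> embeds densely into its odometer \<open>Y\<close>. The array is the restriction to \<open>G\<close> of a
  two-valued function on \<open>Y\<close> that is continuous off a closed set \<open>holes\<close> of positive measure which
  does not meet \<open>G\<close>. It comes from clopen sets \<open>V 0 \<supseteq> V 1 \<supseteq> \<dots>\<close>, represented by periodic subsets of
  \<open>G\<close>, with intersection \<open>holes\<close>: a group element in \<open>V m - V (Suc m)\<close> is filled at stage \<open>m\<close>, and
  its value tells whether its colour equals \<open>m mod k\<close>. The colours \<open>1, \<dots>, k - 1\<close> are locally
  constant.

  An element of the fibre over \<open>\<xi>\<close> is a limit of translates of the array by group elements that tend
  to \<open>\<xi>\<close>. Its value at \<open>h\<close> is forced if \<open>h \<xi>\<close> is not in \<open>holes\<close>; otherwise it says whether the colour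
  of \<open>h \<xi>\<close> is \<open>j\<close>, where \<open>j\<close> is the class modulo \<open>k\<close> of the stage at which the approximating points
  are filled. If \<open>j\<close> is the same at all positions \<open>h\<close>, then the fibre consists of the \<open>k\<close> arrays
  \<open>phi j \<xi>\<close>. They are distinct as soon as the orbit of \<open>\<xi>\<close> meets \<open>holes\<close> in every colour, hence
  almost everywhere. The maps \<open>phi j\<close> are measurable equivariant sections of the factor map whose
  images cover the subshift, so an ergodic measure is carried by one of these images and is the
  image of Haar measure under \<open>phi j\<close>.

  That \<open>j\<close> does not depend on \<open>h\<close> is achieved by tiles. Each \<open>V m\<close> is divided into tiles of bounded
  size such that no step by an element of a large finite set \<open>F m\<close> leads from one tile to another,
  and the points filled at stage \<open>m\<close> form whole tiles (\<open>tiled_refine\<close>). Since the tiles of \<open>V m\<close> are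
  bounded and those of \<open>V (Suc m)\<close> must be separated by the larger set \<open>F (Suc m)\<close>, one needs
  boundary sets of small measure that cut the group into bounded pieces. This is where amenability
  enters (\<open>bounded_labelling\<close>): in a finite quotient, let every point choose, among its translates by
  a Foelner set, the one that comes first in a random ordering. Neighbouring points make the same
  choice with high probability.

  The factor map exists because the array determines the odometer coordinate (\<open>window_exists\<close>):
  \<open>V m\<close> consists of the cosets on which the array takes both values, and the construction keeps
  each \<open>V m\<close> free of superfluous right periods. Finally, an array over \<open>\<xi>\<close> is Toeplitz only if the
  orbit of \<open>\<xi>\<close> avoids \<open>holes\<close>, and such \<open>\<xi>\<close> form a null set. The odometer is a factor of
  every maximal equicontinuous factor, so the array is irregular with respect to any of its
  presentations.\<close>

section \<open>Borel sets of subspaces of discrete products\<close>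

text \<open>Only finitely many coordinates of a basic open set are constrained, and with discrete factors
  the constraint can be taken to be equality with a given point.\<close>

lemma openin_discrete_product_iff:
  fixes I :: "'i set" and S :: "('i \<Rightarrow> 'b) set"
  assumes "S \<subseteq> extensional I"
  shows "openin (subtopology (product_topology (\<lambda>_. discrete_topology UNIV) I) S) U \<longleftrightarrow>
    U \<subseteq> S \<and> (\<forall>x\<in>U. \<exists>K. finite K \<and> K \<subseteq> I \<and> {y\<in>S. \<forall>i\<in>K. y i = x i} \<subseteq> U)"
    (is "?L \<longleftrightarrow> ?R")
proof
  assume ?L
  then obtain T where T: "openin (product_topology (\<lambda>_. discrete_topology UNIV) I) T" "U = T \<inter> S"
    by (auto simp: openin_subtopology)
  have "\<exists>K. finite K \<and> K \<subseteq> I \<and> {y\<in>S. \<forall>i\<in>K. y i = x i} \<subseteq> U" if x: "x \<in> U" for x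
  proof -
    obtain W where W: "finite {i\<in>I. W i \<noteq> UNIV}" "x \<in> PiE I W" "PiE I W \<subseteq> T"
      using T(1) x T(2) unfolding openin_product_topology_alt by fastforce
    have "y \<in> U" if y: "y \<in> S" "\<forall>i\<in>{i\<in>I. W i \<noteq> UNIV}. y i = x i" for y
    proof -
      have "y i \<in> W i" if i: "i \<in> I" for i
      proof (cases "W i = UNIV")
        case False
        then have "y i = x i" using y i by blast
        then show ?thesis using W(2) i by (simp add: PiE_iff)
      qed simp
      then have "y \<in> PiE I W" using y(1) assms by (auto simp: PiE_iff)
      then show ?thesis using W(3) T(2) y(1) by blast
    qed
    then show ?thesis using W(1) by (intro exI[of _ "{i\<in>I. W i \<noteq> UNIV}"]) auto
  qed
  then show ?R using T(2) by (intro conjI ballI) auto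
next
  assume R: ?R
  then have "\<forall>x\<in>U. \<exists>K. finite K \<and> K \<subseteq> I \<and> {y\<in>S. \<forall>i\<in>K. y i = x i} \<subseteq> U" by simp
  from bchoice[OF this]
  obtain K where "\<forall>x\<in>U. finite (K x) \<and> K x \<subseteq> I \<and> {y\<in>S. \<forall>i\<in>K x. y i = x i} \<subseteq> U" ..
  note K = this[THEN bspec]
  define T where "T = (\<Union>x\<in>U. PiE I (\<lambda>i. if i \<in> K x then {x i} else UNIV))"
  have "openin (product_topology (\<lambda>_. discrete_topology UNIV) I) T"
    unfolding T_def
  proof (rule openin_Union, safe)
    fix x assume x: "x \<in> U"
    have "{i \<in> I. (if i \<in> K x then {x i} else UNIV) \<noteq> topspace (discrete_topology UNIV)} \<subseteq> K x"
      by auto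
    then have "finite {i \<in> I. (if i \<in> K x then {x i} else UNIV) \<noteq> topspace (discrete_topology UNIV)}"
      using K[OF x] finite_subset by blast
    then show "openin (product_topology (\<lambda>_. discrete_topology UNIV) I)
        (PiE I (\<lambda>i. if i \<in> K x then {x i} else UNIV))"
      by (subst openin_PiE_gen) auto
  qed
  moreover have "U = T \<inter> S"
  proof
    show "U \<subseteq> T \<inter> S"
    proof
      fix x assume x: "x \<in> U"
      then have xS: "x \<in> S" using R by blast
      then have "x \<in> PiE I (\<lambda>i. if i \<in> K x then {x i} else UNIV)"
        using assms by (simp add: PiE_iff subset_iff)
      then show "x \<in> T \<inter> S" using x xS by (auto simp only: T_def)
    qed
    show "T \<inter> S \<subseteq> U"
    proof
      fix y assume y: "y \<in> T \<inter> S"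
      then obtain x where x: "x \<in> U" "y \<in> PiE I (\<lambda>i. if i \<in> K x then {x i} else UNIV)"
        by (auto simp: T_def)
      have "y i = x i" if i: "i \<in> K x" for i
      proof -
        have "i \<in> I" using K[OF x(1)] i by blast
        then show ?thesis using PiE_mem[OF x(2), of i] i by simp
      qed
      then show "y \<in> U" using K[OF x(1)] y by blast
    qed
  qed
  ultimately show ?L by (auto simp: openin_subtopology)
qed

lemma continuous_into_discrete_product:
  fixes f :: "'x \<Rightarrow> 'i \<Rightarrow> 'b"
  assumes "f \<in> topspace X \<rightarrow> S" "S \<subseteq> extensional I"
    and "\<And>i c. i \<in> I \<Longrightarrow> openin X {x\<in>topspace X. f x i = c}"
  shows "continuous_map X (subtopology (product_topology (\<lambda>_. discrete_topology UNIV) I) S) f"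
proof -
  have "continuous_map X (discrete_topology UNIV) (\<lambda>x. f x i)" if i: "i \<in> I" for i
    unfolding continuous_map
  proof (intro conjI allI impI)
    fix U :: "'b set"
    have "{x\<in>topspace X. f x i \<in> U} = (\<Union>c\<in>U. {x\<in>topspace X. f x i = c})" by blast
    then show "openin X {x\<in>topspace X. f x i \<in> U}" using assms(3)[OF i] by auto
  qed auto
  then show ?thesis
    using assms(1,2) by (auto simp: continuous_map_in_subtopology continuous_map_componentwise)
qed

lemma space_borel_of [simp]: "space (borel_of X) = topspace X"
  by (simp add: borel_of_def space_measure_of_conv)

lemma sets_borel_of: "sets (borel_of X) = sigma_sets (topspace X) {U. openin X U}"
  unfolding borel_of_def by (rule sets_measure_of) (auto dest: openin_subset)

lemma openin_borel_of: "openin X U \<Longrightarrow> U \<in> sets (borel_of X)"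
  by (auto simp: sets_borel_of)

lemma measurable_borel_ofI:
  assumes "f \<in> space M \<rightarrow> topspace X"
    and "\<And>U. openin X U \<Longrightarrow> f -` U \<inter> space M \<in> sets M"
  shows "f \<in> measurable M (borel_of X)"
  by (rule measurable_sigma_sets[OF sets_borel_of]) (use assms in \<open>auto dest: openin_subset\<close>)

lemma continuous_map_measurable_borel_of:
  assumes "continuous_map X Z f"
  shows "f \<in> measurable (borel_of X) (borel_of Z)"
proof (rule measurable_borel_ofI)
  show "f \<in> space (borel_of X) \<rightarrow> topspace Z" using assms by (auto simp: continuous_map_def)
  fix U assume "openin Z U"
  then have "openin X {x\<in>topspace X. f x \<in> U}" using assms by (auto simp: continuous_map_def)
  moreover have "{x\<in>topspace X. f x \<in> U} = f -` U \<inter> space (borel_of X)" by auto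
  ultimately show "f -` U \<inter> space (borel_of X) \<in> sets (borel_of X)"
    using openin_borel_of by metis
qed

text \<open>Countably many coordinates and countably many admissible values suffice to test
  measurability coordinatewise.\<close>

lemma measurable_into_discrete_product:
  fixes f :: "'x \<Rightarrow> 'i \<Rightarrow> 'b"
  assumes f: "f \<in> space M \<rightarrow> S" and S: "S \<subseteq> extensional I" and I: "countable I"
    and C: "countable C" "\<And>y i. y \<in> S \<Longrightarrow> i \<in> I \<Longrightarrow> y i \<in> C"
    and meas: "\<And>i c. i \<in> I \<Longrightarrow> {x\<in>space M. f x i = c} \<in> sets M"
  shows "f \<in> measurable M (borel_of (subtopology (product_topology (\<lambda>_. discrete_topology UNIV) I) S))"
proof (rule measurable_borel_ofI)
  show "f \<in> space M \<rightarrow> topspace (subtopology (product_topology (\<lambda>_. discrete_topology UNIV) I) S)"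
    using f S by (auto simp: PiE_iff extensional_def Pi_iff subset_iff)
  fix U assume "openin (subtopology (product_topology (\<lambda>_. discrete_topology UNIV) I) S) U"
  then have U: "U \<subseteq> S" "\<And>x. x \<in> U \<Longrightarrow> \<exists>K. finite K \<and> K \<subseteq> I \<and> {y\<in>S. \<forall>i\<in>K. y i = x i} \<subseteq> U"
    using openin_discrete_product_iff[OF S] by blast+
  define P where "P = {p. finite p \<and> p \<subseteq> I \<times> C \<and> {y\<in>S. \<forall>(i,c)\<in>p. y i = c} \<subseteq> U}"
  have P: "countable P"
  proof (rule countable_subset)
    show "P \<subseteq> {p. finite p \<and> p \<subseteq> I \<times> C}" by (auto simp: P_def)
    show "countable {p. finite p \<and> p \<subseteq> I \<times> C}"
      using countable_Collect_finite_subset[of "I \<times> C"] I C(1) by auto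
  qed
  have "f -` U \<inter> space M = (\<Union>p\<in>P. {x\<in>space M. \<forall>(i,c)\<in>p. f x i = c})"
  proof (intro equalityI subsetI)
    fix x assume x: "x \<in> f -` U \<inter> space M"
    then have "f x \<in> U" "x \<in> space M" by auto
    obtain K where K: "finite K \<and> K \<subseteq> I \<and> {y\<in>S. \<forall>i\<in>K. y i = f x i} \<subseteq> U"
      using U(2)[OF \<open>f x \<in> U\<close>] ..
    have "f x \<in> S" using f \<open>x \<in> space M\<close> by blast
    then have "(\<lambda>i. (i, f x i)) ` K \<subseteq> I \<times> C"
      using K C(2) by auto
    then have "(\<lambda>i. (i, f x i)) ` K \<in> P"
      using K unfolding P_def by simp
    then show "x \<in> (\<Union>p\<in>P. {x\<in>space M. \<forall>(i,c)\<in>p. f x i = c})"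
      by (rule UN_I) (use \<open>x \<in> space M\<close> in simp)
  next
    fix x assume "x \<in> (\<Union>p\<in>P. {x\<in>space M. \<forall>(i,c)\<in>p. f x i = c})"
    then show "x \<in> f -` U \<inter> space M" using f by (auto simp: P_def)
  qed
  also have "\<dots> \<in> sets M"
  proof (rule sets.countable_UN'[OF P])
    show "(\<lambda>p. {x\<in>space M. \<forall>(i,c)\<in>p. f x i = c}) ` P \<subseteq> sets M"
    proof safe
      fix p assume p: "p \<in> P"
      have "{x\<in>space M. \<forall>q\<in>p. f x (fst q) = snd q} \<in> sets M"
        by (rule sets.sets_Collect_finite_All) (use p meas in \<open>auto simp: P_def\<close>)
      then show "{x\<in>space M. \<forall>(i,c)\<in>p. f x i = c} \<in> sets M"
        by (simp add: case_prod_beta)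
    qed
  qed
  finally show "f -` U \<inter> space M \<in> sets M" .
qed


section \<open>Residual chains and their odometers\<close>

locale residual_chain = group G for G :: "('g, 'm) monoid_scheme" (structure) +
  fixes \<Gamma> :: "nat \<Rightarrow> 'g set"
  assumes normal_chain: "\<Gamma> n \<lhd> G"
    and finite_index: "finite (rcosets (\<Gamma> n))"
    and chain_decreasing: "\<Gamma> (Suc n) \<subseteq> \<Gamma> n"
    and chain_Inter: "(\<Inter>n. \<Gamma> n) = {\<one>}"
    and countable_carrier: "countable (carrier G)"
    and infinite_carrier: "infinite (carrier G)"
begin

abbreviation Y :: "(nat \<Rightarrow> 'g set) set" where "Y \<equiv> odometer G \<Gamma>"
abbreviation act :: "'g \<Rightarrow> (nat \<Rightarrow> 'g set) \<Rightarrow> (nat \<Rightarrow> 'g set)" where "act \<equiv> odometer_action G"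

definition idx :: "nat \<Rightarrow> nat" where "idx n = card (rcosets (\<Gamma> n))"

lemma subgroup_chain: "subgroup (\<Gamma> n) G"
  using normal_chain normal_imp_subgroup by blast

lemma chain_antimono: "m \<le> n \<Longrightarrow> \<Gamma> n \<subseteq> \<Gamma> m"
  by (rule lift_Suc_antimono_le[of \<Gamma>]) (use chain_decreasing in auto)

lemma chain_carrier: "\<gamma> \<in> \<Gamma> n \<Longrightarrow> \<gamma> \<in> carrier G"
  using subgroup.subset[OF subgroup_chain] by blast

lemma chain_one: "\<one> \<in> \<Gamma> n"
  using subgroup.one_closed[OF subgroup_chain] .

lemma chain_mult: "a \<in> \<Gamma> n \<Longrightarrow> b \<in> \<Gamma> n \<Longrightarrow> a \<otimes> b \<in> \<Gamma> n"
  using subgroup.m_closed[OF subgroup_chain] .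

lemma chain_inv: "a \<in> \<Gamma> n \<Longrightarrow> inv a \<in> \<Gamma> n"
  using subgroup.m_inv_closed[OF subgroup_chain] .

lemma chain_conj: "a \<in> \<Gamma> n \<Longrightarrow> g \<in> carrier G \<Longrightarrow> g \<otimes> a \<otimes> inv g \<in> \<Gamma> n"
  using normal.inv_op_closed2[OF normal_chain] by blast

lemma chain_conj': "a \<in> \<Gamma> n \<Longrightarrow> g \<in> carrier G \<Longrightarrow> inv g \<otimes> a \<otimes> g \<in> \<Gamma> n"
  using normal.inv_op_closed1[OF normal_chain] by blast

lemma eventually_avoids:
  assumes "finite T"
  shows "\<exists>n0. \<forall>n\<ge>n0. \<Gamma> n \<inter> T \<subseteq> {\<one>}"
proof -
  have "\<exists>n. t \<noteq> \<one> \<longrightarrow> t \<notin> \<Gamma> n" for t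
    using chain_Inter by blast
  then obtain f where f: "\<And>t. t \<noteq> \<one> \<Longrightarrow> t \<notin> \<Gamma> (f t)" by metis
  show ?thesis
  proof (intro exI allI impI subsetI)
    fix n t assume n: "n \<ge> Max (insert 0 (f ` T))" and t: "t \<in> \<Gamma> n \<inter> T"
    have "f t \<le> n" using n t assms by (auto intro: order_trans[OF Max_ge])
    then show "t \<in> {\<one>}" using f[of t] t chain_antimono by blast
  qed
qed

lemma lcoset_mem_iff: 
  assumes "g \<in> carrier G" "h \<in> carrier G"
  shows "h \<in> g <# \<Gamma> n \<longleftrightarrow> inv g \<otimes> h \<in> \<Gamma> n"
proof
  assume "h \<in> g <# \<Gamma> n"
  then obtain \<gamma> where \<gamma>: "\<gamma> \<in> \<Gamma> n" "h = g \<otimes> \<gamma>" by (auto simp: l_coset_def)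
  then show "inv g \<otimes> h \<in> \<Gamma> n"
    using assms chain_carrier by (simp add: m_assoc[symmetric])
next
  assume *: "inv g \<otimes> h \<in> \<Gamma> n"
  have "h = g \<otimes> (inv g \<otimes> h)" using assms by (simp add: m_assoc[symmetric])
  then show "h \<in> g <# \<Gamma> n" using * by (auto simp: l_coset_def)
qed

lemma lcoset_carrier: "g \<in> carrier G \<Longrightarrow> h \<in> g <# \<Gamma> n \<Longrightarrow> h \<in> carrier G"
  by (auto simp: l_coset_def chain_carrier)

lemma lcoset_self: "g \<in> carrier G \<Longrightarrow> g \<in> g <# \<Gamma> n"
  by (simp add: lcoset_mem_iff chain_one)

lemma lcoset_eq:
  assumes "g \<in> carrier G" "h \<in> g <# \<Gamma> n"
  shows "h <# \<Gamma> n = g <# \<Gamma> n"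
  using l_repr_independence[OF assms(2,1) subgroup_chain] by simp

lemma lcoset_rcosets: "g \<in> carrier G \<Longrightarrow> g <# \<Gamma> n \<in> rcosets (\<Gamma> n)"
  using normal.coset_eq[OF normal_chain[of n]] by (auto simp: RCOSETS_def)

lemma rcosets_lcoset: "C \<in> rcosets (\<Gamma> n) \<Longrightarrow> \<exists>g\<in>carrier G. C = g <# \<Gamma> n"
  using normal.coset_eq[OF normal_chain[of n]] by (auto simp: RCOSETS_def)

lemma rcosets_eq_lcosets: "rcosets (\<Gamma> n) = (\<lambda>g. g <# \<Gamma> n) ` carrier G"
  using lcoset_rcosets[of _ n] rcosets_lcoset[of _ n] by blast

lemma idx_pos: "idx n > 0"
  unfolding idx_def using finite_index lcoset_rcosets[OF one_closed]
  by (auto simp: card_gt_0_iff)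

text \<open>The indices tend to infinity because finitely many elements of \<open>G\<close> are eventually
  separated.\<close>

lemma idx_unbounded: "\<exists>n0. \<forall>n\<ge>n0. idx n \<ge> M"
proof -
  obtain T where T: "T \<subseteq> carrier G" "finite T" "card T = M"
    using infinite_carrier infinite_arbitrarily_large by metis
  obtain n0 where n0: "\<And>n. n \<ge> n0 \<Longrightarrow> \<Gamma> n \<inter> (\<lambda>(a,b). inv a \<otimes> b) ` (T \<times> T) \<subseteq> {\<one>}"
    using eventually_avoids[of "(\<lambda>(a,b). inv a \<otimes> b) ` (T \<times> T)"] T by auto
  have "idx n \<ge> M" if n: "n \<ge> n0" for n
  proof -
    have "inj_on (\<lambda>g. g <# \<Gamma> n) T"
    proof (rule inj_onI)
      fix a b assume ab: "a \<in> T" "b \<in> T" "a <# \<Gamma> n = b <# \<Gamma> n"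
      then have abc: "a \<in> carrier G" "b \<in> carrier G" using T by auto
      then have "b \<in> a <# \<Gamma> n" using ab lcoset_self by simp
      then have "inv a \<otimes> b \<in> \<Gamma> n" using abc lcoset_mem_iff by simp
      then have "inv a \<otimes> b = \<one>" using n0[OF n] ab by force
      then show "a = b" using abc by (metis inv_equality inv_inv inv_closed)
    qed
    then have "card T \<le> card (rcosets (\<Gamma> n))"
      by (rule card_inj_on_le) (use T lcoset_rcosets finite_index in auto)
    then show ?thesis using T by (simp add: idx_def)
  qed
  then show ?thesis by blast
qed

lemma inverse_idx_small:
  assumes "(\<epsilon>::real) > 0"
  shows "\<exists>n0. \<forall>n\<ge>n0. 1 / real (idx n) < \<epsilon>"
proof -
  obtain M :: nat where M: "1 / \<epsilon> < real M" using reals_Archimedean2 by blast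
  obtain n0 where n0: "\<And>n. n \<ge> n0 \<Longrightarrow> idx n \<ge> M" using idx_unbounded by blast
  have "1 / real (idx n) < \<epsilon>" if "n \<ge> n0" for n
  proof -
    have "1 / \<epsilon> < real (idx n)" using M n0[OF that] by linarith
    then show ?thesis using assms idx_pos[of n] by (simp add: field_simps)
  qed
  then show ?thesis by blast
qed

subsection \<open>Points of the odometer\<close>

text \<open>A point \<open>\<xi>\<close> is handled through the relation \<open>g \<in> \<xi> n\<close>, which says that \<open>\<xi>\<close> and
  the image of \<open>g\<close> in the odometer agree up to level \<open>n\<close>.\<close>

lemma Y_ex: "\<xi> \<in> Y \<Longrightarrow> \<exists>g\<in>carrier G. \<xi> n = g <# \<Gamma> n"
  unfolding odometer_def by blast

lemma Y_carrier: "\<xi> \<in> Y \<Longrightarrow> g \<in> \<xi> n \<Longrightarrow> g \<in> carrier G"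
  using Y_ex lcoset_carrier by metis

lemma Y_coset: "\<xi> \<in> Y \<Longrightarrow> g \<in> \<xi> n \<Longrightarrow> \<xi> n = g <# \<Gamma> n"
  using Y_ex lcoset_eq by metis

lemma Y_nonempty: "\<xi> \<in> Y \<Longrightarrow> \<exists>g. g \<in> \<xi> n"
  using Y_ex lcoset_self by metis

lemma Y_Suc: assumes "\<xi> \<in> Y" shows "\<xi> (Suc n) \<subseteq> \<xi> n"
proof -
  obtain g where g: "\<And>n. g n \<in> carrier G \<and> \<xi> n = g n <# \<Gamma> n" "\<And>n. g (Suc n) <# \<Gamma> n = g n <# \<Gamma> n"
    using assms unfolding odometer_def by blast
  have "\<xi> (Suc n) = g (Suc n) <# \<Gamma> (Suc n)" using g by blast
  also have "\<dots> \<subseteq> g (Suc n) <# \<Gamma> n" using chain_decreasing[of n] by (auto simp: l_coset_def)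
  also have "\<dots> = \<xi> n" using g by blast
  finally show ?thesis .
qed

lemma Y_antimono: "\<xi> \<in> Y \<Longrightarrow> m \<le> n \<Longrightarrow> \<xi> n \<subseteq> \<xi> m"
  by (rule lift_Suc_antimono_le[of \<xi>]) (auto intro: Y_Suc[THEN subsetD])

lemma Y_mult: "\<xi> \<in> Y \<Longrightarrow> g \<in> \<xi> n \<Longrightarrow> \<gamma> \<in> \<Gamma> n \<Longrightarrow> g \<otimes> \<gamma> \<in> \<xi> n"
  using Y_coset by (fastforce simp: l_coset_def)

lemma Y_memE:
  assumes "\<xi> \<in> Y" "g \<in> \<xi> n" "h \<in> \<xi> n"
  obtains \<gamma> where "\<gamma> \<in> \<Gamma> n" "h = g \<otimes> \<gamma>"
  using assms Y_coset[of \<xi> g n] by (auto simp: l_coset_def)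

lemma YI:
  assumes "\<And>n. \<exists>g\<in>carrier G. \<xi> n = g <# \<Gamma> n" "\<And>n. \<xi> (Suc n) \<subseteq> \<xi> n"
  shows "\<xi> \<in> Y"
proof -
  obtain g where g: "\<And>n. g n \<in> carrier G" "\<And>n. \<xi> n = g n <# \<Gamma> n" using assms(1) by metis
  have "g (Suc n) <# \<Gamma> n = g n <# \<Gamma> n" for n
  proof (rule lcoset_eq)
    show "g (Suc n) \<in> g n <# \<Gamma> n" using assms(2)[of n] g lcoset_self by auto
  qed (use g in auto)
  then show ?thesis unfolding odometer_def using g by blast
qed

lemma Y_eqI:
  assumes "\<xi> \<in> Y" "\<eta> \<in> Y" "\<And>n. \<exists>g. g \<in> \<xi> n \<and> g \<in> \<eta> n"
  shows "\<xi> = \<eta>"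
  using assms by (metis Y_coset ext)

definition emb :: "'g \<Rightarrow> nat \<Rightarrow> 'g set" where "emb g = (\<lambda>n. g <# \<Gamma> n)"

lemma emb_Y: "g \<in> carrier G \<Longrightarrow> emb g \<in> Y"
  unfolding emb_def using chain_decreasing by (intro YI) (auto simp: l_coset_def)

lemma emb_self: "g \<in> carrier G \<Longrightarrow> g \<in> emb g n"
  by (simp add: emb_def lcoset_self)

lemma act_mem: "g \<in> \<xi> n \<Longrightarrow> h \<otimes> g \<in> act h \<xi> n"
  by (auto simp: odometer_action_def l_coset_def)

lemma act_Y: assumes "\<xi> \<in> Y" "h \<in> carrier G" shows "act h \<xi> \<in> Y"
proof (rule YI)
  fix n
  obtain g where g: "g \<in> carrier G" "\<xi> n = g <# \<Gamma> n" using Y_ex[OF assms(1)] by blast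
  then have "act h \<xi> n = (h \<otimes> g) <# \<Gamma> n"
    using assms(2) lcos_m_assoc[OF subgroup.subset[OF subgroup_chain]]
    by (simp add: odometer_action_def)
  then show "\<exists>g\<in>carrier G. act h \<xi> n = g <# \<Gamma> n" using g assms by blast
  show "act h \<xi> (Suc n) \<subseteq> act h \<xi> n"
    using Y_Suc[OF assms(1), of n] by (auto simp: odometer_action_def l_coset_def)
qed

lemma act_mult:
  assumes "\<xi> \<in> Y" "g \<in> carrier G" "h \<in> carrier G"
  shows "act (g \<otimes> h) \<xi> = act g (act h \<xi>)"
proof (rule Y_eqI)
  fix n
  obtain a where a: "a \<in> \<xi> n" using Y_nonempty assms by blast
  have "g \<otimes> h \<otimes> a \<in> act (g \<otimes> h) \<xi> n" using a act_mem by blast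
  moreover have "g \<otimes> (h \<otimes> a) \<in> act g (act h \<xi>) n" using a act_mem by blast
  ultimately show "\<exists>x. x \<in> act (g \<otimes> h) \<xi> n \<and> x \<in> act g (act h \<xi>) n"
    using assms a Y_carrier[of \<xi> a n] by (auto simp: m_assoc)
qed (use assms act_Y in auto)

lemma act_one: "\<xi> \<in> Y \<Longrightarrow> act \<one> \<xi> = \<xi>"
proof (rule Y_eqI)
  fix n assume "\<xi> \<in> Y"
  then obtain a where a: "a \<in> \<xi> n" using Y_nonempty by blast
  then show "\<exists>x. x \<in> act \<one> \<xi> n \<and> x \<in> \<xi> n"
    using act_mem[where h = \<one>, of a \<xi> n] a Y_carrier[OF \<open>\<xi> \<in> Y\<close> a] by auto
qed (use act_Y in auto)

lemma act_inv: "\<xi> \<in> Y \<Longrightarrow> g \<in> carrier G \<Longrightarrow> act (inv g) (act g \<xi>) = \<xi>"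
  "\<xi> \<in> Y \<Longrightarrow> g \<in> carrier G \<Longrightarrow> act g (act (inv g) \<xi>) = \<xi>"
  using act_mult[of \<xi> "inv g" g] act_mult[of \<xi> g "inv g"] act_one by auto

lemma act_image_Y: "g \<in> carrier G \<Longrightarrow> act g ` Y = Y"
  using act_Y act_inv(2) by (auto simp: image_iff) (metis inv_closed)

lemma act_mem_iff:
  assumes "\<xi> \<in> Y" "h \<in> carrier G" "g \<in> carrier G"
  shows "g \<in> act h \<xi> n \<longleftrightarrow> inv h \<otimes> g \<in> \<xi> n"
proof
  assume "g \<in> act h \<xi> n"
  then have "inv h \<otimes> g \<in> act (inv h) (act h \<xi>) n" by (rule act_mem)
  then show "inv h \<otimes> g \<in> \<xi> n" using assms by (simp add: act_inv)
next
  assume "inv h \<otimes> g \<in> \<xi> n"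
  then have "h \<otimes> (inv h \<otimes> g) \<in> act h \<xi> n" by (rule act_mem)
  then show "g \<in> act h \<xi> n"
    using assms by (simp add: m_assoc[symmetric])
qed

subsection \<open>Periodic sets\<close>

definition periodic :: "'g set \<Rightarrow> 'g set \<Rightarrow> bool" where
  "periodic \<Lambda> V \<longleftrightarrow> V \<subseteq> carrier G \<and> (\<forall>x\<in>V. \<forall>\<gamma>\<in>\<Lambda>. x \<otimes> \<gamma> \<in> V)"

lemma periodic_mult_iff:
  assumes "periodic \<Lambda> V" "subgroup \<Lambda> G" "x \<in> carrier G" "\<gamma> \<in> \<Lambda>"
  shows "x \<otimes> \<gamma> \<in> V \<longleftrightarrow> x \<in> V"
proof
  assume "x \<otimes> \<gamma> \<in> V"
  then have "x \<otimes> \<gamma> \<otimes> inv \<gamma> \<in> V"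
    using assms subgroup.m_inv_closed unfolding periodic_def by metis
  moreover have "\<gamma> \<in> carrier G" using assms subgroup.mem_carrier by metis
  ultimately show "x \<in> V" using assms by (simp add: m_assoc)
qed (use assms in \<open>auto simp: periodic_def\<close>)

lemma periodic_mono: "periodic \<Lambda> V \<Longrightarrow> \<Lambda>' \<subseteq> \<Lambda> \<Longrightarrow> periodic \<Lambda>' V"
  unfolding periodic_def by blast

lemma periodic_Un: "periodic \<Lambda> V \<Longrightarrow> periodic \<Lambda> W \<Longrightarrow> periodic \<Lambda> (V \<union> W)"
  unfolding periodic_def by blast

lemma periodic_Diff: "subgroup \<Lambda> G \<Longrightarrow> periodic \<Lambda> V \<Longrightarrow> periodic \<Lambda> W \<Longrightarrow> periodic \<Lambda> (V - W)"
  using periodic_mult_iff[of \<Lambda> W] by (auto simp: periodic_def)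

text \<open>For a set that is periodic at some level, this is the clopen subset of the odometer
  that it represents.\<close>

definition hat :: "'g set \<Rightarrow> (nat \<Rightarrow> 'g set) set" where
  "hat V = {\<xi> \<in> Y. \<exists>n. \<xi> n \<subseteq> V}"

lemma hat_subset_Y: "hat V \<subseteq> Y"
  by (auto simp: hat_def)

lemma hat_mono: "V \<subseteq> W \<Longrightarrow> hat V \<subseteq> hat W"
  by (auto simp: hat_def)

text \<open>Membership in a periodic set is constant on cosets, so a single level decides it, whatever
  witness level the definition provides.\<close>

lemma hat_iff:
  assumes "periodic (\<Gamma> n) V" "\<xi> \<in> Y" "g \<in> \<xi> n"
  shows "\<xi> \<in> hat V \<longleftrightarrow> g \<in> V"
proof
  assume "\<xi> \<in> hat V"
  then obtain m where m: "\<xi> m \<subseteq> V" by (auto simp: hat_def)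
  obtain a where a: "a \<in> \<xi> (max m n)" using Y_nonempty assms by blast
  then have "a \<in> \<xi> m" "a \<in> \<xi> n" using Y_antimono[OF assms(2)] by (meson max.cobounded1 max.cobounded2 subsetD)+
  with m have "a \<in> V" by blast
  obtain \<gamma> where "\<gamma> \<in> \<Gamma> n" "a = g \<otimes> \<gamma>" using Y_memE[OF assms(2,3) \<open>a \<in> \<xi> n\<close>] .
  then show "g \<in> V"
    using \<open>a \<in> V\<close> periodic_mult_iff[OF assms(1) subgroup_chain] Y_carrier[OF assms(2,3)] by blast
next
  assume "g \<in> V"
  then have "\<xi> n \<subseteq> V"
    using Y_coset[OF assms(2,3)] assms(1) by (auto simp: l_coset_def periodic_def)
  then show "\<xi> \<in> hat V" using assms(2) by (auto simp: hat_def)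
qed

lemma hat_eq:
  assumes "periodic (\<Gamma> n) V"
  shows "hat V = {\<xi> \<in> Y. \<xi> n \<subseteq> V}"
proof
  show "hat V \<subseteq> {\<xi> \<in> Y. \<xi> n \<subseteq> V}"
    using hat_iff[OF assms] hat_subset_Y by blast
qed (auto simp: hat_def)

definition cyl :: "nat \<Rightarrow> 'g \<Rightarrow> (nat \<Rightarrow> 'g set) set" where
  "cyl n g = {\<xi> \<in> Y. g \<in> \<xi> n}"

lemma periodic_lcoset: "g \<in> carrier G \<Longrightarrow> periodic (\<Gamma> n) (g <# \<Gamma> n)"
  by (auto simp: periodic_def l_coset_def chain_carrier m_assoc intro!: chain_mult)

lemma hat_lcoset:
  assumes "g \<in> carrier G"
  shows "hat (g <# \<Gamma> n) = cyl n g"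
proof -
  have "\<xi> n \<subseteq> g <# \<Gamma> n \<longleftrightarrow> g \<in> \<xi> n" if \<xi>: "\<xi> \<in> Y" for \<xi>
  proof
    assume *: "\<xi> n \<subseteq> g <# \<Gamma> n"
    obtain a where a: "a \<in> \<xi> n" using Y_nonempty[OF \<xi>] by blast
    then have "\<xi> n = a <# \<Gamma> n" "a <# \<Gamma> n = g <# \<Gamma> n"
      using * Y_coset[OF \<xi> a] lcoset_eq[OF assms] by blast+
    then show "g \<in> \<xi> n" using lcoset_self[OF assms] by simp
  next
    assume "g \<in> \<xi> n"
    then show "\<xi> n \<subseteq> g <# \<Gamma> n" using Y_coset[OF \<xi>] by simp
  qed
  then show ?thesis
    unfolding hat_eq[OF periodic_lcoset[OF assms]] cyl_def by auto
qed

end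


section \<open>The unique invariant measure of the odometer\<close>

context residual_chain
begin

abbreviation YT :: "(nat \<Rightarrow> 'g set) topology" where "YT \<equiv> odometer_topology G \<Gamma>"

lemma topspace_YT [simp]: "topspace YT = Y"
  by (simp add: odometer_topology_def)

lemma openin_YT_iff:
  "openin YT U \<longleftrightarrow> U \<subseteq> Y \<and> (\<forall>\<xi>\<in>U. \<exists>n. \<exists>g\<in>\<xi> n. cyl n g \<subseteq> U)"
proof -
  have "(\<exists>K::nat set. finite K \<and> {\<eta>\<in>Y. \<forall>i\<in>K. \<eta> i = \<xi> i} \<subseteq> U) \<longleftrightarrow> (\<exists>n. \<exists>g\<in>\<xi> n. cyl n g \<subseteq> U)"
    if \<xi>: "\<xi> \<in> Y" for \<xi>
  proof
    assume "\<exists>K::nat set. finite K \<and> {\<eta>\<in>Y. \<forall>i\<in>K. \<eta> i = \<xi> i} \<subseteq> U"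
    then obtain K :: "nat set" where K: "finite K" "{\<eta>\<in>Y. \<forall>i\<in>K. \<eta> i = \<xi> i} \<subseteq> U" by blast
    define n where "n = Max (insert 0 K)"
    obtain g where g: "g \<in> \<xi> n" using Y_nonempty \<xi> by blast
    have "cyl n g \<subseteq> U"
    proof
      fix \<eta> assume "\<eta> \<in> cyl n g"
      then have \<eta>: "\<eta> \<in> Y" "g \<in> \<eta> n" by (auto simp: cyl_def)
      have "\<eta> i = \<xi> i" if "i \<in> K" for i
      proof -
        have "i \<le> n" using that K by (simp add: n_def)
        then have "g \<in> \<xi> i" "g \<in> \<eta> i" using g \<eta> \<xi> Y_antimono by blast+
        then show ?thesis using Y_coset \<eta> \<xi> by metis
      qed
      then show "\<eta> \<in> U" using K \<eta> by blast
    qed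
    then show "\<exists>n. \<exists>g\<in>\<xi> n. cyl n g \<subseteq> U" using g by blast
  next
    assume "\<exists>n. \<exists>g\<in>\<xi> n. cyl n g \<subseteq> U"
    then obtain n g where "g \<in> \<xi> n" "cyl n g \<subseteq> U" by blast
    then show "\<exists>K::nat set. finite K \<and> {\<eta>\<in>Y. \<forall>i\<in>K. \<eta> i = \<xi> i} \<subseteq> U"
      by (intro exI[of _ "{n}"]) (auto simp: cyl_def)
  qed
  then have "U \<subseteq> Y \<Longrightarrow> (\<forall>\<xi>\<in>U. \<exists>K::nat set. finite K \<and> {\<eta>\<in>Y. \<forall>i\<in>K. \<eta> i = \<xi> i} \<subseteq> U)
      \<longleftrightarrow> (\<forall>\<xi>\<in>U. \<exists>n. \<exists>g\<in>\<xi> n. cyl n g \<subseteq> U)"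
    by (intro ball_cong refl) (auto simp only: subset_iff)
  then show ?thesis
    using openin_discrete_product_iff[of Y UNIV U] by (auto simp: odometer_topology_def)
qed

lemma openin_cyl: "openin YT (cyl n g)"
  unfolding openin_YT_iff by (auto simp: cyl_def)

lemma openin_hat: "openin YT (hat V)"
  unfolding openin_YT_iff
proof (intro conjI ballI)
  fix \<xi> assume "\<xi> \<in> hat V"
  then obtain n where \<xi>: "\<xi> \<in> Y" "\<xi> n \<subseteq> V" by (auto simp: hat_def)
  obtain g where g: "g \<in> \<xi> n" using \<xi> Y_nonempty by blast
  have "cyl n g \<subseteq> hat V"
  proof
    fix \<eta> assume "\<eta> \<in> cyl n g"
    then have "\<eta> \<in> Y" "\<eta> n = \<xi> n" using Y_coset g \<xi> unfolding cyl_def by blast+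
    then show "\<eta> \<in> hat V" using \<xi> by (auto simp: hat_def)
  qed
  then show "\<exists>n. \<exists>g\<in>\<xi> n. cyl n g \<subseteq> hat V" using g by blast
qed (rule hat_subset_Y)

lemma hat_sets: "hat V \<in> sets (borel_of YT)"
  using openin_hat openin_borel_of by blast

lemma cyl_sets: "cyl n g \<in> sets (borel_of YT)"
  using openin_cyl openin_borel_of by blast

lemma continuous_act: 
  assumes "h \<in> carrier G" shows "continuous_map YT YT (act h)"
  unfolding continuous_map
proof (intro conjI allI impI)
  show "act h ` topspace YT \<subseteq> topspace YT" using act_Y assms by auto
  fix U assume U: "openin YT U"
  show "openin YT {\<xi>\<in>topspace YT. act h \<xi> \<in> U}"
    unfolding openin_YT_iff
  proof (intro conjI ballI)
    fix \<xi> assume "\<xi> \<in> {\<xi>\<in>topspace YT. act h \<xi> \<in> U}"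
    then have \<xi>: "\<xi> \<in> Y" "act h \<xi> \<in> U" by auto
    then obtain n g where g: "g \<in> act h \<xi> n" "cyl n g \<subseteq> U" using U openin_YT_iff by blast
    have gc: "g \<in> carrier G" using Y_carrier act_Y \<xi> assms g by blast
    have "inv h \<otimes> g \<in> \<xi> n" using g \<xi> gc act_mem_iff assms by blast
    moreover have "cyl n (inv h \<otimes> g) \<subseteq> {\<xi>\<in>topspace YT. act h \<xi> \<in> U}"
      using g(2) act_mem_iff[OF _ assms gc] act_Y assms by (auto simp: cyl_def)
    ultimately show "\<exists>n. \<exists>g\<in>\<xi> n. cyl n g \<subseteq> {\<xi>\<in>topspace YT. act h \<xi> \<in> U}" by blast
  qed auto
qed

lemma act_vimage_cyl:
  assumes "h \<in> carrier G" "g \<in> carrier G"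
  shows "act h -` cyl n g \<inter> Y = cyl n (inv h \<otimes> g)"
  using act_mem_iff[OF _ assms] act_Y[OF _ assms(1)] by (auto simp: cyl_def)

lemma cyl_eq: "g \<in> carrier G \<Longrightarrow> cyl n g = {\<xi>\<in>Y. \<xi> n = g <# \<Gamma> n}"
  unfolding cyl_def using Y_coset[of _ g n] lcoset_self[of g n] by (intro Collect_cong) metis

abbreviation YM where "YM \<equiv> borel_of YT"

lemma sets_YM: "sets YM = sigma_sets Y ({{}, Y} \<union> {cyl n g | n g. g \<in> carrier G})"
proof (rule antisym)
  let ?E = "{{}, Y} \<union> {cyl n g | n g. g \<in> carrier G}"
  interpret E: sigma_algebra Y "sigma_sets Y ?E"
    by (rule sigma_algebra_sigma_sets) (auto simp: cyl_def)
  have "U \<in> sigma_sets Y ?E" if U: "openin YT U" for U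
  proof -
    have "U = (\<Union>(n,g)\<in>{(n,g). g \<in> carrier G \<and> cyl n g \<subseteq> U}. cyl n g)"
    proof (intro equalityI subsetI)
      fix \<xi> assume \<xi>: "\<xi> \<in> U"
      then obtain n g where g: "g \<in> \<xi> n" "cyl n g \<subseteq> U" using U openin_YT_iff by blast
      have "\<xi> \<in> Y" using \<xi> U openin_YT_iff by blast
      then have "\<xi> \<in> cyl n g" "g \<in> carrier G" using g Y_carrier by (auto simp: cyl_def)
      then show "\<xi> \<in> (\<Union>(n,g)\<in>{(n,g). g \<in> carrier G \<and> cyl n g \<subseteq> U}. cyl n g)" using g by blast
    qed auto
    also have "\<dots> \<in> sigma_sets Y ?E"
    proof (rule E.countable_UN')
      show "countable {(n,g). g \<in> carrier G \<and> cyl n g \<subseteq> U}"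
        by (rule countable_subset[of _ "UNIV \<times> carrier G"]) (use countable_carrier in auto)
    qed auto
    finally show ?thesis .
  qed
  then show "sets YM \<subseteq> sigma_sets Y ?E"
    unfolding sets_borel_of topspace_YT by (intro sigma_sets_mono) auto
  have "Y \<in> sets YM" using openin_borel_of[OF openin_topspace[of YT]] by simp
  then have "?E \<subseteq> sets YM" using cyl_sets by auto
  then show "sigma_sets Y ?E \<subseteq> sets YM"
    using sets.sigma_sets_subset[of ?E YM] by simp
qed

lemma Int_stable_cyl: "Int_stable ({{}, Y} \<union> {cyl n g | n g. g \<in> carrier G})"
proof -
  let ?E = "{{}, Y} \<union> {cyl n g | n g. g \<in> carrier G}"
  have *: "cyl m g \<inter> cyl n h \<in> ?E" if "m \<le> n" "h \<in> carrier G" for m n g h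
  proof (cases "cyl m g \<inter> cyl n h = {}")
    case False
    then obtain \<xi> where \<xi>: "\<xi> \<in> Y" "g \<in> \<xi> m" "h \<in> \<xi> n" by (auto simp: cyl_def)
    have "cyl n h \<subseteq> cyl m g"
    proof
      fix \<eta> assume "\<eta> \<in> cyl n h"
      then have \<eta>: "\<eta> \<in> Y" "h \<in> \<eta> n" by (auto simp: cyl_def)
      have "h \<in> \<eta> m" "h \<in> \<xi> m" using \<eta> \<xi> Y_antimono that by blast+
      then have "\<eta> m = \<xi> m" using Y_coset \<eta> \<xi> by metis
      then show "\<eta> \<in> cyl m g" using \<xi> \<eta> by (auto simp: cyl_def)
    qed
    then have "cyl m g \<inter> cyl n h = cyl n h" by blast
    then show ?thesis using that by blast
  qed simp
  have **: "cyl m g \<inter> cyl n h \<in> ?E" if "g \<in> carrier G" "h \<in> carrier G" for m n g h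
  proof (cases "m \<le> n")
    case True
    then show ?thesis by (rule *[OF _ that(2)])
  next
    case False
    then have "cyl n h \<inter> cyl m g \<in> ?E" by (intro *[OF _ that(1)]) simp
    then show ?thesis by (simp only: Int_commute)
  qed
  have E: "a = {} \<or> a = Y \<or> (\<exists>n. \<exists>g\<in>carrier G. a = cyl n g)" "a \<inter> Y = a" "Y \<inter> a = a" if "a \<in> ?E" for a
    using that by (auto simp: cyl_def)
  show ?thesis
  proof (rule Int_stableI)
    fix a b assume ab: "a \<in> ?E" "b \<in> ?E"
    show "a \<inter> b \<in> ?E"
    proof (cases "a = {} \<or> b = {} \<or> a = Y \<or> b = Y")
      case True
      then have "a \<inter> b \<in> {{}, a, b}" using E(2,3)[OF ab(1)] E(2,3)[OF ab(2)] by auto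
      moreover have "{} \<in> ?E" by simp
      ultimately show ?thesis using ab by (elim insertE) (simp_all only: empty_iff)
    next
      case False
      then obtain m g n h where "a = cyl m g" "b = cyl n h" "g \<in> carrier G" "h \<in> carrier G"
        using E(1)[OF ab(1)] E(1)[OF ab(2)] by (elim disjE exE bexE) simp_all
      then show ?thesis using **[of g h m n] by (simp only:)
    qed
  qed
qed

abbreviation inv_measure where "inv_measure \<equiv> invariant_prob_measure G YT act"

lemma inv_measureD:
  assumes "inv_measure \<mu>"
  shows "prob_space \<mu>" "sets \<mu> = sets YM" "space \<mu> = Y"
    "h \<in> carrier G \<Longrightarrow> A \<in> sets \<mu> \<Longrightarrow> measure \<mu> (act h -` A \<inter> Y) = measure \<mu> A"
proof -
  show 1: "prob_space \<mu>" and 2: "sets \<mu> = sets YM" using assms by (auto simp: invariant_prob_measure_def)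
  then show 3: "space \<mu> = Y" using sets_eq_imp_space_eq[OF 2] by simp
  show "measure \<mu> (act h -` A \<inter> Y) = measure \<mu> A" if "h \<in> carrier G" "A \<in> sets \<mu>"
  proof -
    have "act h \<in> measurable \<mu> \<mu>" "distr \<mu> \<mu> (act h) = \<mu>"
      using assms that by (auto simp: invariant_prob_measure_def)
    then show ?thesis using measure_distr[of "act h" \<mu> \<mu> A] that 3 by simp
  qed
qed

text \<open>Translations permute the cosets of \<open>\<Gamma> n\<close> transitively, so an invariant measure gives all of them
  the same mass. Densities in finite quotients thereby become measures in the odometer.\<close>

lemma measure_hat:
  assumes \<mu>: "inv_measure \<mu>" and V: "periodic (\<Gamma> n) V"
  shows "measure \<mu> (hat V) = real (card {C \<in> rcosets (\<Gamma> n). C \<subseteq> V}) / real (idx n)"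
proof -
  note D = inv_measureD[OF \<mu>]
  interpret prob_space \<mu> by (rule D)
  define cc where "cc C = {\<xi>\<in>Y. \<xi> n = C}" for C
  have ccyl: "cc (g <# \<Gamma> n) = cyl n g" if "g \<in> carrier G" for g
    using cyl_eq that by (simp add: cc_def)
  have eq1: "measure \<mu> (cyl n g) = measure \<mu> (cyl n \<one>)" if "g \<in> carrier G" for g
    using D(4)[of g "cyl n g"] act_vimage_cyl[of g g n] that cyl_sets D(2) by simp
  have meas: "cc C \<in> sets \<mu>" "measure \<mu> (cc C) = measure \<mu> (cyl n \<one>)" if C: "C \<in> rcosets (\<Gamma> n)" for C
  proof -
    obtain g where "g \<in> carrier G" "C = g <# \<Gamma> n" using rcosets_lcoset[OF C] by blast
    then show "cc C \<in> sets \<mu>" "measure \<mu> (cc C) = measure \<mu> (cyl n \<one>)"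
      using ccyl[of g] eq1[of g] cyl_sets[of n g] D(2) by simp_all
  qed
  have sum: "measure \<mu> (\<Union>C\<in>S. cc C) = real (card S) * measure \<mu> (cyl n \<one>)" 
    if S: "S \<subseteq> rcosets (\<Gamma> n)" for S
  proof -
    have "measure \<mu> (\<Union>C\<in>S. cc C) = (\<Sum>C\<in>S. measure \<mu> (cc C))"
      by (rule finite_measure_finite_Union)
         (use S finite_index finite_subset meas in \<open>auto simp: disjoint_family_on_def cc_def\<close>)
    also have "\<dots> = (\<Sum>C\<in>S. measure \<mu> (cyl n \<one>))" using S meas by (intro sum.cong) auto
    finally show ?thesis by simp
  qed
  have in_rcos: "\<xi> n \<in> rcosets (\<Gamma> n)" if "\<xi> \<in> Y" for \<xi>
    using Y_ex[OF that] lcoset_rcosets by metis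
  have "(\<Union>C\<in>rcosets (\<Gamma> n). cc C) = Y" using in_rcos by (auto simp: cc_def)
  then have "1 = real (idx n) * measure \<mu> (cyl n \<one>)"
    using sum[of "rcosets (\<Gamma> n)"] prob_space D(3) by (simp add: idx_def)
  then have "measure \<mu> (cyl n \<one>) = 1 / real (idx n)" using idx_pos[of n] by (simp add: field_simps)
  moreover have "hat V = (\<Union>C\<in>{C \<in> rcosets (\<Gamma> n). C \<subseteq> V}. cc C)"
    using in_rcos by (auto simp: hat_eq[OF V] cc_def)
  ultimately show ?thesis using sum[of "{C \<in> rcosets (\<Gamma> n). C \<subseteq> V}"] by simp
qed

lemma measure_cyl:
  assumes "inv_measure \<mu>" "g \<in> carrier G"
  shows "measure \<mu> (cyl n g) = 1 / real (idx n)"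
proof -
  have "{C \<in> rcosets (\<Gamma> n). C \<subseteq> g <# \<Gamma> n} = {g <# \<Gamma> n}"
  proof (intro equalityI subsetI)
    fix C assume "C \<in> {C \<in> rcosets (\<Gamma> n). C \<subseteq> g <# \<Gamma> n}"
    then obtain a where "a \<in> carrier G" "C = a <# \<Gamma> n" "C \<subseteq> g <# \<Gamma> n" using rcosets_lcoset by blast
    then show "C \<in> {g <# \<Gamma> n}" using lcoset_eq[OF assms(2)] lcoset_self by blast
  qed (use lcoset_rcosets assms in auto)
  then show ?thesis
    using measure_hat[OF assms(1) periodic_lcoset[OF assms(2)]] hat_lcoset[OF assms(2)] by simp
qed

lemma inv_measure_unique:
  assumes "inv_measure \<mu>" "inv_measure \<mu>'"
  shows "\<mu> = \<mu>'"
proof (rule measure_eqI_generator_eq[OF Int_stable_cyl])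
  note D = inv_measureD[OF assms(1)] and D' = inv_measureD[OF assms(2)]
  interpret prob_space \<mu> by (rule D)
  interpret p': prob_space \<mu>' by (rule D')
  show "{{}, Y} \<union> {cyl n g | n g. g \<in> carrier G} \<subseteq> Pow Y" by (auto simp: cyl_def)
  show "sets \<mu> = sigma_sets Y ({{}, Y} \<union> {cyl n g | n g. g \<in> carrier G})"
    "sets \<mu>' = sigma_sets Y ({{}, Y} \<union> {cyl n g | n g. g \<in> carrier G})"
    using D D' sets_YM by auto
  show "emeasure \<mu> A = emeasure \<mu>' A" if "A \<in> {{}, Y} \<union> {cyl n g | n g. g \<in> carrier G}" for A
    using that
  proof (elim UnE insertE)
    assume "A = Y"
    then show ?thesis using emeasure_space_1 p'.emeasure_space_1 D(3) D'(3) by simp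
  next
    assume "A \<in> {cyl n g | n g. g \<in> carrier G}"
    then show ?thesis
      using measure_cyl[OF assms(1)] measure_cyl[OF assms(2)]
      by (auto simp: emeasure_eq_measure p'.emeasure_eq_measure)
  qed auto
  show "range (\<lambda>_::nat. Y) \<subseteq> {{}, Y} \<union> {cyl n g | n g. g \<in> carrier G}" "(\<Union>i::nat. Y) = Y" by auto
  show "emeasure \<mu> Y \<noteq> \<infinity>" by simp
qed

text \<open>Conditioning an invariant measure on an invariant set yields an invariant measure; by
  uniqueness, the odometer is ergodic.\<close>

lemma inv_measure_ergodic:
  assumes \<mu>: "inv_measure \<mu>" and A: "A \<in> sets \<mu>" and
    inv: "\<And>g. g \<in> carrier G \<Longrightarrow> act g -` A \<inter> Y = A"
  shows "emeasure \<mu> A = 0 \<or> emeasure \<mu> A = 1"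
proof (cases "emeasure \<mu> A = 0")
  case False
  note D = inv_measureD[OF \<mu>]
  interpret prob_space \<mu> by (rule D)
  let ?U = "uniform_measure \<mu> A"
  have U: "emeasure ?U B = emeasure \<mu> (A \<inter> B) / emeasure \<mu> A" if "B \<in> sets \<mu>" for B
    using that A by simp
  have "inv_measure ?U"
    unfolding invariant_prob_measure_def
  proof (intro conjI ballI)
    show "prob_space ?U" by (rule prob_space_uniform_measure) (use False in auto)
    show "sets ?U = sets YM" using D by simp
    fix g assume g: "g \<in> carrier G"
    have mg: "act g \<in> measurable \<mu> \<mu>" using \<mu> g by (auto simp: invariant_prob_measure_def)
    then show m: "act g \<in> measurable ?U ?U" by (simp cong: measurable_cong_sets)
    show "distr ?U ?U (act g) = ?U"
    proof (rule measure_eqI)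
      fix B assume "B \<in> sets (distr ?U ?U (act g))"
      then have B: "B \<in> sets \<mu>" by simp
      have gB: "act g -` B \<inter> Y \<in> sets \<mu>" using measurable_sets[OF mg B] D by simp
      have "emeasure (distr ?U ?U (act g)) B = emeasure ?U (act g -` B \<inter> Y)"
        using m B D by (subst emeasure_distr) auto
      also have "\<dots> = emeasure \<mu> (A \<inter> (act g -` B \<inter> Y)) / emeasure \<mu> A" by (rule U[OF gB])
      also have "A \<inter> (act g -` B \<inter> Y) = act g -` (A \<inter> B) \<inter> Y" using inv[OF g] by blast
      also have "emeasure \<mu> (act g -` (A \<inter> B) \<inter> Y) = emeasure \<mu> (A \<inter> B)"
        using D(4)[OF g, of "A \<inter> B"] A B by (simp add: emeasure_eq_measure)
      also have "\<dots> / emeasure \<mu> A = emeasure ?U B" using U[OF B] by simp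
      finally show "emeasure (distr ?U ?U (act g)) B = emeasure ?U B" .
    qed simp
  qed
  then have "?U = \<mu>" using inv_measure_unique \<mu> by blast
  moreover have "emeasure ?U A = 1"
    using False by (intro emeasure_uniform_measure_1) auto
  ultimately show ?thesis by simp
qed simp

text \<open>A factor map to the odometer sends every invariant measure to an invariant measure, hence to the
  unique one. This applies to the subshift and to an arbitrary maximal equicontinuous factor.\<close>

lemma inv_measure_distr:
  assumes \<mu>: "invariant_prob_measure G W a \<mu>" and f: "continuous_map W YT f"
    and eq: "\<And>g w. g \<in> carrier G \<Longrightarrow> w \<in> topspace W \<Longrightarrow> f (a g w) = act g (f w)"
  shows "inv_measure (distr \<mu> YM f)"
  unfolding invariant_prob_measure_def
proof (intro conjI ballI)
  have s: "sets \<mu> = sets (borel_of W)" using \<mu> by (simp add: invariant_prob_measure_def)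
  have sp: "space \<mu> = topspace W" using sets_eq_imp_space_eq[OF s] by simp
  have mf: "f \<in> measurable \<mu> YM"
    using continuous_map_measurable_borel_of[OF f] s by (simp cong: measurable_cong_sets)
  show "prob_space (distr \<mu> YM f)"
    using \<mu> mf by (auto simp: invariant_prob_measure_def intro: prob_space.prob_space_distr)
  show "sets (distr \<mu> YM f) = sets YM" by simp
  fix g assume g: "g \<in> carrier G"
  have ma: "act g \<in> measurable YM YM" by (rule continuous_map_measurable_borel_of[OF continuous_act[OF g]])
  then show "act g \<in> measurable (distr \<mu> YM f) (distr \<mu> YM f)" by (simp cong: measurable_cong_sets)
  have ms: "a g \<in> measurable \<mu> \<mu>" and inv: "distr \<mu> \<mu> (a g) = \<mu>"
    using \<mu> g by (auto simp: invariant_prob_measure_def)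
  have "distr (distr \<mu> YM f) (distr \<mu> YM f) (act g) = distr (distr \<mu> YM f) YM (act g)"
    by (rule distr_cong) auto
  also have "\<dots> = distr \<mu> YM (act g \<circ> f)" by (rule distr_distr[OF ma mf])
  also have "\<dots> = distr \<mu> YM (f \<circ> a g)"
    by (rule distr_cong) (use eq g sp in auto)
  also have "\<dots> = distr (distr \<mu> \<mu> (a g)) YM f" using distr_distr[OF mf ms] by simp
  also have "\<dots> = distr \<mu> YM f" using inv by simp
  finally show "distr (distr \<mu> YM f) (distr \<mu> YM f) (act g) = distr \<mu> YM f" .
qed

text \<open>Translation by the image of \<open>g\<close> in the odometer group is the action of \<open>g\<close>.\<close>

lemma haar_invariant:
  assumes "normalized_haar_measure (odometer_group G \<Gamma>) YT \<nu>"
  shows "inv_measure \<nu>"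
proof -
  have P: "prob_space \<nu>" and S: "sets \<nu> = sets YM"
    and T: "\<And>z A. z \<in> Y \<Longrightarrow> A \<in> sets \<nu> \<Longrightarrow> emeasure \<nu> (z <#\<^bsub>odometer_group G \<Gamma>\<^esub> A) = emeasure \<nu> A"
    using assms by (auto simp: normalized_haar_measure_def odometer_group_def)
  have sp: "space \<nu> = Y" using sets_eq_imp_space_eq[OF S] by simp
  have "emb g \<otimes>\<^bsub>odometer_group G \<Gamma>\<^esub> \<xi> = act g \<xi>" if g: "g \<in> carrier G" and \<xi>: "\<xi> \<in> Y" for g \<xi>
  proof
    fix n
    obtain h where h: "h \<in> carrier G" "\<xi> n = h <# \<Gamma> n" using Y_ex[OF \<xi>] by blast
    have "(g <# \<Gamma> n) <#> (h <# \<Gamma> n) = g <# (h <# \<Gamma> n)"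
    proof (intro equalityI subsetI)
      fix x assume "x \<in> (g <# \<Gamma> n) <#> (h <# \<Gamma> n)"
      then obtain a b where ab: "a \<in> \<Gamma> n" "b \<in> \<Gamma> n" "x = (g \<otimes> a) \<otimes> (h \<otimes> b)"
        by (auto simp: set_mult_def l_coset_def)
      have c: "a \<in> carrier G" "b \<in> carrier G" using ab chain_carrier by auto
      have "x = g \<otimes> (h \<otimes> ((inv h \<otimes> a \<otimes> h) \<otimes> b))"
        using ab c g h by (simp add: m_assoc[symmetric])
      moreover have "(inv h \<otimes> a \<otimes> h) \<otimes> b \<in> \<Gamma> n" using ab h chain_conj' chain_mult by blast
      ultimately show "x \<in> g <# (h <# \<Gamma> n)" by (auto simp: l_coset_def)
    next
      fix x assume "x \<in> g <# (h <# \<Gamma> n)"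
      then obtain b where "b \<in> \<Gamma> n" "x = g \<otimes> (h \<otimes> b)" by (auto simp: l_coset_def)
      then show "x \<in> (g <# \<Gamma> n) <#> (h <# \<Gamma> n)"
        using chain_one[of n] g by (force simp: set_mult_def l_coset_def)
    qed
    then show "(emb g \<otimes>\<^bsub>odometer_group G \<Gamma>\<^esub> \<xi>) n = act g \<xi> n"
      by (simp add: odometer_group_def odometer_action_def emb_def h)
  qed
  then have lc: "emb g <#\<^bsub>odometer_group G \<Gamma>\<^esub> A = act g ` A" if "g \<in> carrier G" "A \<subseteq> Y" for g A
    using that by (auto simp: l_coset_def image_iff subset_iff)
  show ?thesis
    unfolding invariant_prob_measure_def
  proof (intro conjI ballI)
    fix g assume g: "g \<in> carrier G"
    show m: "act g \<in> measurable \<nu> \<nu>"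
      using continuous_map_measurable_borel_of[OF continuous_act[OF g]] S
      by (simp cong: measurable_cong_sets)
    show "distr \<nu> \<nu> (act g) = \<nu>"
    proof (rule measure_eqI)
      fix A assume "A \<in> sets (distr \<nu> \<nu> (act g))"
      then have A: "A \<in> sets \<nu>" by simp
      have AY: "A \<subseteq> Y" using A sets.sets_into_space sp by blast
      have pre: "act g -` A \<inter> Y \<in> sets \<nu>" using measurable_sets[OF m A] sp by simp
      have "act g ` (act g -` A \<inter> Y) = A"
      proof (intro equalityI subsetI)
        fix \<xi> assume \<xi>: "\<xi> \<in> A"
        then have "act g (act (inv g) \<xi>) = \<xi>" "act (inv g) \<xi> \<in> Y"
          using AY act_inv(2) act_Y g by auto
        then show "\<xi> \<in> act g ` (act g -` A \<inter> Y)" using \<xi> by (intro image_eqI[of _ _ "act (inv g) \<xi>"]) auto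
      qed auto
      then have "emb g <#\<^bsub>odometer_group G \<Gamma>\<^esub> (act g -` A \<inter> Y) = A" using lc[OF g] by auto
      then have "emeasure \<nu> A = emeasure \<nu> (act g -` A \<inter> Y)" using T[OF emb_Y[OF g] pre] by simp
      then show "emeasure (distr \<nu> \<nu> (act g)) A = emeasure \<nu> A"
        using m A sp by (simp add: emeasure_distr)
    qed simp
  qed (use P S in auto)
qed

end

section \<open>Random orderings and bounded pieces\<close>

text \<open>Transposing two elements of \<open>E\<close> interchanges the orderings in which either of them comes first, so
  under a random ordering the first element of \<open>E\<close> is uniformly distributed.\<close>

lemma card_argmin_permutations:
  fixes lb :: "'a \<Rightarrow> nat"
  assumes Q: "finite Q" and E: "J \<subseteq> E" "E \<subseteq> Q" "E \<noteq> {}" and inj: "inj_on lb Q"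
  shows "card {p. p permutes Q \<and> (\<exists>e\<in>J. \<forall>y\<in>E. lb (p e) \<le> lb (p y))} * card E
     = card J * card {p. p permutes Q}"
proof -
  define M where "M e = {p. p permutes Q \<and> (\<forall>y\<in>E. lb (p e) \<le> lb (p y))}" for e
  have fP: "finite {p. p permutes Q}" using finite_permutations[OF Q] .
  then have fM: "finite (M e)" for e by (rule rev_finite_subset) (auto simp: M_def)
  have swap: "p \<circ> Transposition.transpose e e' \<in> M e'" if "e \<in> E" "e' \<in> E" "p \<in> M e" for e e' p
  proof -
    have "p \<circ> Transposition.transpose e e' permutes Q"
      using that E by (intro permutes_compose permutes_swap_id) (auto simp: M_def)
    moreover have "lb (p (Transposition.transpose e e' e')) \<le> lb (p (Transposition.transpose e e' y))" if y: "y \<in> E" for y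
    proof -
      have "Transposition.transpose e e' y \<in> E" using \<open>e \<in> E\<close> \<open>e' \<in> E\<close> y by (auto simp: Transposition.transpose_def)
      then show ?thesis using \<open>p \<in> M e\<close> by (auto simp: M_def)
    qed
    ultimately show ?thesis by (auto simp: M_def)
  qed
  have eq: "card (M e) = card (M e')" if "e \<in> E" "e' \<in> E" for e e'
  proof (rule bij_betw_same_card[of "\<lambda>p. p \<circ> Transposition.transpose e e'"])
    show "bij_betw (\<lambda>p. p \<circ> Transposition.transpose e e') (M e) (M e')"
      by (rule bij_betw_byWitness[of _ "\<lambda>p. p \<circ> Transposition.transpose e e'"])
         (use swap[OF that] swap[OF that(2) that(1)] in \<open>auto simp: comp_assoc Transposition.transpose_commute\<close>)
  qed
  have disj: "M e \<inter> M e' = {}" if "e \<in> E" "e' \<in> E" "e \<noteq> e'" for e e'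
  proof (rule ccontr)
    assume "M e \<inter> M e' \<noteq> {}"
    then obtain p where p: "p \<in> M e" "p \<in> M e'" by blast
    then have "lb (p e) = lb (p e')" using that by (auto simp: M_def intro!: antisym)
    moreover have "p permutes Q" using p by (auto simp: M_def)
    ultimately show False
      using that E inj by (meson inj_onD permutes_in_image permutes_inj subsetD inj_eq)
  qed
  obtain e0 where e0: "e0 \<in> E" using E by blast
  have finE: "finite E" using E Q finite_subset by blast
  have card: "card (\<Union>e\<in>I. M e) = card I * card (M e0)" if I: "I \<subseteq> E" for I
  proof -
    have "card (\<Union>e\<in>I. M e) = (\<Sum>e\<in>I. card (M e))"
    proof (rule card_UN_disjoint)
      show "finite I" using I finE finite_subset by blast
      show "\<forall>i\<in>I. \<forall>j\<in>I. i \<noteq> j \<longrightarrow> M i \<inter> M j = {}" using I disj by (meson subsetD)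
    qed (use fM in blast)
    also have "\<dots> = (\<Sum>e\<in>I. card (M e0))"
      by (rule sum.cong[OF refl]) (rule eq[OF _ e0], use I in blast)
    finally show ?thesis by simp
  qed
  have all: "(\<Union>e\<in>E. M e) = {p. p permutes Q}"
  proof (intro equalityI subsetI)
    fix p assume p: "p \<in> {p. p permutes Q}"
    obtain e where "e \<in> E" "\<forall>y\<in>E. lb (p e) \<le> lb (p y)"
      using ex_min_if_finite[of "(\<lambda>e. lb (p e)) ` E"] finE E by (auto simp: not_less)
    then show "p \<in> (\<Union>e\<in>E. M e)" using p by (auto simp: M_def)
  qed (auto simp: M_def)
  have "{p. p permutes Q \<and> (\<exists>e\<in>J. \<forall>y\<in>E. lb (p e) \<le> lb (p y))} = (\<Union>e\<in>J. M e)"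
    by (auto simp: M_def)
  then show ?thesis using card[OF E(1)] card[of E] all by simp
qed


context residual_chain
begin

lemma folner_set:
  assumes "amenable_group G" "finite F" "F \<subseteq> carrier G" "\<delta> > (0::real)"
  shows "\<exists>A. finite A \<and> A \<noteq> {} \<and> A \<subseteq> carrier G \<and>
    (\<forall>f\<in>F. real (card (((f <# A) - A) \<union> (A - (f <# A)))) \<le> \<delta> * real (card A))"
proof -
  obtain A :: "nat \<Rightarrow> 'g set" where A: "\<And>n. finite (A n) \<and> A n \<noteq> {} \<and> A n \<subseteq> carrier G"
    "\<And>g. g \<in> carrier G \<Longrightarrow> (\<lambda>n. real (card (((g <# A n) - A n) \<union> (A n - (g <# A n)))) / real (card (A n))) \<longlonglongrightarrow> 0"
    using assms(1) unfolding amenable_group_def by blast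
  have "\<forall>\<^sub>F n in sequentially. \<forall>f\<in>F. real (card (((f <# A n) - A n) \<union> (A n - (f <# A n)))) / real (card (A n)) < \<delta>"
    using assms A(2) order_tendstoD(2)[of _ 0 sequentially \<delta>] by (intro eventually_ball_finite) auto
  then obtain n where n: "\<forall>f\<in>F. real (card (((f <# A n) - A n) \<union> (A n - (f <# A n)))) / real (card (A n)) < \<delta>"
    using eventually_happens trivial_limit_sequentially by blast
  have "card (A n) > 0" using A(1)[of n] by (simp add: card_gt_0_iff)
  with n have "\<forall>f\<in>F. real (card (((f <# A n) - A n) \<union> (A n - (f <# A n)))) \<le> \<delta> * real (card (A n))"
    by (auto simp: divide_simps intro!: less_imp_le)
  then show ?thesis using A(1)[of n] by blast
qed

text \<open>Amenability cuts the group into bounded pieces: outside a periodic set \<open>B\<close> of small density,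
  points that differ by a step in \<open>F\<close> carry the same label, and labels are close to the points. The
  label of \<open>x\<close> is the translate \<open>s \<otimes> x\<close>, \<open>s \<in> S\<close>, whose coset comes first in an ordering of the
  quotient. The labels of \<open>x\<close> and \<open>f \<otimes> x\<close> can differ only if the first coset met by
  \<open>S \<union> S f\<close> belongs to the symmetric difference of \<open>S\<close> and \<open>S f\<close>. For a random ordering this has
  probability \<open>card (sym_diff S (S f)) / card (S \<union> S f)\<close>, which is small if \<open>S\<close> consists of the
  inverses of a Foelner set; so some ordering leaves few bad cosets.\<close>

lemma bounded_labelling:
  assumes am: "amenable_group G" and F: "finite F" "F \<subseteq> carrier G" and \<epsilon>: "\<epsilon> > (0::real)"
  shows "\<exists>n\<ge>n0. \<exists>B c S. periodic (\<Gamma> n) B \<and> finite S \<and> S \<subseteq> carrier G \<and>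
    (\<forall>x\<in>carrier G. \<exists>s\<in>S. c x = s \<otimes> x) \<and>
    (\<forall>x\<in>carrier G. \<forall>\<gamma>\<in>\<Gamma> n. c (x \<otimes> \<gamma>) = c x \<otimes> \<gamma>) \<and>
    (\<forall>x\<in>carrier G - B. \<forall>f\<in>F. c (f \<otimes> x) = c x) \<and>
    real (card {C \<in> rcosets (\<Gamma> n). C \<subseteq> B}) / real (idx n) < \<epsilon>"
proof -
  define \<delta> where "\<delta> = \<epsilon> / (real (card F) + 1)"
  have \<delta>: "\<delta> > 0" "real (card F) * \<delta> < \<epsilon>" using \<epsilon> by (auto simp: \<delta>_def field_simps)
  obtain A where A: "finite A" "A \<noteq> {}" "A \<subseteq> carrier G"
    and Af: "\<And>f. f \<in> F \<Longrightarrow> real (card (((inv f <# A) - A) \<union> (A - (inv f <# A)))) \<le> \<delta> * real (card A)"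
  proof -
    have "finite (m_inv G ` F)" "m_inv G ` F \<subseteq> carrier G" using F by auto
    from folner_set[OF am this \<delta>(1)] show ?thesis using that by (elim exE conjE) simp
  qed
  define S where "S = m_inv G ` A"
  define R where "R f = (\<lambda>s. s \<otimes> f) ` S" for f
  have S: "finite S" "S \<noteq> {}" "S \<subseteq> carrier G" using A by (auto simp: S_def)
  have R: "finite (R f)" "R f \<subseteq> carrier G" if "f \<in> F" for f using S F that by (auto simp: R_def)
  have cardS: "card S = card A"
    unfolding S_def using A by (intro card_image inj_on_subset[OF inv_inj]) auto
  have symd: "real (card ((R f - S) \<union> (S - R f))) \<le> \<delta> * real (card S)" if f: "f \<in> F" for f
  proof -
    have fc: "f \<in> carrier G" using f F by blast
    have "R f = m_inv G ` ((inv f <# A))"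
      using A(3) fc by (auto simp: R_def S_def l_coset_def image_iff inv_mult_group subset_iff)
    moreover have "inv f <# A \<subseteq> carrier G" using A fc by (auto simp: l_coset_def)
    ultimately have "(R f - S) \<union> (S - R f) = m_inv G ` (((inv f <# A) - A) \<union> (A - (inv f <# A)))"
      unfolding S_def image_Un using A(3)
      by (subst (1 2) inj_on_image_set_diff[OF inv_inj]) auto
    moreover have "card (m_inv G ` (((inv f <# A) - A) \<union> (A - (inv f <# A)))) = card (((inv f <# A) - A) \<union> (A - (inv f <# A)))"
      using A fc by (intro card_image inj_on_subset[OF inv_inj]) (auto simp: l_coset_def)
    ultimately show ?thesis using Af[OF f] cardS by simp
  qed
  \<comment> \<open>All translates that compete for a label of \<open>x\<close> or \<open>f \<otimes> x\<close> are to lie in distinct cosets.\<close>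
  define U where "U = S \<union> (\<Union>f\<in>F. R f)"
  have U: "finite U" "U \<subseteq> carrier G" using S R F by (auto simp: U_def)
  obtain n1 where n1: "\<And>n. n \<ge> n1 \<Longrightarrow> \<Gamma> n \<inter> (\<lambda>(a,b). inv a \<otimes> b) ` (m_inv G ` U \<times> m_inv G ` U) \<subseteq> {\<one>}"
    using eventually_avoids[of "(\<lambda>(a,b). inv a \<otimes> b) ` (m_inv G ` U \<times> m_inv G ` U)"] U by auto
  define n where "n = max n0 n1"
  define q where "q g = g <# \<Gamma> n" for g
  define Q where "Q = rcosets (\<Gamma> n)"
  have Q: "finite Q" using finite_index by (simp add: Q_def)
  have q: "q g \<in> Q" if "g \<in> carrier G" for g using lcoset_rcosets that by (simp add: q_def Q_def)
  have q_mult: "q (g \<otimes> \<gamma>) = q g" if "g \<in> carrier G" "\<gamma> \<in> \<Gamma> n" for g \<gamma>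
    unfolding q_def using that by (intro lcoset_eq) (auto simp: l_coset_def)
  have inj: "u = v" if uv: "u \<in> U" "v \<in> U" "x \<in> carrier G" "q (u \<otimes> x) = q (v \<otimes> x)" for u v x
  proof -
    have c: "u \<in> carrier G" "v \<in> carrier G" using U uv by auto
    have "v \<otimes> x \<in> u \<otimes> x <# \<Gamma> n" using uv(4) lcoset_self[of "v \<otimes> x" n] c uv(3) by (simp add: q_def)
    then have *: "inv (u \<otimes> x) \<otimes> (v \<otimes> x) \<in> \<Gamma> n" using lcoset_mem_iff c uv(3) by simp
    have "x \<otimes> (inv (u \<otimes> x) \<otimes> (v \<otimes> x)) \<otimes> inv x \<in> \<Gamma> n" by (rule chain_conj[OF * uv(3)])
    moreover have "x \<otimes> (inv (u \<otimes> x) \<otimes> (v \<otimes> x)) \<otimes> inv x = inv u \<otimes> v"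
      using c uv(3) by (simp add: inv_mult_group m_assoc[symmetric]) (simp add: m_assoc)
    ultimately have "inv u \<otimes> v \<in> \<Gamma> n" by simp
    then have "u \<otimes> (inv u \<otimes> v) \<otimes> inv u \<in> \<Gamma> n" by (rule chain_conj) (rule c)
    then have "v \<otimes> inv u \<in> \<Gamma> n" using c by (simp add: m_assoc[symmetric])
    moreover have "v \<otimes> inv u \<in> (\<lambda>(a,b). inv a \<otimes> b) ` (m_inv G ` U \<times> m_inv G ` U)"
      using uv c by (intro image_eqI[of _ _ "(inv v, inv u)"]) auto
    moreover have "n \<ge> n1" by (simp add: n_def)
    ultimately have "v \<otimes> inv u = \<one>" using n1[of n] by blast
    then show "u = v" using c by (metis inv_equality inv_inv inv_closed)
  qed
  obtain lb :: "'g set \<Rightarrow> nat" where lb: "inj_on lb Q" using finite_imp_inj_to_nat_seg[OF Q] by blast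
  define P where "P = {p. p permutes Q}"
  have P: "finite P" "P \<noteq> {}" using finite_permutations[OF Q] permutes_id[of Q] by (auto simp: P_def simp del: permutes_id)
  define key where "key p g = lb (p (q g))" for p g
  have key_eqD: "u = v" if "p \<in> P" "u \<in> U" "v \<in> U" "x \<in> carrier G" "key p (u \<otimes> x) = key p (v \<otimes> x)" for p u v x
  proof -
    have p: "p permutes Q" using that(1) by (simp add: P_def)
    have "u \<otimes> x \<in> carrier G" "v \<otimes> x \<in> carrier G" using that U by auto
    then have "p (q (u \<otimes> x)) \<in> Q" "p (q (v \<otimes> x)) \<in> Q"
      using q permutes_in_image[OF p] by auto
    then have "p (q (u \<otimes> x)) = p (q (v \<otimes> x))"
      by (rule inj_onD[OF lb that(5)[unfolded key_def]])
    then have "q (u \<otimes> x) = q (v \<otimes> x)" by (rule injD[OF permutes_inj[OF p]])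
    then show ?thesis by (rule inj[OF that(2-4)])
  qed
  define minim where "minim p x s \<longleftrightarrow> s \<in> S \<and> (\<forall>t\<in>S. key p (s \<otimes> x) \<le> key p (t \<otimes> x))" for p x s
  have minim_ex: "\<exists>s. minim p x s" for p x
    using ex_min_if_finite[of "(\<lambda>s. key p (s \<otimes> x)) ` S"] S by (auto simp: not_less minim_def)
  have minim_unique: "s = t" if "minim p x s" "minim p x t" "p \<in> P" "x \<in> carrier G" for p x s t
  proof (rule key_eqD)
    show "key p (s \<otimes> x) = key p (t \<otimes> x)" using that by (auto simp: minim_def intro!: antisym)
  qed (use that in \<open>auto simp: minim_def U_def\<close>)
  define c where "c p x = (SOME s. minim p x s) \<otimes> x" for p x
  have c_eq: "c p x = s \<otimes> x" if "minim p x s" "p \<in> P" "x \<in> carrier G" for p x s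
    using minim_unique[OF someI_ex[OF minim_ex] that] by (simp add: c_def)
  have c_S: "\<exists>s\<in>S. c p x = s \<otimes> x" for p x
    using someI_ex[OF minim_ex[of p x]] by (auto simp: c_def minim_def)
  have c_mult: "c p (x \<otimes> \<gamma>) = c p x \<otimes> \<gamma>" if "p \<in> P" "x \<in> carrier G" "\<gamma> \<in> \<Gamma> n" for p x \<gamma>
  proof -
    have \<gamma>: "\<gamma> \<in> carrier G" using that chain_carrier by blast
    obtain s where s: "minim p x s" using minim_ex by blast
    have "key p (t \<otimes> (x \<otimes> \<gamma>)) = key p (t \<otimes> x)" if "t \<in> S" for t
      using q_mult[of "t \<otimes> x" \<gamma>] S that \<open>x \<in> carrier G\<close> \<open>\<gamma> \<in> \<Gamma> n\<close> \<gamma>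
      by (auto simp: key_def m_assoc subset_iff)
    then have "minim p (x \<otimes> \<gamma>) s" using s by (auto simp: minim_def)
    moreover have "s \<in> carrier G" using s S by (auto simp: minim_def)
    ultimately show ?thesis using c_eq[OF _ that(1)] s that \<gamma> by (simp add: m_assoc)
  qed
  define cut where "cut p f x \<longleftrightarrow> c p (f \<otimes> x) \<noteq> c p x" for p f x
  have cut_argmin: "\<exists>e\<in>(\<lambda>u. q (u \<otimes> x)) ` ((R f - S) \<union> (S - R f)). \<forall>y\<in>(\<lambda>u. q (u \<otimes> x)) ` (S \<union> R f). lb (p e) \<le> lb (p y)"
    if p: "p \<in> P" and f: "f \<in> F" and x: "x \<in> carrier G" and cut: "cut p f x" for p f x
  proof -
    have fc: "f \<in> carrier G" using F f by blast
    obtain u where u: "u \<in> S \<union> R f" "\<forall>v\<in>S \<union> R f. key p (u \<otimes> x) \<le> key p (v \<otimes> x)"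
      using ex_min_if_finite[of "(\<lambda>s. key p (s \<otimes> x)) ` (S \<union> R f)"] S R[OF f] by (auto simp: not_less)
    have "u \<notin> S \<inter> R f"
    proof
      assume *: "u \<in> S \<inter> R f"
      then obtain s where s: "s \<in> S" "u = s \<otimes> f" by (auto simp: R_def)
      have ass: "t \<otimes> f \<otimes> x = t \<otimes> (f \<otimes> x)" if "t \<in> S" for t using that S fc x by (auto simp: m_assoc)
      have "minim p x u" using * u by (auto simp: minim_def)
      then have "c p x = u \<otimes> x" using c_eq p x by blast
      moreover have "key p (s \<otimes> (f \<otimes> x)) \<le> key p (t \<otimes> (f \<otimes> x))" if "t \<in> S" for t
      proof -
        have "t \<otimes> f \<in> S \<union> R f" using that by (simp add: R_def)
        from bspec[OF u(2) this] show ?thesis using s ass[OF that] ass[OF s(1)] by simp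
      qed
      then have "minim p (f \<otimes> x) s" using s by (auto simp: minim_def)
      then have "c p (f \<otimes> x) = s \<otimes> (f \<otimes> x)" using c_eq p x fc by blast
      ultimately show False using cut s ass by (simp add: cut_def)
    qed
    then show ?thesis using u by (intro bexI[of _ "q (u \<otimes> x)"]) (auto simp: key_def)
  qed
  have prob: "real (card {p\<in>P. cut p f x}) \<le> \<delta> * real (card P)" if f: "f \<in> F" and x: "x \<in> carrier G" for f x
  proof -
    let ?J = "(\<lambda>u. q (u \<otimes> x)) ` ((R f - S) \<union> (S - R f))" and ?E = "(\<lambda>u. q (u \<otimes> x)) ` (S \<union> R f)"
    let ?M = "{p. p permutes Q \<and> (\<exists>e\<in>?J. \<forall>y\<in>?E. lb (p e) \<le> lb (p y))}"
    have 0: "card ?M * card ?E = card ?J * card {p. p permutes Q}"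
    proof (rule card_argmin_permutations[OF Q _ _ _ lb])
      show "?E \<subseteq> Q" using q S R[OF f] x by (auto simp: subset_iff)
    qed (use S in auto)
    have 1: "real (card ?M) * real (card ?E) = real (card ?J) * real (card P)"
      using arg_cong[OF 0, of real] by (simp only: P_def of_nat_mult)
    have "inj_on (\<lambda>u. q (u \<otimes> x)) (S \<union> R f)"
    proof (rule inj_onI)
      fix u v assume uv: "u \<in> S \<union> R f" "v \<in> S \<union> R f" "q (u \<otimes> x) = q (v \<otimes> x)"
      then have "u \<in> U" "v \<in> U" using f unfolding U_def by blast+
      then show "u = v" by (rule inj[OF _ _ x uv(3)])
    qed
    then have "card ?E = card (S \<union> R f)" by (rule card_image)
    then have 2: "card ?E \<ge> card S" using S R[OF f] by (simp add: card_mono)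
    have "card ?J \<le> card ((R f - S) \<union> (S - R f))" by (rule card_image_le) (use S R[OF f] in auto)
    then have "real (card ?J) \<le> \<delta> * real (card S)" using symd[OF f] by linarith
    also have "\<dots> \<le> \<delta> * real (card ?E)" using 2 \<delta> by simp
    finally have "real (card ?M) * real (card ?E) \<le> \<delta> * real (card ?E) * real (card P)"
      unfolding 1 by (rule mult_right_mono) simp
    moreover have "card ?E > 0" using 2 S card_gt_0_iff[of S] by linarith
    ultimately have "real (card ?M) \<le> \<delta> * real (card P)"
      by (simp add: mult.commute mult.left_commute)
    moreover have "card {p\<in>P. cut p f x} \<le> card ?M"
    proof (rule card_mono)
      show "finite ?M" using P(1) unfolding P_def by (rule rev_finite_subset) auto
      show "{p\<in>P. cut p f x} \<subseteq> ?M" using cut_argmin[OF _ f x] by (auto simp: P_def)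
    qed
    ultimately show ?thesis by linarith
  qed
  have "\<forall>C\<in>Q. \<exists>g. g \<in> carrier G \<and> C = q g" using rcosets_lcoset by (auto simp: Q_def q_def)
  then obtain rep where rep: "\<And>C. C \<in> Q \<Longrightarrow> rep C \<in> carrier G \<and> C = q (rep C)" by metis
  define bad where "bad p = {C\<in>Q. \<exists>f\<in>F. cut p f (rep C)}" for p
  \<comment> \<open>Summing over all orderings and exchanging the sums bounds the average number of bad cosets.\<close>
  have "(\<Sum>p\<in>P. real (card (bad p))) \<le> (\<Sum>p\<in>P. \<Sum>C\<in>Q. \<Sum>f\<in>F. of_bool (cut p f (rep C)))"
  proof (rule sum_mono)
    fix p
    have "real (card (bad p)) = (\<Sum>C\<in>Q. of_bool (\<exists>f\<in>F. cut p f (rep C)))"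
      using Q by (simp add: bad_def Int_def)
    also have "\<dots> \<le> (\<Sum>C\<in>Q. \<Sum>f\<in>F. of_bool (cut p f (rep C)))"
    proof (rule sum_mono)
      fix C
      show "of_bool (\<exists>f\<in>F. cut p f (rep C)) \<le> (\<Sum>f\<in>F. of_bool (cut p f (rep C)) :: real)"
      proof (cases "\<exists>f\<in>F. cut p f (rep C)")
        case True
        then obtain f where f: "f \<in> F" "cut p f (rep C)" by blast
        have "of_bool (cut p f (rep C)) \<le> (\<Sum>f\<in>F. of_bool (cut p f (rep C)) :: real)"
          by (rule member_le_sum[OF f(1)]) (use F in auto)
        then show ?thesis using f True by simp
      qed (simp add: sum_nonneg)
    qed
    finally show "real (card (bad p)) \<le> (\<Sum>C\<in>Q. \<Sum>f\<in>F. of_bool (cut p f (rep C)))" .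
  qed
  also have "\<dots> = (\<Sum>C\<in>Q. \<Sum>f\<in>F. \<Sum>p\<in>P. of_bool (cut p f (rep C)))"
    by (subst sum.swap) (rule sum.cong[OF refl], rule sum.swap)
  also have "\<dots> \<le> (\<Sum>C\<in>Q. \<Sum>f\<in>F. \<delta> * real (card P))"
  proof (intro sum_mono)
    fix C f assume "C \<in> Q" "f \<in> F"
    then show "(\<Sum>p\<in>P. of_bool (cut p f (rep C))) \<le> \<delta> * real (card P)"
      using prob[of f "rep C"] rep P(1) by (simp add: Int_def)
  qed
  also have "\<dots> = (\<Sum>p\<in>P. real (card Q) * (real (card F) * \<delta>))" by simp
  finally have "\<exists>p\<in>P. real (card (bad p)) \<le> real (card Q) * (real (card F) * \<delta>)"
    using P by (meson sum_strict_mono not_le)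
  then obtain p where p: "p \<in> P" "real (card (bad p)) \<le> real (card Q) * (real (card F) * \<delta>)" by blast
  define B where "B = {x\<in>carrier G. \<exists>f\<in>F. cut p f x}"
  have perB: "periodic (\<Gamma> n) B"
    unfolding periodic_def
  proof (intro conjI ballI)
    show "B \<subseteq> carrier G" by (auto simp: B_def)
    fix x \<gamma> assume x: "x \<in> B" and \<gamma>: "\<gamma> \<in> \<Gamma> n"
    then obtain f where f: "x \<in> carrier G" "f \<in> F" "c p (f \<otimes> x) \<noteq> c p x" by (auto simp: B_def cut_def)
    have cc: "\<gamma> \<in> carrier G" "f \<in> carrier G" using \<gamma> chain_carrier f F by auto
    have "c p x \<in> carrier G" "c p (f \<otimes> x) \<in> carrier G"
      using c_S[of p x] c_S[of p "f \<otimes> x"] S f cc by auto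
    then have "c p (f \<otimes> x) \<otimes> \<gamma> \<noteq> c p x \<otimes> \<gamma>" using f cc by simp
    then have "c p (f \<otimes> (x \<otimes> \<gamma>)) \<noteq> c p (x \<otimes> \<gamma>)"
      using c_mult[OF p(1) _ \<gamma>, of x] c_mult[OF p(1) _ \<gamma>, of "f \<otimes> x"] f cc by (simp add: m_assoc)
    then show "x \<otimes> \<gamma> \<in> B" using f cc by (auto simp: B_def cut_def)
  qed
  have "{C \<in> rcosets (\<Gamma> n). C \<subseteq> B} \<subseteq> bad p"
  proof
    fix C assume C: "C \<in> {C \<in> rcosets (\<Gamma> n). C \<subseteq> B}"
    then have "rep C \<in> C" using rep[of C] lcoset_self by (auto simp: Q_def q_def)
    then show "C \<in> bad p" using C by (auto simp: bad_def B_def Q_def)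
  qed
  moreover have "finite (bad p)" using Q by (simp add: bad_def)
  ultimately have "real (card {C \<in> rcosets (\<Gamma> n). C \<subseteq> B}) \<le> real (card Q) * (real (card F) * \<delta>)"
    using card_mono[of "bad p"] p(2) by (meson of_nat_le_iff order_trans)
  also have "\<dots> < real (card Q) * \<epsilon>" using \<delta>(2) idx_pos[of n] by (simp add: idx_def Q_def)
  finally have "real (card {C \<in> rcosets (\<Gamma> n). C \<subseteq> B}) / real (idx n) < \<epsilon>"
    using idx_pos[of n] by (simp add: idx_def Q_def field_simps)
  moreover have "\<forall>x\<in>carrier G - B. \<forall>f\<in>F. c p (f \<otimes> x) = c p x" by (auto simp: B_def cut_def)
  moreover have "n \<ge> n0" by (simp add: n_def)
  ultimately show ?thesis
    using perB S c_S c_mult[OF p(1)]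
    by (intro exI[of _ n] conjI exI[of _ B] exI[of _ "c p"] exI[of _ S] ballI) auto
qed

end


section \<open>The tower of tiled sets\<close>

context residual_chain
begin

lemma hat_translate:
  assumes "h \<in> carrier G"
  shows "act h -` hat V \<inter> Y = hat {x\<in>carrier G. h \<otimes> x \<in> V}"
proof (intro equalityI subsetI)
  fix \<xi> assume "\<xi> \<in> act h -` hat V \<inter> Y"
  then obtain n where n: "\<xi> \<in> Y" "act h \<xi> n \<subseteq> V" by (auto simp: hat_def)
  then have "\<xi> n \<subseteq> {x\<in>carrier G. h \<otimes> x \<in> V}" using act_mem Y_carrier by blast
  then show "\<xi> \<in> hat {x\<in>carrier G. h \<otimes> x \<in> V}" using n by (auto simp: hat_def)
next
  fix \<xi> assume "\<xi> \<in> hat {x\<in>carrier G. h \<otimes> x \<in> V}"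
  then obtain n where n: "\<xi> \<in> Y" "\<xi> n \<subseteq> {x\<in>carrier G. h \<otimes> x \<in> V}" by (auto simp: hat_def)
  then have "act h \<xi> n \<subseteq> V" by (auto simp: odometer_action_def l_coset_def)
  then show "\<xi> \<in> act h -` hat V \<inter> Y" using n act_Y assms by (auto simp: hat_def)
qed

lemma hat_UN:
  assumes "\<And>i. i \<in> I \<Longrightarrow> periodic (\<Gamma> n) (B i)"
  shows "hat (\<Union>i\<in>I. B i) = (\<Union>i\<in>I. hat (B i))"
proof (intro equalityI subsetI)
  have P: "periodic (\<Gamma> n) (\<Union>i\<in>I. B i)" using assms unfolding periodic_def by blast
  fix \<xi> assume \<xi>: "\<xi> \<in> hat (\<Union>i\<in>I. B i)"
  then have "\<xi> \<in> Y" using hat_subset_Y by blast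
  then obtain g where g: "g \<in> \<xi> n" using Y_nonempty by blast
  then obtain i where "i \<in> I" "g \<in> B i" using hat_iff[OF P \<open>\<xi> \<in> Y\<close>] \<xi> by blast
  then show "\<xi> \<in> (\<Union>i\<in>I. hat (B i))" using hat_iff[OF assms \<open>\<xi> \<in> Y\<close> g] by blast
next
  fix \<xi> assume "\<xi> \<in> (\<Union>i\<in>I. hat (B i))"
  then show "\<xi> \<in> hat (\<Union>i\<in>I. B i)" using hat_mono[of "B _" "\<Union>i\<in>I. B i"] by blast
qed

lemma measure_hat_UN_le:
  assumes \<mu>: "inv_measure \<mu>" and I: "finite I" "\<And>i. i \<in> I \<Longrightarrow> periodic (\<Gamma> n) (B i)"
    and b: "\<And>i. i \<in> I \<Longrightarrow> measure \<mu> (hat (B i)) \<le> b"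
  shows "measure \<mu> (hat (\<Union>i\<in>I. B i)) \<le> real (card I) * b"
proof -
  interpret prob_space \<mu> by (rule inv_measureD[OF \<mu>])
  have "measure \<mu> (hat (\<Union>i\<in>I. B i)) = measure \<mu> (\<Union>i\<in>I. hat (B i))"
    by (simp only: hat_UN[OF I(2)])
  also have "\<dots> \<le> (\<Sum>i\<in>I. measure \<mu> (hat (B i)))"
    by (rule finite_measure_subadditive_finite) (use I hat_sets inv_measureD(2)[OF \<mu>] in auto)
  also have "\<dots> \<le> (\<Sum>i\<in>I. b)" by (rule sum_mono) (rule b)
  finally show ?thesis by simp
qed

lemma measure_hat_mono: "inv_measure \<mu> \<Longrightarrow> V \<subseteq> W \<Longrightarrow> measure \<mu> (hat V) \<le> measure \<mu> (hat W)"
  using inv_measureD(1,2) hat_sets hat_mono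
  by (intro finite_measure.finite_measure_mono prob_space.finite_measure) auto

lemma measure_hat_Un_le:
  assumes "inv_measure \<mu>" "periodic (\<Gamma> n) V" "periodic (\<Gamma> n) W"
  shows "measure \<mu> (hat (V \<union> W)) \<le> measure \<mu> (hat V) + measure \<mu> (hat W)"
proof -
  interpret prob_space \<mu> by (rule inv_measureD[OF assms(1)])
  have "hat (V \<union> W) = hat V \<union> hat W"
    using hat_UN[of "UNIV :: bool set" n "\<lambda>b. if b then V else W"] assms by (simp add: UNIV_bool Un_commute)
  then show ?thesis
    using measure_Un_le[of "hat V" \<mu> "hat W"] hat_sets inv_measureD(2)[OF assms(1)] by simp
qed

definition tile_saturation :: "('g \<Rightarrow> 'g) \<Rightarrow> 'g set \<Rightarrow> 'g set \<Rightarrow> 'g set" where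
  "tile_saturation c V X = {x\<in>V. \<exists>y\<in>V \<inter> X. c y = c x}"

text \<open>A tiling of \<open>V\<close> is recorded by a labelling \<open>c\<close> that assigns to each point a point of
  \<open>G\<close> at bounded left distance; the tiles are the fibres of \<open>c\<close>.\<close>

definition labelling :: "'g set \<Rightarrow> 'g set \<Rightarrow> 'g set \<Rightarrow> 'g set \<Rightarrow> ('g \<Rightarrow> 'g) \<Rightarrow> bool" where
  "labelling \<Lambda> V F S c \<longleftrightarrow> finite S \<and> S \<subseteq> carrier G \<and> (\<forall>x\<in>V. \<exists>s\<in>S. c x = s \<otimes> x) \<and>
     (\<forall>x\<in>V. \<forall>\<gamma>\<in>\<Lambda>. c (x \<otimes> \<gamma>) = c x \<otimes> \<gamma>) \<and> (\<forall>x\<in>V. \<forall>f\<in>F. f \<otimes> x \<in> V \<longrightarrow> c (f \<otimes> x) = c x)"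

definition tiled :: "'g set \<Rightarrow> 'g set \<Rightarrow> 'g set \<Rightarrow> bool" where
  "tiled \<Lambda> V F \<longleftrightarrow> periodic \<Lambda> V \<and> (\<exists>S c. labelling \<Lambda> V F S c)"

lemma periodic_tile_saturation:
  assumes "periodic \<Lambda> V" "labelling \<Lambda> V F S c" "periodic \<Lambda>' X" "\<Lambda>' \<subseteq> \<Lambda>"
  shows "periodic \<Lambda>' (tile_saturation c V X)"
  unfolding periodic_def
proof (intro conjI ballI)
  show "tile_saturation c V X \<subseteq> carrier G" using assms(1) by (auto simp: tile_saturation_def periodic_def)
  fix x \<gamma> assume x: "x \<in> tile_saturation c V X" and \<gamma>: "\<gamma> \<in> \<Lambda>'"
  then obtain y where y: "y \<in> V \<inter> X" "c y = c x" "x \<in> V" by (auto simp: tile_saturation_def)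
  have \<gamma>\<Lambda>: "\<gamma> \<in> \<Lambda>" using \<gamma> assms by blast
  have V: "x \<otimes> \<gamma> \<in> V" "y \<otimes> \<gamma> \<in> V" using y \<gamma>\<Lambda> assms(1) by (auto simp: periodic_def)
  have "y \<otimes> \<gamma> \<in> X" using y \<gamma> assms(3) by (auto simp: periodic_def)
  moreover have "c (y \<otimes> \<gamma>) = c (x \<otimes> \<gamma>)" using y assms(2) \<gamma>\<Lambda> by (simp add: labelling_def)
  ultimately show "x \<otimes> \<gamma> \<in> tile_saturation c V X" using V by (auto simp: tile_saturation_def)
qed

text \<open>Two points of a tile differ by an element \<open>inv t \<otimes> s\<close> with \<open>s, t \<in> S\<close>, so the saturation is covered by
  boundedly many translates of \<open>X\<close>.\<close>

lemma measure_tile_saturation: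
  assumes \<mu>: "inv_measure \<mu>" and V: "periodic \<Lambda> V" and c: "labelling \<Lambda> V F S c"
    and X: "periodic (\<Gamma> n) X"
  shows "measure \<mu> (hat (tile_saturation c V X)) \<le> real (card (S \<times> S)) * measure \<mu> (hat X)"
proof -
  define u where "u = (\<lambda>(s,t). inv t \<otimes> s)"
  have S: "finite S" "S \<subseteq> carrier G" using c by (auto simp: labelling_def)
  have uc: "u i \<in> carrier G" if "i \<in> S \<times> S" for i using that S by (auto simp: u_def)
  have per: "periodic (\<Gamma> n) {x\<in>carrier G. u i \<otimes> x \<in> X}" if "i \<in> S \<times> S" for i
    using X uc[OF that] chain_carrier[of _ n] by (auto simp: periodic_def m_assoc[symmetric])
  have "tile_saturation c V X \<subseteq> (\<Union>i\<in>S \<times> S. {x\<in>carrier G. u i \<otimes> x \<in> X})"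
  proof
    fix x assume "x \<in> tile_saturation c V X"
    then obtain y where y: "y \<in> V" "y \<in> X" "c y = c x" "x \<in> V" by (auto simp: tile_saturation_def)
    obtain s where s: "s \<in> S" "c x = s \<otimes> x" using c y(4) by (auto simp: labelling_def)
    obtain t where t: "t \<in> S" "c y = t \<otimes> y" using c y(1) by (auto simp: labelling_def)
    have cc: "x \<in> carrier G" "y \<in> carrier G" "s \<in> carrier G" "t \<in> carrier G"
      using y s t V S by (auto simp: periodic_def)
    have "y = inv t \<otimes> (t \<otimes> y)" using cc by (simp add: m_assoc[symmetric])
    also have "\<dots> = inv t \<otimes> s \<otimes> x" using y s t cc by (simp add: m_assoc)
    finally have "u (s,t) \<otimes> x \<in> X" using y by (simp add: u_def)
    then show "x \<in> (\<Union>i\<in>S \<times> S. {x\<in>carrier G. u i \<otimes> x \<in> X})" using cc s t by blast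
  qed
  then have "measure \<mu> (hat (tile_saturation c V X)) \<le> measure \<mu> (hat (\<Union>i\<in>S \<times> S. {x\<in>carrier G. u i \<otimes> x \<in> X}))"
    by (rule measure_hat_mono[OF \<mu>])
  also have "\<dots> \<le> real (card (S \<times> S)) * measure \<mu> (hat X)"
  proof (rule measure_hat_UN_le[OF \<mu> _ per])
    fix i assume i: "i \<in> S \<times> S"
    show "measure \<mu> (hat {x\<in>carrier G. u i \<otimes> x \<in> X}) \<le> measure \<mu> (hat X)"
      using inv_measureD(4)[OF \<mu> uc[OF i], of "hat X"] inv_measureD(2)[OF \<mu>] hat_sets[of X]
        hat_translate[OF uc[OF i], of X] by simp
  qed (use S in auto)
  finally show ?thesis .
qed

lemma lcoset_subset: "periodic (\<Gamma> n) V \<Longrightarrow> v \<in> V \<Longrightarrow> v <# \<Gamma> n \<subseteq> V"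
  by (auto simp: l_coset_def periodic_def)

lemma measure_hat_pos:
  assumes "inv_measure \<mu>" "periodic (\<Gamma> n) V" "v \<in> V"
  shows "measure \<mu> (hat V) \<ge> 1 / real (idx n)"
proof -
  have v: "v \<in> carrier G" using assms by (auto simp: periodic_def)
  show ?thesis
    using measure_hat_mono[OF assms(1) lcoset_subset[OF assms(2,3)]] hat_lcoset[OF v] measure_cyl[OF assms(1) v]
    by simp
qed

text \<open>One step of the construction: from the tiled set \<open>V\<close> remove the tiles that meet a small
  boundary set \<open>B\<close>, and the tiles that meet one further coset \<open>t \<Gamma>\<^sub>n\<close>.  Off \<open>B\<close> a labelling for
  the new set \<open>F'\<close> is available.  Since the coset \<open>t \<Gamma>\<^sub>n\<close> is the only removed piece of its
  surroundings, the remaining set \<open>V'\<close> has no period in \<open>\<Lambda>\<close> outside \<open>\<Gamma>\<^sub>n\<close>.\<close>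

lemma tiled_refine:
  assumes \<mu>: "inv_measure \<mu>" and am: "amenable_group G"
    and \<Lambda>: "\<Lambda> \<lhd> G" "\<Gamma> n0 \<subseteq> \<Lambda>" and V: "tiled \<Lambda> V F" "V \<noteq> {}"
    and F': "finite F'" "F' \<subseteq> carrier G" and K: "finite K" "K \<subseteq> carrier G" and \<epsilon>: "\<epsilon> > (0::real)"
  shows "\<exists>n>n0. \<exists>V'\<subseteq>V. tiled (\<Gamma> n) V' F' \<and> K \<inter> V' = {} \<and> measure \<mu> (hat (V - V')) < \<epsilon> \<and>
    (\<forall>x\<in>V - V'. \<forall>f\<in>F. f \<otimes> x \<in> V \<longrightarrow> f \<otimes> x \<notin> V') \<and>
    (\<forall>\<zeta>\<in>\<Lambda>. (\<forall>x\<in>carrier G. x \<otimes> \<zeta> \<in> V' \<longleftrightarrow> x \<in> V') \<longrightarrow> \<zeta> \<in> \<Gamma> n)"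
proof -
  obtain S c where c: "labelling \<Lambda> V F S c" and VL: "periodic \<Lambda> V" using V by (auto simp: tiled_def)
  have VG: "V \<subseteq> carrier G" using VL by (auto simp: periodic_def)
  have Vn: "periodic (\<Gamma> n) V" if "n \<ge> n0" for n
    using periodic_mono[OF VL] chain_antimono[OF that] \<Lambda>(2) by blast
  obtain v where v: "v \<in> V" using V(2) by blast
  define \<kappa> where "\<kappa> = real (card (S \<times> S)) + 1"
  define m where "m = min \<epsilon> (1 / real (idx n0))"
  \<comment> \<open>Saturating a set multiplies its measure by at most \<open>\<kappa>\<close>; the boundary set gets \<open>2 * \<epsilon>'\<close> and the
    extra coset \<open>\<epsilon>'\<close>, which together stay below three quarters of \<open>m\<close>.\<close>
  define \<epsilon>' where "\<epsilon>' = m / (4 * \<kappa>)"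
  have \<kappa>: "\<kappa> \<ge> 1" by (simp add: \<kappa>_def)
  have m: "m > 0" using \<epsilon> idx_pos[of n0] by (simp add: m_def)
  have \<epsilon>': "\<epsilon>' > 0" "\<kappa> * \<epsilon>' = m / 4" using m \<kappa> by (auto simp: \<epsilon>'_def)
  obtain n1 B0 c1 S1 where n1: "n1 \<ge> n0" and B0: "periodic (\<Gamma> n1) B0" and S1: "finite S1" "S1 \<subseteq> carrier G"
      "\<forall>x\<in>carrier G. \<exists>s\<in>S1. c1 x = s \<otimes> x" 
      "\<forall>x\<in>carrier G. \<forall>\<gamma>\<in>\<Gamma> n1. c1 (x \<otimes> \<gamma>) = c1 x \<otimes> \<gamma>"
      "\<forall>x\<in>carrier G - B0. \<forall>f\<in>F'. c1 (f \<otimes> x) = c1 x"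
      "real (card {C \<in> rcosets (\<Gamma> n1). C \<subseteq> B0}) / real (idx n1) < \<epsilon>'"
    using bounded_labelling[OF am F' \<epsilon>'(1), of n0] by blast
  have mB0: "measure \<mu> (hat B0) < \<epsilon>'" using S1(6) measure_hat[OF \<mu> B0] by simp
  obtain n2' where n2': "\<And>n. n \<ge> n2' \<Longrightarrow> 1 / real (idx n) < \<epsilon>' / (real (card K) + 1)"
    using inverse_idx_small[of "\<epsilon>' / (real (card K) + 1)"] \<epsilon>' by auto
  define n2 where "n2 = max n1 n2'"
  have n2: "n2 \<ge> n1" "n2 \<ge> n0" using n1 by (auto simp: n2_def)
  define BK where "BK = (\<Union>a\<in>K. a <# \<Gamma> n2)"
  have perBK: "periodic (\<Gamma> n2) BK" 
    unfolding periodic_def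
  proof (intro conjI ballI)
    show "BK \<subseteq> carrier G" using lcoset_carrier K(2) by (auto simp: BK_def)
    fix x \<gamma> assume "x \<in> BK" "\<gamma> \<in> \<Gamma> n2"
    then obtain a where a: "a \<in> K" "x \<in> a <# \<Gamma> n2" by (auto simp: BK_def)
    then have "a \<in> carrier G" using K(2) by blast
    from periodic_lcoset[OF this, of n2] have "x \<otimes> \<gamma> \<in> a <# \<Gamma> n2"
      using a(2) \<open>\<gamma> \<in> \<Gamma> n2\<close> unfolding periodic_def by blast
    then show "x \<otimes> \<gamma> \<in> BK" using a(1) by (auto simp: BK_def)
  qed
  have "measure \<mu> (hat BK) \<le> real (card K) * (1 / real (idx n2))"
    unfolding BK_def
    by (rule measure_hat_UN_le[OF \<mu> K(1)])
       (use periodic_lcoset K(2) hat_lcoset measure_cyl[OF \<mu>] in \<open>auto simp: subset_iff\<close>)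
  also have "\<dots> \<le> real (card K) * (\<epsilon>' / (real (card K) + 1))"
    using n2'[of n2] by (intro mult_left_mono) (auto simp: n2_def)
  also have "\<dots> \<le> \<epsilon>'" using \<epsilon>' by (simp add: divide_simps)
  finally have mBK: "measure \<mu> (hat BK) \<le> \<epsilon>'" .
  define B where "B = B0 \<union> BK"
  have perB0: "periodic (\<Gamma> n2) B0" using periodic_mono[OF B0 chain_antimono[OF n2(1)]] .
  have perB: "periodic (\<Gamma> n2) B" unfolding B_def by (rule periodic_Un[OF perB0 perBK])
  have mB: "measure \<mu> (hat B) \<le> 2 * \<epsilon>'"
    using measure_hat_Un_le[OF \<mu> perB0 perBK] mB0 mBK by (simp add: B_def)
  define WB where "WB = tile_saturation c V B"
  have perWB: "periodic (\<Gamma> n2) WB"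
    unfolding WB_def by (rule periodic_tile_saturation[OF VL c perB])
      (use chain_antimono[OF n2(2)] \<Lambda> in blast)
  have "measure \<mu> (hat WB) \<le> real (card (S \<times> S)) * measure \<mu> (hat B)"
    unfolding WB_def by (rule measure_tile_saturation[OF \<mu> VL c perB])
  also have "\<dots> \<le> \<kappa> * (2 * \<epsilon>')"
    using mB by (intro mult_mono) (auto simp: \<kappa>_def)
  finally have mWB: "measure \<mu> (hat WB) \<le> m / 2" using \<epsilon>'(2) by simp
  have "WB \<noteq> V"
  proof
    assume "WB = V"
    then have "1 / real (idx n0) \<le> m / 2" using mWB measure_hat_pos[OF \<mu> Vn v] by force
    moreover have "m \<le> 1 / real (idx n0)" by (simp add: m_def)
    ultimately show False using m by linarith
  qed
  moreover have "WB \<subseteq> V" by (auto simp: WB_def tile_saturation_def)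
  ultimately obtain t where t: "t \<in> V" "t \<notin> WB" by blast
  have tc: "t \<in> carrier G" using t VG by blast
  obtain n3 where n3: "\<And>n. n \<ge> n3 \<Longrightarrow> 1 / real (idx n) < \<epsilon>'" using inverse_idx_small[OF \<epsilon>'(1)] by blast
  obtain n4 where n4: "\<And>n. n \<ge> n4 \<Longrightarrow> idx n \<ge> Suc (idx n2)" using idx_unbounded by blast
  \<comment> \<open>The index must grow strictly, so that the coset \<open>t <# \<Gamma> n2\<close> is not removed altogether.\<close>
  define n where "n = Suc (max n2 (max n3 n4))"
  have n: "n \<ge> n2" "n > n0" "1 / real (idx n) < \<epsilon>'" "idx n > idx n2"
  proof -
    have "n \<ge> n3" "n \<ge> n4" by (auto simp: n_def)
    then show "1 / real (idx n) < \<epsilon>'" "idx n > idx n2" using n3 n4[of n] by auto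
    show "n \<ge> n2" "n > n0" using n2(2) by (auto simp: n_def)
  qed
  have "\<Gamma> n \<noteq> \<Gamma> n2" using n(4) by (auto simp: idx_def)
  then obtain \<gamma>' where \<gamma>': "\<gamma>' \<in> \<Gamma> n2" "\<gamma>' \<notin> \<Gamma> n" using chain_antimono[OF n(1)] by blast
  have \<Gamma>\<Lambda>: "\<Gamma> n \<subseteq> \<Lambda>" "\<Gamma> n2 \<subseteq> \<Lambda>"
    using chain_antimono[of n0 n] chain_antimono[OF n2(2)] n(2) \<Lambda>(2) by auto
  define E where "E = t <# \<Gamma> n"
  have perE: "periodic (\<Gamma> n) E" unfolding E_def by (rule periodic_lcoset[OF tc])
  define WE where "WE = tile_saturation c V E"
  have perWE: "periodic (\<Gamma> n) WE"
    unfolding WE_def by (rule periodic_tile_saturation[OF VL c perE \<Gamma>\<Lambda>(1)])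
  have "measure \<mu> (hat WE) \<le> real (card (S \<times> S)) * measure \<mu> (hat E)"
    unfolding WE_def by (rule measure_tile_saturation[OF \<mu> VL c perE])
  also have "\<dots> \<le> \<kappa> * \<epsilon>'"
    using n(3) hat_lcoset[OF tc, of n] measure_cyl[OF \<mu> tc, of n]
    by (intro mult_mono) (auto simp: \<kappa>_def E_def)
  finally have mWE: "measure \<mu> (hat WE) \<le> m / 4" using \<epsilon>'(2) by simp
  define W where "W = WB \<union> WE"
  have W: "W = tile_saturation c V (B \<union> E)"
    unfolding W_def WB_def WE_def tile_saturation_def by blast
  have perWBn: "periodic (\<Gamma> n) WB" by (rule periodic_mono[OF perWB chain_antimono[OF n(1)]])
  have perW: "periodic (\<Gamma> n) W" unfolding W_def by (rule periodic_Un[OF perWBn perWE])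
  define V' where "V' = V - W"
  have V': "V' \<subseteq> V" "V - V' = W" by (auto simp: V'_def W tile_saturation_def)
  have "measure \<mu> (hat W) < \<epsilon>"
    using measure_hat_Un_le[OF \<mu> perWBn perWE] mWB mWE m by (simp add: W_def m_def)
  have disjB: "V' \<inter> B = {}" by (auto simp: V'_def W tile_saturation_def)
  have "labelling (\<Gamma> n) V' F' S1 c1"
    unfolding labelling_def
  proof (intro conjI ballI impI)
    fix x \<gamma> assume "x \<in> V'" "\<gamma> \<in> \<Gamma> n"
    then have "x \<in> carrier G" "\<gamma> \<in> \<Gamma> n1"
      using V'(1) VG chain_antimono[of n1 n] n(1) n2(1) by auto
    then show "c1 (x \<otimes> \<gamma>) = c1 x \<otimes> \<gamma>" using S1(4) by blast
  next
    fix x f assume "x \<in> V'" "f \<in> F'"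
    then show "c1 (f \<otimes> x) = c1 x" using S1(5) V'(1) VG disjB by (auto simp: B_def)
  qed (use S1 V' VG in auto)
  moreover have "periodic (\<Gamma> n) V'"
    unfolding V'_def by (rule periodic_Diff[OF subgroup_chain Vn perW]) (use n in simp)
  ultimately have "tiled (\<Gamma> n) V' F'" by (auto simp: tiled_def)
  moreover have "K \<inter> V' = {}"
  proof -
    have "K \<subseteq> BK" using lcoset_self K(2) by (auto simp: BK_def)
    then show ?thesis using disjB by (auto simp: B_def)
  qed
  moreover have "\<forall>x\<in>V - V'. \<forall>f\<in>F. f \<otimes> x \<in> V \<longrightarrow> f \<otimes> x \<notin> V'"
  proof (intro ballI impI)
    fix x f assume x: "x \<in> V - V'" and f: "f \<in> F" "f \<otimes> x \<in> V"
    then have "c (f \<otimes> x) = c x" "x \<in> W" using c V'(2) by (auto simp: labelling_def)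
    then have "f \<otimes> x \<in> W" using f unfolding W tile_saturation_def by auto
    then show "f \<otimes> x \<notin> V'" by (simp add: V'_def)
  qed
  moreover have "\<zeta> \<in> \<Gamma> n" if \<zeta>: "\<zeta> \<in> \<Lambda>" and stab: "\<forall>x\<in>carrier G. x \<otimes> \<zeta> \<in> V' \<longleftrightarrow> x \<in> V'" for \<zeta>
  proof -
    have \<Lambda>s: "subgroup \<Lambda> G" using \<Lambda>(1) normal_imp_subgroup by blast
    have \<zeta>c: "\<zeta> \<in> carrier G" using subgroup.mem_carrier[OF \<Lambda>s \<zeta>] .
    have "\<exists>s\<in>S. c t = s \<otimes> t" "S \<subseteq> carrier G" using c t(1) by (simp_all add: labelling_def)
    then obtain s where s: "s \<in> carrier G" "c t = s \<otimes> t" by blast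
    have ct: "c t \<in> carrier G" using s tc by simp
    \<comment> \<open>Among the points \<open>t \<otimes> \<gamma>\<close>, the extra coset removes only those of that coset itself, because \<open>c\<close>
      is equivariant and therefore injective on them.\<close>
    have inE: "\<gamma> \<in> \<Gamma> n" if \<gamma>: "\<gamma> \<in> \<Lambda>" "t \<otimes> \<gamma> \<in> WE" for \<gamma>
    proof -
      obtain y where y: "y \<in> V" "y \<in> E" "c y = c (t \<otimes> \<gamma>)" using \<gamma>(2) by (auto simp: WE_def tile_saturation_def)
      then obtain \<delta> where \<delta>: "\<delta> \<in> \<Gamma> n" "y = t \<otimes> \<delta>" by (auto simp: E_def l_coset_def)
      have "c t \<otimes> \<delta> = c t \<otimes> \<gamma>" using y(3) \<delta> c t(1) \<gamma>(1) \<Gamma>\<Lambda> by (auto simp: labelling_def subset_iff)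
      then have "\<delta> = \<gamma>" using ct \<delta>(1) \<gamma>(1) chain_carrier subgroup.mem_carrier[OF \<Lambda>s] by simp
      then show ?thesis using \<delta> by simp
    qed
    have "t \<in> E" using lcoset_self[OF tc] by (simp add: E_def)
    then have "t \<notin> V'" using t(1) by (auto simp: V'_def W tile_saturation_def)
    then have "t \<otimes> \<zeta> \<notin> V'" using stab tc by blast
    moreover have "t \<otimes> \<zeta> \<in> V" using VL t(1) \<zeta> by (auto simp: periodic_def)
    ultimately have "t \<otimes> \<zeta> \<in> WE \<or> t \<otimes> \<zeta> \<in> WB" by (auto simp: V'_def W_def)
    then show "\<zeta> \<in> \<Gamma> n"
    proof
      assume "t \<otimes> \<zeta> \<in> WE" then show ?thesis using inE \<zeta> by blast
    next
      assume WB: "t \<otimes> \<zeta> \<in> WB"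
      have \<gamma>c: "\<gamma>' \<in> carrier G" using \<gamma>' chain_carrier by blast
      \<comment> \<open>Otherwise \<open>t \<otimes> \<gamma>'\<close> survives, although its translate by \<open>\<zeta>\<close> lies in the \<open>\<Gamma> n2\<close>-periodic set
        \<open>WB\<close>.\<close>
      have "t \<otimes> \<gamma>' \<notin> WB" using periodic_mult_iff[OF perWB subgroup_chain tc \<gamma>'(1)] t(2) by simp
      moreover have "t \<otimes> \<gamma>' \<notin> WE" using inE[of \<gamma>'] \<gamma>' \<Gamma>\<Lambda>(2) by blast
      moreover have "t \<otimes> \<gamma>' \<in> V" using VL t(1) \<gamma>' \<Gamma>\<Lambda>(2) by (auto simp: periodic_def)
      ultimately have "t \<otimes> \<gamma>' \<in> V'" by (simp add: V'_def W_def)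
      then have "t \<otimes> \<gamma>' \<otimes> \<zeta> \<in> V'" using stab tc \<gamma>c by simp
      moreover have "t \<otimes> \<gamma>' \<otimes> \<zeta> = t \<otimes> \<zeta> \<otimes> (inv \<zeta> \<otimes> \<gamma>' \<otimes> \<zeta>)"
        using tc \<gamma>c \<zeta>c by (simp add: m_assoc[symmetric]) (simp add: m_assoc)
      moreover have "t \<otimes> \<zeta> \<otimes> (inv \<zeta> \<otimes> \<gamma>' \<otimes> \<zeta>) \<in> WB"
        using WB perWB chain_conj'[OF \<gamma>'(1) \<zeta>c] by (auto simp: periodic_def)
      ultimately show ?thesis by (simp add: V'_def W_def)
    qed
  qed
  ultimately show ?thesis using n(2) V' \<open>measure \<mu> (hat W) < \<epsilon>\<close> 
    by (intro exI[of _ n] conjI exI[of _ V']) auto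
qed

lemma finite_representatives:
  "\<exists>R. finite R \<and> R \<subseteq> carrier G \<and> (\<forall>x\<in>carrier G. \<exists>\<gamma>\<in>\<Gamma> n. x \<otimes> \<gamma> \<in> R)"
proof -
  define r where "r C = (SOME g. g \<in> C)" for C :: "'g set"
  have r: "r (x <# \<Gamma> n) \<in> x <# \<Gamma> n" if "x \<in> carrier G" for x
    unfolding r_def by (rule someI[of _ x]) (rule lcoset_self[OF that])
  have "\<exists>\<gamma>\<in>\<Gamma> n. x \<otimes> \<gamma> \<in> r ` (rcosets (\<Gamma> n))" if x: "x \<in> carrier G" for x
  proof -
    obtain \<gamma> where "\<gamma> \<in> \<Gamma> n" "r (x <# \<Gamma> n) = x \<otimes> \<gamma>" using r[OF x] by (auto simp: l_coset_def)
    then show ?thesis using lcoset_rcosets[OF x] by (metis imageI)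
  qed
  moreover have "r ` (rcosets (\<Gamma> n)) \<subseteq> carrier G"
    using r lcoset_carrier by (auto simp: rcosets_eq_lcosets)
  ultimately show ?thesis using finite_index by (intro exI[of _ "r ` (rcosets (\<Gamma> n))"]) auto
qed

end

text \<open>The data that the dynamics depends on. \<open>V\<close> and \<open>lv\<close> give the unfilled sets and their
  periods. By \<open>separated\<close>, no step in \<open>F m\<close> within \<open>V m\<close> leads from the points filled at stage \<open>m\<close> to the
  remaining ones. The conditions \<open>meets_next\<close> and \<open>meets_gap\<close> say that every coset in \<open>V m\<close> contains
  points filled later and points filled now; so all late stages occur near every point of the limit
  set. Rigidity makes a group element recognisable, modulo \<open>\<Gamma> (lv (Suc m))\<close>, from the right translates
  of finitely many \<open>V i\<close>, and the last condition provides room for every colour in the limit set.\<close>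

locale toeplitz_tower = residual_chain G \<Gamma> for G :: "('g, 'm) monoid_scheme" (structure) and \<Gamma> +
  fixes \<nu> :: "(nat \<Rightarrow> 'g set) measure" and k :: nat and lv :: "nat \<Rightarrow> nat"
    and V F :: "nat \<Rightarrow> 'g set" and col :: "'g \<Rightarrow> nat"
  assumes invariant: "inv_measure \<nu>"
    and k: "k \<ge> 2"
    and V_0: "V 0 = carrier G"
    and V_Suc: "V (Suc m) \<subseteq> V m"
    and lv_Suc: "lv m < lv (Suc m)"
    and V_periodic: "periodic (\<Gamma> (lv m)) (V m)"
    and separated: "x \<in> V m - V (Suc m) \<Longrightarrow> f \<in> F m \<Longrightarrow> f \<otimes> x \<in> V m \<Longrightarrow> f \<otimes> x \<notin> V (Suc m)"
    and F_Suc: "F m \<subseteq> F (Suc m)"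
    and F_cover: "x \<in> carrier G \<Longrightarrow> \<exists>m. x \<in> F m"
    and V_Inter: "x \<in> carrier G \<Longrightarrow> \<exists>m. x \<notin> V (Suc m)"
    and meets_next: "v \<in> V m \<Longrightarrow> \<exists>\<gamma>\<in>\<Gamma> (lv m). v \<otimes> \<gamma> \<in> V (Suc m)"
    and meets_gap: "v \<in> V m \<Longrightarrow> \<exists>\<gamma>\<in>\<Gamma> (lv m). v \<otimes> \<gamma> \<in> V m - V (Suc m)"
    and rigid: "\<zeta> \<in> carrier G \<Longrightarrow> (\<And>i x. i \<le> Suc m \<Longrightarrow> x \<in> carrier G \<Longrightarrow> x \<otimes> \<zeta> \<in> V i \<longleftrightarrow> x \<in> V i)
      \<Longrightarrow> \<zeta> \<in> \<Gamma> (lv (Suc m))"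
    and col_periodic: "x \<in> carrier G \<Longrightarrow> \<gamma> \<in> \<Gamma> (lv 0) \<Longrightarrow> col (x \<otimes> \<gamma>) = col x"
    and col_range: "x \<in> carrier G \<Longrightarrow> col x \<in> {1..<k}"
    and col_positive: "i \<in> {1..<k} \<Longrightarrow>
      measure \<nu> {\<xi>\<in>Y. (\<forall>m. \<xi> \<in> hat (V m)) \<and> \<xi> \<in> hat {x\<in>carrier G. col x = i}} > 0"

context residual_chain
begin

text \<open>Iterates \<open>tiled_refine\<close>, starting with \<open>G\<close> itself and its points as tiles. The removed measure
  is summable with a total below \<open>\<theta>\<close>, the mass of one coset of level \<open>N\<close>; each such coset therefore
  retains positive measure in the limit set. The index of \<open>\<Gamma> N\<close> is at least \<open>k\<close>, so its cosets can be
  given all \<open>k - 1\<close> colours.\<close>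

lemma toeplitz_tower_exists:
  assumes \<nu>: "inv_measure \<nu>" and am: "amenable_group G" and k: "k \<ge> 2"
  shows "\<exists>lv V F col. toeplitz_tower G \<Gamma> \<nu> k lv V F col"
proof -
  define F where "F m = insert \<one> (from_nat_into (carrier G) ` {..<m})" for m :: nat
  have carr: "from_nat_into (carrier G) i \<in> carrier G" for i
    using infinite_carrier by (intro from_nat_into) auto
  then have F: "finite (F m)" "F m \<subseteq> carrier G" for m by (auto simp: F_def)
  have F_cover: "\<exists>m. x \<in> F m" if "x \<in> carrier G" for x
  proof -
    have "from_nat_into (carrier G) (to_nat_on (carrier G) x) = x"
      using from_nat_into_to_nat_on[OF countable_carrier that] .
    then have "x \<in> F (Suc (to_nat_on (carrier G) x))" unfolding F_def by force
    then show ?thesis ..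
  qed
  obtain N where N: "idx N \<ge> k" using idx_unbounded by blast
  define \<theta> where "\<theta> = 1 / real (idx N)"
  have \<theta>: "\<theta> > 0" using idx_pos[of N] by (simp add: \<theta>_def)
  \<comment> \<open>The state consists of a level, a normal subgroup that preserves \<open>W\<close> and its tiling, and \<open>W\<close>.
    The subgroup is all of \<open>G\<close> at the beginning, so that rigidity starts without any assumption
    on \<open>\<zeta>\<close>.\<close>
  define P where "P m s = (case s of (n, \<Lambda>, W) \<Rightarrow> \<Lambda> \<lhd> G \<and> \<Gamma> n \<subseteq> \<Lambda> \<and> tiled \<Lambda> W (F m) \<and> W \<noteq> {} \<and>
      (m = 0 \<longrightarrow> s = (N, carrier G, carrier G)))" for m :: nat and s :: "nat \<times> 'g set \<times> 'g set"
  define R where "R m s s' = (case s of (n, \<Lambda>, W) \<Rightarrow> case s' of (n', \<Lambda>', W') \<Rightarrow>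
      n < n' \<and> \<Lambda>' = \<Gamma> n' \<and> W' \<subseteq> W \<and> F m \<inter> W' = {} \<and> 
      measure \<nu> (hat (W - W')) < \<theta> / 2 * (1/2) ^ Suc m \<and>
      (\<forall>x\<in>W - W'. \<forall>f\<in>F m. f \<otimes> x \<in> W \<longrightarrow> f \<otimes> x \<notin> W') \<and>
      (\<forall>\<zeta>\<in>\<Lambda>. (\<forall>x\<in>carrier G. x \<otimes> \<zeta> \<in> W' \<longleftrightarrow> x \<in> W') \<longrightarrow> \<zeta> \<in> \<Gamma> n') \<and>
      (\<forall>v\<in>W. \<exists>\<gamma>\<in>\<Gamma> n. v \<otimes> \<gamma> \<in> W') \<and> (\<forall>v\<in>W. \<exists>\<gamma>\<in>\<Gamma> n. v \<otimes> \<gamma> \<in> W - W'))"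
    for m :: nat and s s' :: "nat \<times> 'g set \<times> 'g set"
  have "\<exists>f. \<forall>m. P m (f m) \<and> R m (f m) (f (Suc m))"
  proof (rule dependent_nat_choice)
    have "labelling (carrier G) (carrier G) (F 0) {\<one>} (\<lambda>x. x)"
      by (auto simp: labelling_def F_def)
    then have "tiled (carrier G) (carrier G) (F 0)"
      unfolding tiled_def by (auto simp: periodic_def)
    moreover have "carrier G \<lhd> G"
      by (simp add: normal_inv_iff subgroup_self)
    ultimately have "P 0 (N, carrier G, carrier G)"
      using chain_carrier by (auto simp: P_def)
    then show "\<exists>s. P 0 s" ..
  next
    fix s m assume "P m s"
    then obtain n \<Lambda> W where s: "s = (n, \<Lambda>, W)" "\<Lambda> \<lhd> G" "\<Gamma> n \<subseteq> \<Lambda>" "tiled \<Lambda> W (F m)" "W \<noteq> {}"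
      by (cases s) (auto simp: P_def)
    have perW: "periodic (\<Gamma> n) W" using s periodic_mono by (auto simp: tiled_def)
    obtain T where T: "finite T" "T \<subseteq> carrier G" "\<forall>x\<in>carrier G. \<exists>\<gamma>\<in>\<Gamma> n. x \<otimes> \<gamma> \<in> T"
      using finite_representatives[of n] by (elim exE conjE) rule
    \<comment> \<open>Less than the mass of one coset is removed, so every coset of \<open>W\<close> keeps a point; as the
      representatives \<open>T\<close> are removed, it also loses one.\<close>
    define \<epsilon> where "\<epsilon> = min (\<theta> / 2 * (1/2) ^ Suc m) (1 / real (idx n))"
    have \<epsilon>: "\<epsilon> > 0" using \<theta> idx_pos[of n] by (simp add: \<epsilon>_def)
    have K: "finite (F m \<union> T)" "F m \<union> T \<subseteq> carrier G" using F T by auto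
    obtain n' W' where n': "n' > n" and W': "W' \<subseteq> W" "tiled (\<Gamma> n') W' (F (Suc m))"
        "(F m \<union> T) \<inter> W' = {}" "measure \<nu> (hat (W - W')) < \<epsilon>"
        "\<forall>x\<in>W - W'. \<forall>f\<in>F m. f \<otimes> x \<in> W \<longrightarrow> f \<otimes> x \<notin> W'"
        "\<forall>\<zeta>\<in>\<Lambda>. (\<forall>x\<in>carrier G. x \<otimes> \<zeta> \<in> W' \<longleftrightarrow> x \<in> W') \<longrightarrow> \<zeta> \<in> \<Gamma> n'"
      using tiled_refine[OF \<nu> am s(2-5) F[of "Suc m"] K \<epsilon>] by blast
    have nxt: "\<exists>\<gamma>\<in>\<Gamma> n. v \<otimes> \<gamma> \<in> W'" if v: "v \<in> W" for v
    proof (rule ccontr)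
      assume no: "\<not> ?thesis"
      have vc: "v \<in> carrier G" using v perW by (auto simp: periodic_def)
      have "v <# \<Gamma> n \<subseteq> W - W'"
        using no lcoset_subset[OF perW v] by (auto simp: l_coset_def)
      then have "measure \<nu> (hat (v <# \<Gamma> n)) \<le> measure \<nu> (hat (W - W'))" by (rule measure_hat_mono[OF \<nu>])
      then show False using measure_cyl[OF \<nu> vc, of n] hat_lcoset[OF vc, of n] W'(4) by (simp add: \<epsilon>_def)
    qed
    have gap: "\<exists>\<gamma>\<in>\<Gamma> n. v \<otimes> \<gamma> \<in> W - W'" if v: "v \<in> W" for v
    proof -
      have vc: "v \<in> carrier G" using v perW by (auto simp: periodic_def)
      then obtain \<gamma> where \<gamma>: "\<gamma> \<in> \<Gamma> n" "v \<otimes> \<gamma> \<in> T" using T(3) by blast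
      then have "v \<otimes> \<gamma> \<in> W - W'" using W'(3) v perW by (auto simp: periodic_def)
      then show ?thesis using \<gamma>(1) by blast
    qed
    have "P (Suc m) (n', \<Gamma> n', W')"
      using W' normal_chain nxt s(5) by (auto simp: P_def)
    moreover have "R m s (n', \<Gamma> n', W')"
      using W' n' nxt gap by (auto simp: R_def s(1) \<epsilon>_def)
    ultimately show "\<exists>s'. P (Suc m) s' \<and> R m s s'" by blast
  qed
  then obtain f where f: "\<And>m. P m (f m)" "\<And>m. R m (f m) (f (Suc m))" by blast
  define lv where "lv m = fst (f m)" for m
  define L where "L m = fst (snd (f m))" for m
  define V where "V m = snd (snd (f m))" for m
  have f_eq: "f m = (lv m, L m, V m)" for m by (simp add: lv_def L_def V_def)
  note fP = f(1)[unfolded P_def f_eq, simplified] and fR = f(2)[unfolded R_def f_eq, simplified]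
  have V_per: "periodic (\<Gamma> (lv m)) (V m)" for m
    using fP[of m] periodic_mono by (auto simp: tiled_def)
  have start: "lv 0 = N" "L 0 = carrier G" "V 0 = carrier G" using fP[of 0] by auto
  have L_Suc: "L (Suc m) = \<Gamma> (lv (Suc m))" for m using fR[of m] by blast
  obtain h where h: "bij_betw h (rcosets (\<Gamma> N)) {0..<idx N}"
    using ex_bij_betw_finite_nat[OF finite_index] by (auto simp: idx_def)
  define col where "col x = Suc (h (x <# \<Gamma> N) mod (k - 1))" for x
  have "toeplitz_tower G \<Gamma> \<nu> k lv V F col"
  proof (unfold_locales, goal_cases)
    case (3) then show ?case by (rule start)
  next
    case (4 m) then show ?case using fR[of m] by blast
  next
    case (5 m) then show ?case using fR[of m] by blast
  next
    case (7 x m f) then show ?case using fR[of m] by blast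
  next
    case (8 m) then show ?case by (auto simp: F_def)
  next
    case (10 x)
    then obtain m where "x \<in> F m" using F_cover by blast
    then show ?case using fR[of m] by blast
  next
    case (11 v m) then show ?case using fR[of m] by blast
  next
    case (12 v m) then show ?case using fR[of m] by blast
  next
    case (13 \<zeta> m)
    have "\<zeta> \<in> L i" if "i \<le> Suc m" for i
      using that
    proof (induction i)
      case 0 then show ?case using 13 start by simp
    next
      case (Suc i)
      have "\<zeta> \<in> L i" "\<forall>x\<in>carrier G. x \<otimes> \<zeta> \<in> V (Suc i) \<longleftrightarrow> x \<in> V (Suc i)"
        using Suc 13 by auto
      then show ?case using fR[of i] L_Suc[of i] by blast
    qed
    then show ?case using L_Suc[of m] by blast
  next
    case (14 x \<gamma>)
    have "(x \<otimes> \<gamma>) <# \<Gamma> N = x <# \<Gamma> N" using 14 start by (intro lcoset_eq) (auto simp: l_coset_def)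
    then show ?case by (simp add: col_def)
  next
    case (15 x) 
    have "h (x <# \<Gamma> N) mod (k - 1) < k - 1" using k by (intro mod_less_divisor) simp
    then show ?case by (auto simp: col_def)
  next
    case (16 i)
    interpret prob_space \<nu> by (rule inv_measureD[OF \<nu>])
    have sets: "hat A \<in> sets \<nu>" for A using hat_sets inv_measureD(2)[OF \<nu>] by simp
    have "i - 1 \<in> h ` (rcosets (\<Gamma> N))" using h 16 N by (auto simp: bij_betw_def)
    then obtain g where g: "g \<in> carrier G" "h (g <# \<Gamma> N) = i - 1"
      unfolding rcosets_eq_lcosets image_image by (elim imageE) simp
    have colg: "col x = i" if "x \<in> g <# \<Gamma> N" for x
    proof -
      have "i - 1 < k - 1" "i \<ge> 1" using 16 by auto
      then have "Suc ((i - 1) mod (k - 1)) = i" by (subst mod_less) auto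
      then show ?thesis using lcoset_eq[OF g(1) that] g(2) by (simp only: col_def)
    qed
    let ?D = "{\<xi>\<in>Y. (\<forall>m. \<xi> \<in> hat (V m)) \<and> \<xi> \<in> hat {x\<in>carrier G. col x = i}}"
    define U where "U = (\<Union>m. hat (V m - V (Suc m)))"
    have bound: "measure \<nu> (hat (V m - V (Suc m))) \<le> \<theta> / 2 * (1/2) ^ Suc m" for m
      using fR[of m] by simp
    have sums: "(\<lambda>m. \<theta> / 2 * (1/2) ^ Suc m) sums (\<theta> / 2 * 1)"
      by (intro sums_mult power_half_series)
    have summ: "summable (\<lambda>m. measure \<nu> (hat (V m - V (Suc m))))"
      by (rule summable_comparison_test'[OF sums_summable[OF sums], of 0]) (use bound in simp)
    have "measure \<nu> U \<le> (\<Sum>m. measure \<nu> (hat (V m - V (Suc m))))"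
      unfolding U_def by (rule finite_measure_subadditive_countably[OF _ summ]) (use sets in auto)
    also have "\<dots> \<le> (\<Sum>m. \<theta> / 2 * (1/2) ^ Suc m)"
      by (rule suminf_le[OF bound summ sums_summable[OF sums]])
    also have "\<dots> = \<theta> / 2" using sums_unique[OF sums] by simp
    finally have U: "measure \<nu> U \<le> \<theta> / 2" .
    have in_hat: "\<xi> \<in> hat (V m)" if \<xi>: "\<xi> \<in> Y" "\<xi> \<notin> U" for \<xi> m
    proof (induction m)
      case 0
      have "\<xi> 0 \<subseteq> carrier G" using Y_carrier[OF \<xi>(1)] by blast
      then show ?case using \<xi>(1) start(3) by (auto simp: hat_def)
    next
      case (Suc m)
      have le: "lv m \<le> lv (Suc m)" using fR[of m] by simp
      obtain g where g: "g \<in> \<xi> (lv (Suc m))" using Y_nonempty \<xi> by blast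
      have per: "periodic (\<Gamma> (lv (Suc m))) (V m)" by (rule periodic_mono[OF V_per chain_antimono[OF le]])
      have "g \<in> V m" using hat_iff[OF per \<xi>(1) g] Suc by blast
      moreover have "g \<notin> V m - V (Suc m)"
        using hat_iff[OF periodic_Diff[OF subgroup_chain per V_per] \<xi>(1) g] \<xi>(2) by (auto simp: U_def)
      ultimately show ?case using hat_iff[OF V_per \<xi>(1) g] by blast
    qed
    have "hat (g <# \<Gamma> N) - U \<subseteq> ?D"
    proof
      fix \<xi> assume \<xi>: "\<xi> \<in> hat (g <# \<Gamma> N) - U"
      then have \<xi>Y: "\<xi> \<in> Y" using hat_subset_Y by blast
      have "g <# \<Gamma> N \<subseteq> {x\<in>carrier G. col x = i}" using colg lcoset_carrier[OF g(1)] by blast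
      then have "\<xi> \<in> hat {x\<in>carrier G. col x = i}" using \<xi> hat_mono by blast
      then show "\<xi> \<in> ?D" using in_hat \<xi>Y \<xi> by blast
    qed
    moreover have Dsets: "?D \<in> sets \<nu>"
    proof -
      have "?D = (\<Inter>m. hat (V m)) \<inter> hat {x\<in>carrier G. col x = i}" using hat_subset_Y by auto
      then show ?thesis using sets by auto
    qed
    ultimately have "measure \<nu> (hat (g <# \<Gamma> N) - U) \<le> measure \<nu> ?D" by (rule finite_measure_mono)
    moreover have "measure \<nu> (hat (g <# \<Gamma> N)) \<le> measure \<nu> (hat (g <# \<Gamma> N) - U) + measure \<nu> U"
    proof -
      have "U \<in> sets \<nu>" using sets by (auto simp: U_def)
      then have "measure \<nu> ((hat (g <# \<Gamma> N) - U) \<union> U) \<le> measure \<nu> (hat (g <# \<Gamma> N) - U) + measure \<nu> U"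
        using sets by (intro measure_Un_le) auto
      moreover have "measure \<nu> (hat (g <# \<Gamma> N)) \<le> measure \<nu> ((hat (g <# \<Gamma> N) - U) \<union> U)"
        using sets \<open>U \<in> sets \<nu>\<close> by (intro finite_measure_mono) auto
      ultimately show ?thesis by linarith
    qed
    moreover have "measure \<nu> (hat (g <# \<Gamma> N)) = \<theta>"
      using hat_lcoset[OF g(1)] measure_cyl[OF \<nu> g(1)] by (simp add: \<theta>_def)
    ultimately show ?case using U \<theta> by linarith
  qed (use \<nu> k V_per F_cover in auto)
  then show ?thesis by blast
qed

end


section \<open>The array of a tower and the factor map\<close>

context toeplitz_tower
begin

definition stage :: "'g \<Rightarrow> nat" where "stage g = (LEAST m. g \<notin> V (Suc m))"

text \<open>Each stage class \<open>j = m mod k\<close> has its own pattern of values: the points of colour \<open>j\<close> get \<open>True\<close>, so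
  \<open>j = 0\<close> is the constant pattern.\<close>

definition x0 :: "'g \<Rightarrow> bool" where "x0 = (\<lambda>g\<in>carrier G. col g = stage g mod k)"

lemma lv_mono: "i \<le> m \<Longrightarrow> lv i \<le> lv m"
  by (rule lift_Suc_mono_le[of lv]) (auto intro: less_imp_le lv_Suc)

lemma lv_ge: "m \<le> lv m"
proof (induction m)
  case (Suc m) then show ?case using lv_Suc[of m] by linarith
qed simp

lemma V_antimono: "i \<le> m \<Longrightarrow> V m \<subseteq> V i"
  by (rule lift_Suc_antimono_le[of V]) (use V_Suc in auto)

lemma V_carrier: "x \<in> V m \<Longrightarrow> x \<in> carrier G"
  using V_antimono[of 0 m] V_0 by auto

lemma F_mono: "i \<le> m \<Longrightarrow> F i \<subseteq> F m"
  by (rule lift_Suc_mono_le[of F]) (use F_Suc in auto)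

lemma F_finite_cover:
  assumes "finite T" "T \<subseteq> carrier G"
  shows "\<exists>m. T \<subseteq> F m"
  using assms
proof (induction T rule: finite_induct)
  case (insert t T)
  then obtain m m' where "T \<subseteq> F m" "t \<in> F m'" using F_cover by blast
  then have "insert t T \<subseteq> F (max m m')" using F_mono[of m "max m m'"] F_mono[of m' "max m m'"] by auto
  then show ?case ..
qed simp

lemma V_periodic_le: "i \<le> m \<Longrightarrow> periodic (\<Gamma> (lv m)) (V i)"
  using periodic_mono[OF V_periodic chain_antimono[OF lv_mono]] .

lemma V_mult_iff: "i \<le> m \<Longrightarrow> x \<in> carrier G \<Longrightarrow> \<gamma> \<in> \<Gamma> (lv m) \<Longrightarrow> x \<otimes> \<gamma> \<in> V i \<longleftrightarrow> x \<in> V i"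
  using periodic_mult_iff[OF V_periodic_le subgroup_chain] .

lemma col_mult: "x \<in> carrier G \<Longrightarrow> \<gamma> \<in> \<Gamma> (lv m) \<Longrightarrow> col (x \<otimes> \<gamma>) = col x"
  using col_periodic chain_antimono[OF lv_mono, of 0 m] by blast

lemma stage_iff: 
  assumes "x \<in> carrier G"
  shows "stage x = m \<longleftrightarrow> x \<in> V m - V (Suc m)"
proof
  assume m: "stage x = m"
  have "x \<notin> V (Suc m)" using LeastI_ex[OF V_Inter[OF assms]] m by (simp add: stage_def)
  moreover have "x \<in> V m"
  proof (cases m)
    case 0 then show ?thesis using assms V_0 by simp
  next
    case (Suc i)
    then have "i < (LEAST m. x \<notin> V (Suc m))" using m by (simp add: stage_def)
    then show ?thesis using not_less_Least Suc by blast
  qed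
  ultimately show "x \<in> V m - V (Suc m)" by blast
next
  assume m: "x \<in> V m - V (Suc m)"
  show "stage x = m"
    unfolding stage_def
  proof (rule Least_equality)
    fix i assume i: "x \<notin> V (Suc i)"
    show "m \<le> i"
    proof (rule ccontr)
      assume "\<not> m \<le> i"
      then have "V m \<subseteq> V (Suc i)" by (intro V_antimono) simp
      then show False using i m by blast
    qed
  qed (use m in blast)
qed

lemma V_iff_stage:
  assumes "x \<in> carrier G"
  shows "x \<in> V m \<longleftrightarrow> m \<le> stage x"
proof -
  have "x \<in> V (stage x)" "x \<notin> V (Suc (stage x))" using stage_iff[OF assms] by auto
  then show ?thesis using V_antimono[of m "stage x"] V_antimono[of "Suc (stage x)" m]
    by (cases "m \<le> stage x") auto
qed

lemma reach_next:
  assumes "m \<le> m'" "v \<in> V m"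
  shows "\<exists>\<gamma>\<in>\<Gamma> (lv m). v \<otimes> \<gamma> \<in> V m'"
  using assms
proof (induction m' rule: dec_induct)
  case base
  then show ?case using chain_one V_carrier by (intro bexI[of _ \<one>]) auto
next
  case (step i)
  then obtain \<gamma> where \<gamma>: "\<gamma> \<in> \<Gamma> (lv m)" "v \<otimes> \<gamma> \<in> V i" by blast
  obtain \<delta> where \<delta>: "\<delta> \<in> \<Gamma> (lv i)" "v \<otimes> \<gamma> \<otimes> \<delta> \<in> V (Suc i)" using meets_next[OF \<gamma>(2)] by blast
  have "\<delta> \<in> \<Gamma> (lv m)" using \<delta> chain_antimono[OF lv_mono] step by blast
  then show ?case
    using \<gamma> \<delta> chain_mult[OF \<gamma>(1)] V_carrier[OF step.prems] chain_carrier
    by (intro bexI[of _ "\<gamma> \<otimes> \<delta>"]) (auto simp: m_assoc)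
qed

lemma reach_stage:
  assumes "v \<in> V m" "m \<le> m'"
  shows "\<exists>\<gamma>\<in>\<Gamma> (lv m). stage (v \<otimes> \<gamma>) = m'"
proof -
  obtain \<gamma> where \<gamma>: "\<gamma> \<in> \<Gamma> (lv m)" "v \<otimes> \<gamma> \<in> V m'" using reach_next[OF assms(2,1)] by blast
  obtain \<delta> where \<delta>: "\<delta> \<in> \<Gamma> (lv m')" "v \<otimes> \<gamma> \<otimes> \<delta> \<in> V m' - V (Suc m')" using meets_gap[OF \<gamma>(2)] by blast
  have "\<delta> \<in> \<Gamma> (lv m)" using \<delta> chain_antimono[OF lv_mono] assms by blast
  moreover have "v \<otimes> \<gamma> \<otimes> \<delta> = v \<otimes> (\<gamma> \<otimes> \<delta>)"
    using V_carrier[OF assms(1)] chain_carrier \<gamma> \<delta> by (auto simp: m_assoc)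
  ultimately show ?thesis
    using \<gamma> \<delta> chain_mult[OF \<gamma>(1)] stage_iff[of "v \<otimes> \<gamma> \<otimes> \<delta>" m'] V_carrier
    by (intro bexI[of _ "\<gamma> \<otimes> \<delta>"]) auto
qed

lemma stage_mult:
  assumes "x \<in> carrier G" "\<gamma> \<in> \<Gamma> (lv (Suc (stage x)))"
  shows "stage (x \<otimes> \<gamma>) = stage x"
proof -
  have c: "x \<otimes> \<gamma> \<in> carrier G" using assms chain_carrier by blast
  have "x \<in> V (stage x) - V (Suc (stage x))" using stage_iff[OF assms(1)] by blast
  then have "x \<otimes> \<gamma> \<in> V (stage x) - V (Suc (stage x))"
    using V_mult_iff[OF _ assms, of "stage x"] V_mult_iff[OF _ assms, of "Suc (stage x)"] by simp
  then show ?thesis using stage_iff[OF c] by blast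
qed

lemma x0_mult:
  assumes "x \<in> carrier G" "\<gamma> \<in> \<Gamma> (lv (Suc (stage x)))"
  shows "x0 (x \<otimes> \<gamma>) = x0 x"
  using stage_mult[OF assms] col_mult[OF assms] assms chain_carrier by (auto simp: x0_def)

text \<open>Within \<open>V m\<close>, steps by elements of \<open>F m\<close> do not change the stage at which a point is
  filled: this is what the separation of tiles is for.\<close>

lemma stage_step:
  assumes x: "x \<in> V m" "f \<otimes> x \<in> V m" and f: "f \<in> F m" "inv f \<in> F m" "f \<in> carrier G"
  shows "stage (f \<otimes> x) = stage x"
proof -
  have le: "stage (f \<otimes> x) \<le> stage x" if x: "x \<in> V m" "f \<otimes> x \<in> V m" and f: "f \<in> F m" for f x
  proof (rule ccontr)
    have c: "x \<in> carrier G" "f \<otimes> x \<in> carrier G" using x V_carrier by auto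
    assume "\<not> ?thesis"
    then have s: "Suc (stage x) \<le> stage (f \<otimes> x)" by simp
    have "x \<in> V (stage x) - V (Suc (stage x))" using stage_iff[OF c(1)] by blast
    moreover have "f \<otimes> x \<in> V (stage x)" using s V_iff_stage[OF c(2)] by simp
    moreover have "f \<in> F (stage x)" using f F_mono V_iff_stage[OF c(1)] x by blast
    ultimately have "f \<otimes> x \<notin> V (Suc (stage x))" using separated by blast
    then show False using s V_iff_stage[OF c(2)] by simp
  qed
  have "inv f \<otimes> (f \<otimes> x) = x" using f x V_carrier by (simp add: m_assoc[symmetric])
  then show ?thesis using le[OF x f(1)] le[of "f \<otimes> x" "inv f"] x f by auto
qed

subsection \<open>Recovering the odometer coordinate from the array\<close>

text \<open>Filling classes rotate through all residues modulo \<open>k\<close> within \<open>k\<close> stages. The class of the colour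
  yields \<open>True\<close>, the class \<open>0\<close> yields \<open>False\<close>.\<close>

lemma x0_values:
  assumes a: "a \<in> V m"
  shows "\<exists>\<gamma>\<in>\<Gamma> (lv m). stage (a \<otimes> \<gamma>) \<le> m + k \<and> (x0 (a \<otimes> \<gamma>) \<longleftrightarrow> b)"
proof -
  have ac: "a \<in> carrier G" using a V_carrier by blast
  have mk: "m mod k < k" using k by simp
  have col: "col a < k" "col a \<ge> 1" using col_range[OF ac] by auto
  define c where "c = (if b then col a else 0)"
  have c: "c < k" using col k by (auto simp: c_def)
  \<comment> \<open>The first stage from \<open>m\<close> on with residue \<open>c\<close>.\<close>
  define m' where "m' = m + (c + (k - m mod k)) mod k"
  have "m' mod k = (m + (c + (k - m mod k))) mod k" by (simp add: m'_def mod_add_right_eq)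
  also have "\<dots> = (m mod k + (c + (k - m mod k))) mod k" by (simp add: mod_add_left_eq)
  also have "m mod k + (c + (k - m mod k)) = c + k" using mk by simp
  finally have m'k: "m' mod k = c" using c by simp
  have "(c + (k - m mod k)) mod k < k" using k by simp
  then have m': "m \<le> m'" "m' \<le> m + k" by (simp_all add: m'_def)
  obtain \<gamma> where \<gamma>: "\<gamma> \<in> \<Gamma> (lv m)" "stage (a \<otimes> \<gamma>) = m'" using reach_stage[OF a m'(1)] by blast
  have "x0 (a \<otimes> \<gamma>) \<longleftrightarrow> col a = m' mod k"
    using \<gamma> col_mult[OF ac \<gamma>(1)] ac chain_carrier by (auto simp: x0_def)
  then have "x0 (a \<otimes> \<gamma>) \<longleftrightarrow> b" using m'k col by (auto simp: c_def)
  then show ?thesis using \<gamma> m' by blast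
qed

lemma x0_const:
  assumes a: "a \<in> carrier G" "a \<notin> V m" and \<gamma>: "\<gamma> \<in> \<Gamma> (lv m)"
  shows "x0 (a \<otimes> \<gamma>) = x0 a"
proof -
  have "Suc (stage a) \<le> m" using a V_iff_stage by simp
  then have "\<gamma> \<in> \<Gamma> (lv (Suc (stage a)))" using chain_antimono[OF lv_mono] \<gamma> by blast
  then show ?thesis using x0_mult a by blast
qed

text \<open>A coset at level \<open>lv m\<close> lies in \<open>V m\<close> exactly if \<open>x0\<close> takes both values on it, and finitely
  many positions suffice to see this. Hence a finite window of a translate of \<open>x0\<close> determines the translates of finitely
  many \<open>V i\<close>, and by rigidity the coset of the translating element.\<close>

lemma window_exists:
  "\<exists>K. finite K \<and> K \<subseteq> carrier G \<and>
    (\<forall>g\<in>carrier G. \<forall>g'\<in>carrier G. (\<forall>h\<in>K. x0 (h \<otimes> g) = x0 (h \<otimes> g')) \<longrightarrow> g' \<in> g <# \<Gamma> n)"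
proof -
  obtain K where K: "finite K" "K \<subseteq> carrier G" "\<forall>x\<in>carrier G. \<exists>\<gamma>\<in>\<Gamma> (lv (Suc (Suc n + k))). x \<otimes> \<gamma> \<in> K"
    using finite_representatives[of "lv (Suc (Suc n + k))"] by (elim exE conjE) rule
  have transfer: "u \<otimes> g' \<in> V m"
    if g: "g \<in> carrier G" "g' \<in> carrier G" and eq: "\<forall>h\<in>K. x0 (h \<otimes> g) = x0 (h \<otimes> g')"
      and m: "m \<le> Suc n" and u: "u \<in> carrier G" "u \<otimes> g \<in> V m" for g g' m u
  proof (rule ccontr)
    assume nV: "u \<otimes> g' \<notin> V m"
    have val: "x0 (u \<otimes> g') = b" for b
    proof -
      obtain \<gamma> where \<gamma>: "\<gamma> \<in> \<Gamma> (lv m)" "stage (u \<otimes> g \<otimes> \<gamma>) \<le> m + k" "x0 (u \<otimes> g \<otimes> \<gamma>) = b"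
        using x0_values[OF u(2), of b] by blast
      have \<gamma>c: "\<gamma> \<in> carrier G" using \<gamma> chain_carrier by blast
      \<comment> \<open>Normality moves \<open>\<gamma>\<close> to the left of \<open>g\<close>, where it can be absorbed into a position of the window.\<close>
      define \<gamma>' where "\<gamma>' = g \<otimes> \<gamma> \<otimes> inv g"
      have \<gamma>': "\<gamma>' \<in> \<Gamma> (lv m)" "\<gamma>' \<in> carrier G" 
        using chain_conj[OF \<gamma>(1) g(1)] chain_carrier by (auto simp: \<gamma>'_def)
      obtain \<delta> where \<delta>: "\<delta> \<in> \<Gamma> (lv (Suc (Suc n + k)))" "u \<otimes> \<gamma>' \<otimes> \<delta> \<in> K" using K(3) u \<gamma>' by (meson m_closed)
      have \<delta>c: "\<delta> \<in> carrier G" using \<delta> chain_carrier by blast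
      define \<delta>g where "\<delta>g = inv g \<otimes> \<delta> \<otimes> g"
      have "\<delta>g \<in> \<Gamma> (lv (Suc (Suc n + k)))" unfolding \<delta>g_def by (rule chain_conj'[OF \<delta>(1) g(1)])
      moreover have "Suc (stage (u \<otimes> g \<otimes> \<gamma>)) \<le> Suc (Suc n + k)" using \<gamma>(2) m by simp
      ultimately have "\<delta>g \<in> \<Gamma> (lv (Suc (stage (u \<otimes> g \<otimes> \<gamma>))))" using chain_antimono[OF lv_mono] by blast
      then have "x0 (u \<otimes> g \<otimes> \<gamma> \<otimes> \<delta>g) = b" using x0_mult \<gamma> \<gamma>c u g by simp
      moreover have "u \<otimes> g \<otimes> \<gamma> \<otimes> \<delta>g = u \<otimes> \<gamma>' \<otimes> \<delta> \<otimes> g"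
        unfolding \<delta>g_def \<gamma>'_def using u g \<gamma>c \<delta>c by (simp add: m_assoc)
      ultimately have 1: "x0 (u \<otimes> \<gamma>' \<otimes> \<delta> \<otimes> g') = b" using eq \<delta>(2) by auto
      have "\<delta> \<in> \<Gamma> (lv m)" using \<delta>(1) chain_antimono[OF lv_mono[of m "Suc (Suc n + k)"]] m by auto
      then have "inv g' \<otimes> (\<gamma>' \<otimes> \<delta>) \<otimes> g' \<in> \<Gamma> (lv m)" using chain_conj' chain_mult \<gamma>' g by blast
      then have "x0 (u \<otimes> g' \<otimes> (inv g' \<otimes> (\<gamma>' \<otimes> \<delta>) \<otimes> g')) = x0 (u \<otimes> g')" using x0_const nV u g by blast
      moreover have "u \<otimes> g' \<otimes> (inv g' \<otimes> (\<gamma>' \<otimes> \<delta>) \<otimes> g') = u \<otimes> \<gamma>' \<otimes> \<delta> \<otimes> g'"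
        using u g \<gamma>' \<delta>c by (simp add: m_assoc[symmetric]) (simp add: m_assoc)
      ultimately show ?thesis using 1 by simp
    qed
    show False using val[of True] val[of False] by blast
  qed
  have "g' \<in> g <# \<Gamma> n" if g: "g \<in> carrier G" "g' \<in> carrier G" and eq: "\<forall>h\<in>K. x0 (h \<otimes> g) = x0 (h \<otimes> g')" for g g'
  proof -
    define \<zeta> where "\<zeta> = inv g \<otimes> g'"
    have \<zeta>: "\<zeta> \<in> carrier G" using g by (simp add: \<zeta>_def)
    have "x \<otimes> \<zeta> \<in> V i \<longleftrightarrow> x \<in> V i" if "i \<le> Suc n" "x \<in> carrier G" for i x
    proof -
      define u where "u = x \<otimes> inv g"
      have u: "u \<in> carrier G" "u \<otimes> g = x" "u \<otimes> g' = x \<otimes> \<zeta>"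
        using that g by (simp_all add: u_def \<zeta>_def m_assoc)
      show ?thesis using transfer[OF g eq that(1) u(1)] transfer[OF g(2,1) _ that(1) u(1)] eq u(2,3) by auto
    qed
    then have "\<zeta> \<in> \<Gamma> (lv (Suc n))" by (rule rigid[OF \<zeta>])
    then have "\<zeta> \<in> \<Gamma> n" using chain_antimono[of n "lv (Suc n)"] lv_ge[of "Suc n"] by auto
    then show ?thesis using lcoset_mem_iff[OF g] by (simp add: \<zeta>_def)
  qed
  then show ?thesis using K by blast
qed

definition window :: "nat \<Rightarrow> 'g set" where
  "window n = (SOME K. finite K \<and> K \<subseteq> carrier G \<and>
    (\<forall>g\<in>carrier G. \<forall>g'\<in>carrier G. (\<forall>h\<in>K. x0 (h \<otimes> g) = x0 (h \<otimes> g')) \<longrightarrow> g' \<in> g <# \<Gamma> n))"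

lemma window: "finite (window n)" "window n \<subseteq> carrier G"
  "g \<in> carrier G \<Longrightarrow> g' \<in> carrier G \<Longrightarrow> (\<And>h. h \<in> window n \<Longrightarrow> x0 (h \<otimes> g) = x0 (h \<otimes> g')) \<Longrightarrow> g' \<in> g <# \<Gamma> n"
  using someI_ex[OF window_exists[of n], folded window_def] by blast+

abbreviation X :: "('g \<Rightarrow> bool) set" where "X \<equiv> orbit_closure G x0"
abbreviation XT :: "('g \<Rightarrow> bool) topology" where "XT \<equiv> orbit_subshift G x0"
abbreviation shift :: "'g \<Rightarrow> ('g \<Rightarrow> bool) \<Rightarrow> ('g \<Rightarrow> bool)" where "shift \<equiv> shift_action G"

lemma full_shift_eq: "full_shift G =
    subtopology (product_topology (\<lambda>_. discrete_topology UNIV) (carrier G)) (extensional (carrier G))"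
proof -
  have "topspace (full_shift G) = extensional (carrier G)" by (auto simp: full_shift_def PiE_def)
  then have "full_shift G = subtopology (full_shift G) (extensional (carrier G))"
    using subtopology_topspace[of "full_shift G"] by simp
  then show ?thesis by (simp only: full_shift_def)
qed

lemma topspace_full_shift [simp]: "topspace (full_shift G) = extensional (carrier G)"
  by (auto simp: full_shift_def PiE_def)

lemma closure_full_shift_iff:
  assumes "A \<subseteq> extensional (carrier G)"
  shows "x \<in> full_shift G closure_of A \<longleftrightarrow> x \<in> extensional (carrier G) \<and>
    (\<forall>K. finite K \<and> K \<subseteq> carrier G \<longrightarrow> (\<exists>y\<in>A. \<forall>h\<in>K. y h = x h))" (is "_ \<longleftrightarrow> _ \<and> ?R")
proof (intro iffI conjI allI impI)
  assume x: "x \<in> full_shift G closure_of A"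
  then show xe: "x \<in> extensional (carrier G)" using closure_of_subset_topspace by fastforce
  fix K assume K: "finite K \<and> K \<subseteq> carrier G"
  have "openin (full_shift G) {y\<in>extensional (carrier G). \<forall>h\<in>K. y h = x h}"
    unfolding full_shift_eq openin_discrete_product_iff[OF order_refl]
    using K by auto
  moreover have *: "\<And>T. x \<in> T \<and> openin (full_shift G) T \<Longrightarrow> \<exists>y. y \<in> A \<and> y \<in> T"
    using x unfolding in_closure_of by simp
  ultimately have "\<exists>y. y \<in> A \<and> y \<in> {y\<in>extensional (carrier G). \<forall>h\<in>K. y h = x h}"
    using xe by (intro *) simp
  then show "\<exists>y\<in>A. \<forall>h\<in>K. y h = x h" by (elim exE conjE) auto
next
  assume R: "x \<in> extensional (carrier G) \<and> ?R"
  show "x \<in> full_shift G closure_of A"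
    unfolding in_closure_of
  proof (intro conjI allI impI)
    fix T assume T: "x \<in> T \<and> openin (full_shift G) T"
    then have "\<forall>x\<in>T. \<exists>K. finite K \<and> K \<subseteq> carrier G \<and> {y\<in>extensional (carrier G). \<forall>h\<in>K. y h = x h} \<subseteq> T"
      using openin_discrete_product_iff[OF order_refl, of "carrier G" T] unfolding full_shift_eq by simp
    then have "\<exists>K. finite K \<and> K \<subseteq> carrier G \<and> {y\<in>extensional (carrier G). \<forall>h\<in>K. y h = x h} \<subseteq> T"
      by (rule bspec) (use T in simp)
    then obtain K where K: "finite K \<and> K \<subseteq> carrier G" "{y\<in>extensional (carrier G). \<forall>h\<in>K. y h = x h} \<subseteq> T"
      by (elim exE conjE) simp
    obtain y where "y \<in> A" "\<forall>h\<in>K. y h = x h" using R K(1) by meson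
    then show "\<exists>y. y \<in> A \<and> y \<in> T" using K assms by (intro exI[of _ y]) auto
  qed (use R in simp)
qed

lemma shift_apply: "h \<in> carrier G \<Longrightarrow> shift g x h = x (h \<otimes> g)"
  by (simp add: shift_action_def)

lemma shift_extensional: "shift g x \<in> extensional (carrier G)"
  by (simp add: shift_action_def)

lemma X_iff: "x \<in> X \<longleftrightarrow> x \<in> extensional (carrier G) \<and>
    (\<forall>K. finite K \<and> K \<subseteq> carrier G \<longrightarrow> (\<exists>g\<in>carrier G. \<forall>h\<in>K. x h = x0 (h \<otimes> g)))"
proof -
  have "(\<exists>y\<in>(\<lambda>g. shift g x0) ` carrier G. \<forall>h\<in>K. y h = x h) \<longleftrightarrow> (\<exists>g\<in>carrier G. \<forall>h\<in>K. x h = x0 (h \<otimes> g))"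
    if "K \<subseteq> carrier G" for K
  proof -
    have "shift g x0 h = x0 (h \<otimes> g)" if "h \<in> K" for g h
      using that \<open>K \<subseteq> carrier G\<close> by (intro shift_apply) auto
    then show ?thesis by (simp add: eq_commute)
  qed
  moreover have "(\<lambda>g. shift g x0) ` carrier G \<subseteq> extensional (carrier G)" using shift_extensional by blast
  ultimately show ?thesis
    unfolding orbit_closure_def by (simp only: closure_full_shift_iff cong: conj_cong imp_cong)
qed

lemma X_approx:
  assumes "x \<in> X" "finite K" "K \<subseteq> carrier G"
  obtains g where "g \<in> carrier G" "\<And>h. h \<in> K \<Longrightarrow> x h = x0 (h \<otimes> g)"
proof -
  have "\<exists>g\<in>carrier G. \<forall>h\<in>K. x h = x0 (h \<otimes> g)" using assms unfolding X_iff by simp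
  then show ?thesis using that by (elim bexE) simp
qed

lemma X_extensional: "X \<subseteq> extensional (carrier G)"
  by (rule subsetI) (simp only: X_iff)

lemma topspace_XT [simp]: "topspace XT = X"
  using X_extensional by (auto simp: orbit_subshift_def)

lemma XT_eq: "XT = subtopology (product_topology (\<lambda>_. discrete_topology UNIV) (carrier G)) X"
  by (simp add: orbit_subshift_def full_shift_def)


lemma shift_X: assumes "x \<in> X" "g \<in> carrier G" shows "shift g x \<in> X"
  unfolding X_iff
proof (intro conjI allI impI)
  fix K assume K: "finite K \<and> K \<subseteq> carrier G"
  have K': "finite ((\<lambda>h. h \<otimes> g) ` K)" "(\<lambda>h. h \<otimes> g) ` K \<subseteq> carrier G" using K assms by auto
  obtain a where a: "a \<in> carrier G" "\<And>h. h \<in> (\<lambda>h. h \<otimes> g) ` K \<Longrightarrow> x h = x0 (h \<otimes> a)"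
    using X_approx[OF assms(1) K'] by metis
  have "shift g x h = x0 (h \<otimes> (g \<otimes> a))" if "h \<in> K" for h
  proof -
    have "h \<in> carrier G" using K that by blast
    then show ?thesis using a(1) a(2)[of "h \<otimes> g"] that assms(2) by (simp add: shift_apply m_assoc)
  qed
  then show "\<exists>g'\<in>carrier G. \<forall>h\<in>K. shift g x h = x0 (h \<otimes> g')" using a assms by blast
qed (rule shift_extensional)

lemma shift_mult: "x \<in> extensional (carrier G) \<Longrightarrow> g \<in> carrier G \<Longrightarrow> h \<in> carrier G \<Longrightarrow> shift (g \<otimes> h) x = shift g (shift h x)"
  by (rule extensionalityI[OF shift_extensional shift_extensional]) (auto simp: shift_apply m_assoc)

lemma shift_one: "x \<in> extensional (carrier G) \<Longrightarrow> shift \<one> x = x"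
  by (rule extensionalityI[OF shift_extensional]) (auto simp: shift_apply)

text \<open>Any group element whose translate of \<open>x0\<close> agrees with \<open>x\<close> on the window gives the same coset.\<close>

definition beta :: "('g \<Rightarrow> bool) \<Rightarrow> nat \<Rightarrow> 'g set" where
  "beta x n = (SOME g. g \<in> carrier G \<and> (\<forall>h\<in>window n. x h = x0 (h \<otimes> g))) <# \<Gamma> n"

lemma beta_mem:
  assumes "x \<in> X" "g \<in> carrier G" "\<And>h. h \<in> window n \<Longrightarrow> x h = x0 (h \<otimes> g)"
  shows "g \<in> beta x n"
proof -
  let ?P = "\<lambda>g. g \<in> carrier G \<and> (\<forall>h\<in>window n. x h = x0 (h \<otimes> g))"
  have "?P g" using assms by blast
  define a where "a = (SOME g. ?P g)"
  have a: "?P a" unfolding a_def by (rule someI) fact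
  have "x0 (h \<otimes> a) = x0 (h \<otimes> g)" if "h \<in> window n" for h
    using a assms(3)[OF that] that by metis
  then have "g \<in> a <# \<Gamma> n" using a assms(2) by (intro window(3)) auto
  then show ?thesis unfolding beta_def a_def .
qed

lemma beta_coset: "x \<in> X \<Longrightarrow> \<exists>g\<in>carrier G. beta x n = g <# \<Gamma> n"
proof -
  assume "x \<in> X"
  let ?P = "\<lambda>g. g \<in> carrier G \<and> (\<forall>h\<in>window n. x h = x0 (h \<otimes> g))"
  have "\<exists>g. ?P g" using X_approx[OF \<open>x \<in> X\<close> window(1,2)[of n]] by metis
  then have "?P (SOME g. ?P g)" by (rule someI_ex)
  then show ?thesis unfolding beta_def by blast
qed

lemma beta_Y:
  assumes "x \<in> X" shows "beta x \<in> Y"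
proof (rule YI)
  fix n
  show "\<exists>g\<in>carrier G. beta x n = g <# \<Gamma> n" using beta_coset assms .
  have "finite (window n \<union> window (Suc n))" "window n \<union> window (Suc n) \<subseteq> carrier G"
    using window(1,2) by simp_all
  then obtain g where g: "g \<in> carrier G" "\<And>h. h \<in> window n \<union> window (Suc n) \<Longrightarrow> x h = x0 (h \<otimes> g)"
    using X_approx[OF assms] by metis
  have "g \<in> beta x n" "g \<in> beta x (Suc n)" using g by (auto intro: beta_mem[OF assms])
  then have "beta x n = g <# \<Gamma> n" "beta x (Suc n) = g <# \<Gamma> (Suc n)"
    using beta_coset[OF assms] lcoset_eq by metis+
  then show "beta x (Suc n) \<subseteq> beta x n" using chain_decreasing[of n] by (auto simp: l_coset_def)
qed

lemma beta_approx:
  assumes "x \<in> X" "finite K" "K \<subseteq> carrier G"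
  shows "\<exists>g\<in>beta x n. \<forall>h\<in>K. x h = x0 (h \<otimes> g)"
proof -
  have "finite (window n \<union> K)" "window n \<union> K \<subseteq> carrier G" using window(1,2) assms by simp_all
  then obtain g where g: "g \<in> carrier G" "\<And>h. h \<in> window n \<union> K \<Longrightarrow> x h = x0 (h \<otimes> g)"
    using X_approx[OF assms(1)] by metis
  have "g \<in> beta x n" by (rule beta_mem[OF assms(1) g(1)]) (rule g(2), simp)
  then show ?thesis using g(2) by (intro bexI[of _ g]) auto
qed

lemma beta_unique:
  assumes "x \<in> X" "\<xi> \<in> Y" "\<And>n. \<exists>g\<in>\<xi> n. \<forall>h\<in>window n. x h = x0 (h \<otimes> g)"
  shows "beta x = \<xi>"
proof (rule Y_eqI[OF beta_Y[OF assms(1)] assms(2)])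
  fix n
  obtain g where "g \<in> \<xi> n" "\<forall>h\<in>window n. x h = x0 (h \<otimes> g)" using assms(3) by blast
  then show "\<exists>g. g \<in> beta x n \<and> g \<in> \<xi> n" using beta_mem[OF assms(1)] Y_carrier[OF assms(2)] by blast
qed

lemma beta_shift:
  assumes "x \<in> X" "g \<in> carrier G"
  shows "beta (shift g x) = act g (beta x)"
proof (rule beta_unique[OF shift_X[OF assms] act_Y[OF beta_Y[OF assms(1)] assms(2)]])
  fix n
  have w: "window n \<subseteq> carrier G" using window by blast
  obtain a where a: "a \<in> beta x n" "\<forall>h\<in>(\<lambda>h. h \<otimes> g) ` window n. x h = x0 (h \<otimes> a)"
    using beta_approx[OF assms(1), of "(\<lambda>h. h \<otimes> g) ` window n" n] window(1) w assms(2) by auto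
  have ac: "a \<in> carrier G" using Y_carrier[OF beta_Y[OF assms(1)] a(1)] .
  have "shift g x h = x0 (h \<otimes> (g \<otimes> a))" if "h \<in> window n" for h
  proof -
    have "h \<in> carrier G" using w that by blast
    then show ?thesis using a(2) that ac assms(2) by (auto simp: shift_apply m_assoc)
  qed
  moreover have "g \<otimes> a \<in> act g (beta x) n" using a act_mem by blast
  ultimately show "\<exists>b\<in>act g (beta x) n. \<forall>h\<in>window n. shift g x h = x0 (h \<otimes> b)" by blast
qed

lemma beta_continuous: "continuous_map XT YT beta"
  unfolding odometer_topology_def
proof (rule continuous_into_discrete_product)
  show "beta \<in> topspace XT \<rightarrow> Y" using beta_Y by auto
  fix n C
  show "openin XT {x\<in>topspace XT. beta x n = C}"
    unfolding XT_eq openin_discrete_product_iff[OF X_extensional]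
  proof (intro conjI ballI)
    fix x assume "x \<in> {x\<in>topspace (subtopology (product_topology (\<lambda>_. discrete_topology UNIV) (carrier G)) X). beta x n = C}"
    then have x: "x \<in> X" "beta x n = C" using topspace_XT XT_eq by auto
    have "beta y n = C" if y: "y \<in> X" "\<forall>i\<in>window n. y i = x i" for y
    proof -
      obtain g where g: "g \<in> beta y n" "\<forall>h\<in>window n. y h = x0 (h \<otimes> g)"
        using beta_approx[OF y(1) window(1,2)] by blast
      then have "g \<in> beta x n"
        using y by (intro beta_mem[OF x(1)] Y_carrier[OF beta_Y[OF y(1)] g(1)]) auto
      then show ?thesis using g x(2) Y_coset[OF beta_Y[OF y(1)]] Y_coset[OF beta_Y[OF x(1)]] by metis
    qed
    then show "\<exists>K. finite K \<and> K \<subseteq> carrier G \<and> {y\<in>X. \<forall>i\<in>K. y i = x i}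
       \<subseteq> {x\<in>topspace (subtopology (product_topology (\<lambda>_. discrete_topology UNIV) (carrier G)) X). beta x n = C}"
      using window topspace_XT unfolding XT_eq by (intro exI[of _ "window n"]) auto
  qed (use topspace_XT XT_eq in auto)
qed simp

end


section \<open>Sections of the factor map\<close>

context toeplitz_tower
begin

definition holes :: "(nat \<Rightarrow> 'g set) set" where "holes = {\<xi>\<in>Y. \<forall>m. \<xi> \<in> hat (V m)}"

text \<open>The functions \<open>hcol\<close> and \<open>hstage\<close> extend colour and stage from \<open>G\<close> to the odometer.\<close>

definition hcol :: "(nat \<Rightarrow> 'g set) \<Rightarrow> nat" where "hcol \<eta> = col (SOME g. g \<in> \<eta> (lv 0))"

definition hstage :: "(nat \<Rightarrow> 'g set) \<Rightarrow> nat" where "hstage \<eta> = (LEAST m. \<eta> \<notin> hat (V (Suc m)))"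

text \<open>Off \<open>holes\<close>, this is the continuous extension of \<open>x0\<close> from \<open>G\<close>; on \<open>holes\<close>, it follows the
  pattern of class \<open>j\<close>.\<close>

definition val :: "nat \<Rightarrow> (nat \<Rightarrow> 'g set) \<Rightarrow> bool" where
  "val j \<eta> \<longleftrightarrow> hcol \<eta> = (if \<eta> \<in> holes then j else hstage \<eta> mod k)"

definition phi :: "nat \<Rightarrow> (nat \<Rightarrow> 'g set) \<Rightarrow> 'g \<Rightarrow> bool" where
  "phi j \<xi> = (\<lambda>h\<in>carrier G. val j (act h \<xi>))"

lemma phi_apply: "h \<in> carrier G \<Longrightarrow> phi j \<xi> h = val j (act h \<xi>)"
  by (simp add: phi_def)

lemma phi_extensional: "phi j \<xi> \<in> extensional (carrier G)"
  by (simp add: phi_def)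

lemma hat_V_iff: "\<eta> \<in> Y \<Longrightarrow> g \<in> \<eta> (lv m) \<Longrightarrow> i \<le> m \<Longrightarrow> \<eta> \<in> hat (V i) \<longleftrightarrow> g \<in> V i"
  using hat_iff[OF V_periodic_le] .

lemma holes_V: "\<eta> \<in> holes \<Longrightarrow> g \<in> \<eta> (lv m) \<Longrightarrow> g \<in> V m"
  using hat_V_iff[of \<eta> g m m] by (auto simp: holes_def)

lemma hcol_eq:
  assumes "\<eta> \<in> Y" "g \<in> \<eta> (lv m)"
  shows "hcol \<eta> = col g"
proof -
  have g: "g \<in> \<eta> (lv 0)" using assms Y_antimono lv_mono[of 0 m] by blast
  then have "(SOME g. g \<in> \<eta> (lv 0)) \<in> \<eta> (lv 0)" by (rule someI)
  then obtain \<gamma> where "\<gamma> \<in> \<Gamma> (lv 0)" "(SOME g. g \<in> \<eta> (lv 0)) = g \<otimes> \<gamma>"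
    using Y_memE[OF assms(1) g] by metis
  then show ?thesis using col_periodic Y_carrier[OF assms(1) g] by (simp add: hcol_def)
qed

lemma hstage_eq:
  assumes \<eta>: "\<eta> \<in> Y" and g: "g \<in> \<eta> (lv m)" "stage g < m"
  shows "\<eta> \<notin> holes" "hstage \<eta> = stage g"
proof -
  have gc: "g \<in> carrier G" using Y_carrier[OF \<eta> g(1)] .
  have iff: "\<eta> \<in> hat (V i) \<longleftrightarrow> i \<le> stage g" if "i \<le> m" for i
    using hat_V_iff[OF \<eta> g(1) that] V_iff_stage[OF gc] by blast
  then have no: "\<eta> \<notin> hat (V (Suc (stage g)))" using g(2) by simp
  then show "\<eta> \<notin> holes" by (auto simp: holes_def)
  show "hstage \<eta> = stage g"
    unfolding hstage_def
  proof (rule Least_equality)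
    fix i assume i: "\<eta> \<notin> hat (V (Suc i))"
    show "stage g \<le> i"
    proof (rule ccontr)
      assume "\<not> stage g \<le> i"
      then show False using i iff[of "Suc i"] g(2) by simp
    qed
  qed (rule no)
qed

lemma stage_bounded:
  assumes \<eta>: "\<eta> \<in> Y" "\<eta> \<notin> holes"
  shows "\<exists>m. \<forall>g\<in>\<eta> (lv m). stage g < m"
proof -
  obtain m where m: "\<eta> \<notin> hat (V m)" using \<eta> by (auto simp: holes_def)
  have "stage g < m" if "g \<in> \<eta> (lv m)" for g
    using hat_V_iff[OF \<eta>(1) that, of m] V_iff_stage[OF Y_carrier[OF \<eta>(1) that]] m by simp
  then show ?thesis by blast
qed

lemma x0_val:
  assumes \<eta>: "\<eta> \<in> Y" and g: "g \<in> \<eta> (lv m)" "stage g < m"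
  shows "x0 g = val j \<eta>"
  using hstage_eq[OF assms] hcol_eq[OF \<eta> g(1)] Y_carrier[OF \<eta> g(1)] by (simp add: val_def x0_def)

lemma x0_val_holes:
  assumes \<eta>: "\<eta> \<in> holes" and g: "g \<in> \<eta> (lv m)"
  shows "x0 g = val (stage g mod k) \<eta>"
proof -
  have "\<eta> \<in> Y" using \<eta> by (simp add: holes_def)
  then show ?thesis
    using hcol_eq[of \<eta> g m] Y_carrier[of \<eta> g "lv m"] g \<eta> by (simp add: val_def x0_def)
qed

text \<open>Near \<open>\<xi>\<close>, the finitely many positions in \<open>K\<close> whose translates lie in \<open>holes\<close> are all filled at
  the same stage, because they differ by steps in \<open>F M\<close>. All the other values are already determined
  by \<open>\<xi>\<close>.\<close>

lemma locally_coherent: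
  assumes \<xi>: "\<xi> \<in> Y" and K: "finite K" "K \<subseteq> carrier G"
  shows "\<exists>M\<ge>n. \<forall>g\<in>\<xi> (lv M). \<forall>h\<in>K.
    (act h \<xi> \<notin> holes \<longrightarrow> (\<forall>j. x0 (h \<otimes> g) = val j (act h \<xi>))) \<and>
    (act h \<xi> \<in> holes \<longrightarrow> h \<otimes> g \<in> V M \<and> (\<forall>h'\<in>K. act h' \<xi> \<in> holes \<longrightarrow> stage (h \<otimes> g) = stage (h' \<otimes> g)))"
proof -
  have "\<forall>h\<in>K. \<exists>m. act h \<xi> \<notin> holes \<longrightarrow> (\<forall>g\<in>act h \<xi> (lv m). stage g < m)"
    using stage_bounded act_Y[OF \<xi>] K(2) by (metis subsetD)
  then obtain b where b: "\<And>h g. h \<in> K \<Longrightarrow> act h \<xi> \<notin> holes \<Longrightarrow> g \<in> act h \<xi> (lv (b h)) \<Longrightarrow> stage g < b h"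
    by metis
  obtain m where m: "(\<lambda>(a,c). a \<otimes> inv c) ` (K \<times> K) \<subseteq> F m"
  proof -
    have "finite ((\<lambda>(a,c). a \<otimes> inv c) ` (K \<times> K))" "(\<lambda>(a,c). a \<otimes> inv c) ` (K \<times> K) \<subseteq> carrier G"
      using K by auto
    from F_finite_cover[OF this] show ?thesis using that by blast
  qed
  define M where "M = Max (insert n (insert m (b ` K)))"
  have M: "n \<le> M" "m \<le> M" "\<And>h. h \<in> K \<Longrightarrow> b h \<le> M"    unfolding M_def using K(1) by (intro Max_ge; simp)+
  have "(act h \<xi> \<notin> holes \<longrightarrow> (\<forall>j. x0 (h \<otimes> g) = val j (act h \<xi>))) \<and>
    (act h \<xi> \<in> holes \<longrightarrow> h \<otimes> g \<in> V M \<and> (\<forall>h'\<in>K. act h' \<xi> \<in> holes \<longrightarrow> stage (h \<otimes> g) = stage (h' \<otimes> g)))"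
    if g: "g \<in> \<xi> (lv M)" and h: "h \<in> K" for g h
  proof (intro conjI impI allI ballI)
    have mem: "a \<otimes> g \<in> act a \<xi> (lv i)" if "i \<le> M" for a i
      using act_mem[of g \<xi> "lv M" a] g Y_antimono[OF \<xi> lv_mono[OF that]] act_mem by blast
    have gc: "g \<in> carrier G" using Y_carrier[OF \<xi> g] .
    have hc: "h \<in> carrier G" using h K by blast
    {
      fix j assume "act h \<xi> \<notin> holes"
      from b[OF h this mem[OF M(3)[OF h]]] show "x0 (h \<otimes> g) = val j (act h \<xi>)"
        by (rule x0_val[OF act_Y[OF \<xi> hc] mem[OF M(3)[OF h]]])
    }
    assume hD: "act h \<xi> \<in> holes"
    show hV: "h \<otimes> g \<in> V M" using holes_V[OF hD mem] by blast
    fix h' assume h': "h' \<in> K" "act h' \<xi> \<in> holes"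
    have h'c: "h' \<in> carrier G" using h' K by blast
    have h'V: "h' \<otimes> g \<in> V M" using holes_V[OF h'(2) mem] by blast
    have "h \<otimes> inv h' \<in> F m" "h' \<otimes> inv h \<in> F m" using m h h' by auto
    then have fF: "h \<otimes> inv h' \<in> F M" "h' \<otimes> inv h \<in> F M" using F_mono[OF M(2)] by auto
    have e: "h \<otimes> inv h' \<otimes> (h' \<otimes> g) = h \<otimes> g"
      using hc h'c gc by (simp add: m_assoc) (simp add: m_assoc[symmetric])
    have "inv (h \<otimes> inv h') = h' \<otimes> inv h" using hc h'c by (simp add: inv_mult_group)
    then show "stage (h \<otimes> g) = stage (h' \<otimes> g)"
      using stage_step[of "h' \<otimes> g" M "h \<otimes> inv h'"] fF hc h'c hV h'V e by simp
  qed
  then show ?thesis using M(1) by blast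
qed

text \<open>Every pattern \<open>j\<close> occurs over \<open>\<xi>\<close>: approximate \<open>\<xi>\<close> by group elements whose positions near \<open>holes\<close>
  are filled at a late stage of class \<open>j\<close>.\<close>

lemma phi_approx:
  assumes \<xi>: "\<xi> \<in> Y" and j: "j < k" and K: "finite K" "K \<subseteq> carrier G"
  shows "\<exists>g\<in>\<xi> n. \<forall>h\<in>K. phi j \<xi> h = x0 (h \<otimes> g)"
proof -
  obtain M where M: "M \<ge> n" and *: "\<And>g h. g \<in> \<xi> (lv M) \<Longrightarrow> h \<in> K \<Longrightarrow>
    (act h \<xi> \<notin> holes \<longrightarrow> (\<forall>j. x0 (h \<otimes> g) = val j (act h \<xi>))) \<and>
    (act h \<xi> \<in> holes \<longrightarrow> h \<otimes> g \<in> V M \<and> (\<forall>h'\<in>K. act h' \<xi> \<in> holes \<longrightarrow> stage (h \<otimes> g) = stage (h' \<otimes> g)))"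
    using locally_coherent[OF \<xi> K, of n] by metis
  have lvM: "n \<le> lv M" using M lv_ge[of M] by linarith
  have mono: "\<xi> (lv M) \<subseteq> \<xi> n" using Y_antimono[OF \<xi> lvM] .
  obtain g1 where g1: "g1 \<in> \<xi> (lv M)" using Y_nonempty \<xi> by blast
  have Kc: "\<And>h. h \<in> K \<Longrightarrow> h \<in> carrier G" using K by blast
  show ?thesis
  proof (cases "\<exists>h0\<in>K. act h0 \<xi> \<in> holes")
    case False
    then have "\<forall>h\<in>K. phi j \<xi> h = x0 (h \<otimes> g1)" using *[OF g1] phi_apply[OF Kc] by metis
    then show ?thesis using g1 mono by blast
  next
    case True
    then obtain h0 where h0: "h0 \<in> K" "act h0 \<xi> \<in> holes" by blast
    have h0V: "h0 \<otimes> g1 \<in> V M" using *[OF g1 h0(1)] h0(2) by blast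
    \<comment> \<open>A stage of class \<open>j\<close> that is at least \<open>M\<close>.\<close>
    have "M \<le> M * k + j" "(M * k + j) mod k = j" using k j by (auto simp: trans_le_add1)
    then obtain \<gamma> where \<gamma>: "\<gamma> \<in> \<Gamma> (lv M)" "stage (h0 \<otimes> g1 \<otimes> \<gamma>) mod k = j"
      using reach_stage[OF h0V] by metis
    define g where "g = g1 \<otimes> \<gamma>"
    have g: "g \<in> \<xi> (lv M)" unfolding g_def by (rule Y_mult[OF \<xi> g1 \<gamma>(1)])
    have "h0 \<otimes> g1 \<otimes> \<gamma> = h0 \<otimes> g"
      using Kc[OF h0(1)] Y_carrier[OF \<xi> g1] chain_carrier[OF \<gamma>(1)] by (simp add: g_def m_assoc)
    then have st: "stage (h0 \<otimes> g) mod k = j" using \<gamma> by simp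
    have "phi j \<xi> h = x0 (h \<otimes> g)" if h: "h \<in> K" for h
    proof (cases "act h \<xi> \<in> holes")
      case False
      then show ?thesis using *[OF g h] phi_apply[OF Kc[OF h]] by metis
    next
      case True
      then have "stage (h \<otimes> g) = stage (h0 \<otimes> g)" using *[OF g h] h0 by blast
      then show ?thesis
        using x0_val_holes[OF True act_mem[of g \<xi> "lv M" h]] g st phi_apply[OF Kc[OF h]] by simp
    qed
    then show ?thesis using g mono by blast
  qed
qed

lemma phi_X: "\<xi> \<in> Y \<Longrightarrow> j < k \<Longrightarrow> phi j \<xi> \<in> X"
  unfolding X_iff
proof (intro conjI allI impI)
  fix K assume "\<xi> \<in> Y" "j < k" "finite K \<and> K \<subseteq> carrier G"
  then obtain g where "g \<in> \<xi> 0" "\<forall>h\<in>K. phi j \<xi> h = x0 (h \<otimes> g)" using phi_approx[of \<xi> j K 0] by blast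
  then show "\<exists>g\<in>carrier G. \<forall>h\<in>K. phi j \<xi> h = x0 (h \<otimes> g)" using Y_carrier[OF \<open>\<xi> \<in> Y\<close>] by blast
qed (rule phi_extensional)

lemma beta_phi: "\<xi> \<in> Y \<Longrightarrow> j < k \<Longrightarrow> beta (phi j \<xi>) = \<xi>"
  by (rule beta_unique[OF phi_X]) (use phi_approx window in auto)

text \<open>If each pattern failed at some position, these finitely many positions would form a window
  that contradicts \<open>locally_coherent\<close>.\<close>

lemma fiber_phi:
  assumes x: "x \<in> X"
  shows "\<exists>j<k. x = phi j (beta x)"
proof (rule ccontr)
  assume "\<not> ?thesis"
  then have no: "x \<noteq> phi j (beta x)" if "j < k" for j using that by blast
  have \<xi>: "beta x \<in> Y" using beta_Y[OF x] .
  have "\<exists>h\<in>carrier G. x h \<noteq> phi j (beta x) h" if "j < k" for j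
  proof (rule ccontr)
    assume "\<not> ?thesis"
    then have "x = phi j (beta x)"
      using X_extensional x phi_extensional[of j "beta x"]
      by (intro extensionalityI[of x "carrier G"]) auto
    then show False using no[OF that] by blast
  qed
  then obtain w where w: "\<And>j. j < k \<Longrightarrow> w j \<in> carrier G \<and> x (w j) \<noteq> phi j (beta x) (w j)" by metis
  define K where "K = w ` {..<k}"
  have K: "finite K" "K \<subseteq> carrier G" using w by (auto simp: K_def)
  obtain M where *: "\<And>g h. g \<in> beta x (lv M) \<Longrightarrow> h \<in> K \<Longrightarrow>
    (act h (beta x) \<notin> holes \<longrightarrow> (\<forall>j. x0 (h \<otimes> g) = val j (act h (beta x)))) \<and>
    (act h (beta x) \<in> holes \<longrightarrow> h \<otimes> g \<in> V M \<and> (\<forall>h'\<in>K. act h' (beta x) \<in> holes \<longrightarrow> stage (h \<otimes> g) = stage (h' \<otimes> g)))"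
    using locally_coherent[OF \<xi> K, of 0] by metis
  obtain g where g: "g \<in> beta x (lv M)" "\<forall>h\<in>K. x h = x0 (h \<otimes> g)" using beta_approx[OF x K] by blast
  have bad: "act (w j) (beta x) \<in> holes \<and> stage (w j \<otimes> g) mod k \<noteq> j" if "j < k" for j
  proof -
    have wK: "w j \<in> K" using that by (simp add: K_def)
    have ne: "x0 (w j \<otimes> g) \<noteq> val j (act (w j) (beta x))"
      using w[OF that] g(2) wK phi_apply by metis
    then have wD: "act (w j) (beta x) \<in> holes" using *[OF g(1) wK] by blast
    have "x0 (w j \<otimes> g) = val (stage (w j \<otimes> g) mod k) (act (w j) (beta x))"
      by (rule x0_val_holes[OF wD act_mem[of g "beta x" "lv M"]]) (rule g(1))
    then show ?thesis using ne wD by metis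
  qed
  have k0: "0 < k" using k by simp
  define s where "s = stage (w 0 \<otimes> g) mod k"
  have s: "s < k" using k0 by (simp add: s_def)
  have "w 0 \<in> K" "w s \<in> K" using k0 s by (auto simp: K_def)
  then have "stage (w s \<otimes> g) = stage (w 0 \<otimes> g)" using *[OF g(1), of "w s"] bad[OF s] bad[OF k0] by blast
  then show False using bad[OF s] by (simp add: s_def)
qed

lemma fiber_beta:
  assumes "\<xi> \<in> Y"
  shows "fiber XT beta \<xi> = (\<lambda>j. phi j \<xi>) ` {..<k}"
proof (intro equalityI subsetI)
  fix x assume "x \<in> fiber XT beta \<xi>"
  then have x: "x \<in> X" "beta x = \<xi>" by (auto simp: fiber_def)
  obtain j where "j < k" "x = phi j \<xi>" using fiber_phi[OF x(1)] unfolding x(2) by blast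
  then show "x \<in> (\<lambda>j. phi j \<xi>) ` {..<k}" by blast
next
  fix x assume "x \<in> (\<lambda>j. phi j \<xi>) ` {..<k}"
  then show "x \<in> fiber XT beta \<xi>" using phi_X[OF assms] beta_phi[OF assms] by (auto simp: fiber_def)
qed

lemma fiber_singleton:
  assumes "\<xi> \<in> Y" "\<And>h. h \<in> carrier G \<Longrightarrow> act h \<xi> \<notin> holes"
  shows "fiber XT beta \<xi> = {phi 0 \<xi>}"
proof -
  have "phi j \<xi> = phi 0 \<xi>" for j
    by (rule extensionalityI[OF phi_extensional phi_extensional]) (simp add: phi_apply val_def assms(2))
  then show ?thesis using k unfolding fiber_beta[OF assms(1)] by (auto simp: image_iff)
qed

lemma emb_notin_holes: "g \<in> carrier G \<Longrightarrow> emb g \<notin> holes"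
  using hstage_eq(1)[OF emb_Y emb_self, of g "Suc (stage g)"] by simp

lemma act_emb: "g \<in> carrier G \<Longrightarrow> h \<in> carrier G \<Longrightarrow> act h (emb g) = emb (h \<otimes> g)"
proof (rule Y_eqI)
  fix n assume gh: "g \<in> carrier G" "h \<in> carrier G"
  have "h \<otimes> g \<in> act h (emb g) n" by (rule act_mem[OF emb_self[OF gh(1)]])
  moreover have "h \<otimes> g \<in> emb (h \<otimes> g) n" using gh by (intro emb_self) simp
  ultimately show "\<exists>a. a \<in> act h (emb g) n \<and> a \<in> emb (h \<otimes> g) n" by blast
qed (simp_all add: act_Y emb_Y)

lemma x0_X: "x0 \<in> X"
  unfolding X_iff by (auto simp: x0_def intro!: bexI[of _ \<one>])

lemma beta_x0: "beta x0 = emb \<one>"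
proof (rule beta_unique[OF x0_X emb_Y])
  fix n
  have "\<forall>h\<in>window n. x0 h = x0 (h \<otimes> \<one>)" using window(2)[of n] by (simp add: subset_iff)
  then show "\<exists>g\<in>emb \<one> n. \<forall>h\<in>window n. x0 h = x0 (h \<otimes> g)" using emb_self[OF one_closed] by blast
qed simp

lemma fiber_emb:
  assumes "g \<in> carrier G"
  shows "fiber XT beta (emb g) = {shift g x0}"
proof -
  have "fiber XT beta (emb g) = {phi 0 (emb g)}"
    by (rule fiber_singleton) (use assms emb_Y act_emb emb_notin_holes in auto)
  moreover have "shift g x0 \<in> fiber XT beta (emb g)"
    using beta_shift[OF x0_X assms] beta_x0 act_emb[OF _ assms, of \<one>] shift_X[OF x0_X assms] assms act_emb
    by (auto simp: fiber_def)
  ultimately show ?thesis by auto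
qed

lemma beta_factor: "factor_map G XT shift YT act beta"
  unfolding factor_map_def
proof (intro conjI)
  show "beta ` topspace XT = topspace YT"
  proof (intro equalityI subsetI)
    fix \<xi> assume "\<xi> \<in> topspace YT"
    then show "\<xi> \<in> beta ` topspace XT"
      using beta_phi[of \<xi> 0] phi_X[of \<xi> 0] k by (intro image_eqI[of _ _ "phi 0 \<xi>"]) auto
  qed (use beta_Y in auto)
qed (use beta_continuous beta_shift in auto)

lemma beta_almost_one_to_one: "almost_one_to_one XT beta"
  unfolding almost_one_to_one_def
proof (rule antisym)
  let ?A = "{x\<in>topspace XT. fiber XT beta (beta x) = {x}}"
  let ?O = "(\<lambda>g. shift g x0) ` carrier G"
  have "?O \<subseteq> ?A"
  proof
    fix x assume "x \<in> ?O"
    then obtain g where g: "g \<in> carrier G" "x = shift g x0" by blast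
    have "x \<in> fiber XT beta (emb g)" using fiber_emb[OF g(1)] g(2) by simp
    then have "beta x = emb g" "x \<in> topspace XT" by (auto simp: fiber_def)
    then show "x \<in> ?A" using fiber_emb[OF g(1)] g(2) by simp
  qed
  then have "XT closure_of ?O \<subseteq> XT closure_of ?A" by (rule closure_of_mono)
  moreover have "?O \<subseteq> X" using shift_X[OF x0_X] by blast
  then have "XT closure_of ?O = X"
    unfolding orbit_subshift_def closure_of_subtopology
    by (simp add: orbit_closure_def Int_absorb1 Int_absorb2)
  ultimately show "topspace XT \<subseteq> XT closure_of ?A" by simp
qed (rule closure_of_subset_topspace)

lemma phi_act:
  assumes "\<xi> \<in> Y" "g \<in> carrier G"
  shows "shift g (phi j \<xi>) = phi j (act g \<xi>)"
  by (rule extensionalityI[OF shift_extensional phi_extensional])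
     (use assms in \<open>simp add: shift_apply phi_apply act_mult\<close>)

section \<open>Ergodic measures\<close>

lemma sets_\<nu>: "sets \<nu> = sets YM" and space_\<nu>: "space \<nu> = Y" and prob_\<nu>: "prob_space \<nu>"
  using inv_measureD[OF invariant] by auto

lemma hat_\<nu>: "hat A \<in> sets \<nu>"
  using hat_sets sets_\<nu> by simp

lemma hcol_hat: "\<eta> \<in> Y \<Longrightarrow> hcol \<eta> = i \<longleftrightarrow> \<eta> \<in> hat {x\<in>carrier G. col x = i}"
proof -
  assume \<eta>: "\<eta> \<in> Y"
  obtain g where g: "g \<in> \<eta> (lv 0)" using Y_nonempty \<eta> by blast
  have "periodic (\<Gamma> (lv 0)) {x\<in>carrier G. col x = i}"
    using col_periodic chain_carrier by (auto simp: periodic_def)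
  then show "hcol \<eta> = i \<longleftrightarrow> \<eta> \<in> hat {x\<in>carrier G. col x = i}"
    using hat_iff[OF _ \<eta> g] hcol_eq[OF \<eta> g] Y_carrier[OF \<eta> g] by auto
qed

lemma holes_sets: "holes \<in> sets \<nu>"
proof -
  have "holes = (\<Inter>m. hat (V m))" using hat_subset_Y by (auto simp: holes_def)
  then show ?thesis using hat_\<nu> by auto
qed

lemma hcol_sets: "{\<eta>\<in>Y. hcol \<eta> = i} \<in> sets \<nu>"
proof -
  have "{\<eta>\<in>Y. hcol \<eta> = i} = hat {x\<in>carrier G. col x = i}" using hcol_hat hat_subset_Y by blast
  then show ?thesis using hat_\<nu> by simp
qed

lemma hstage_iff: "\<eta> \<in> Y \<Longrightarrow> \<eta> \<notin> holes \<Longrightarrow> hstage \<eta> = m \<longleftrightarrow> \<eta> \<in> hat (V m) - hat (V (Suc m))"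
proof -
  assume \<eta>: "\<eta> \<in> Y" "\<eta> \<notin> holes"
  obtain l where l: "\<forall>g\<in>\<eta> (lv l). stage g < l" using stage_bounded[OF \<eta>] by blast
  define l' where "l' = max l (Suc m)"
  obtain g where g: "g \<in> \<eta> (lv l')" using Y_nonempty \<eta> by blast
  then have "g \<in> \<eta> (lv l)" using Y_antimono[OF \<eta>(1) lv_mono[of l l']] by (auto simp: l'_def)
  then have "stage g < l'" using l by (auto simp: l'_def)
  then have "hstage \<eta> = stage g" using hstage_eq[OF \<eta>(1) g] by blast
  moreover have "\<eta> \<in> hat (V m) \<longleftrightarrow> g \<in> V m" "\<eta> \<in> hat (V (Suc m)) \<longleftrightarrow> g \<in> V (Suc m)"
    using hat_V_iff[OF \<eta>(1) g] by (auto simp: l'_def)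
  ultimately show "hstage \<eta> = m \<longleftrightarrow> \<eta> \<in> hat (V m) - hat (V (Suc m))"
    using stage_iff[OF Y_carrier[OF \<eta>(1) g]] by auto
qed

lemma val_sets: "{\<eta>\<in>Y. val j \<eta>} \<in> sets \<nu>"
proof -
  have st: "{\<eta>\<in>Y. hcol \<eta> = m mod k} \<inter> (hat (V m) - hat (V (Suc m)) - holes) \<in> sets \<nu>" for m
    using hcol_sets hat_\<nu> holes_sets by auto
  have "\<eta> \<in> {\<eta>\<in>Y. val j \<eta>} \<longleftrightarrow> \<eta> \<in> ({\<eta>\<in>Y. hcol \<eta> = j} \<inter> holes) \<union>
      (\<Union>m. {\<eta>\<in>Y. hcol \<eta> = m mod k} \<inter> (hat (V m) - hat (V (Suc m)) - holes))" for \<eta>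
  proof (cases "\<eta> \<in> Y \<and> \<eta> \<notin> holes")
    case True
    then have "\<eta> \<in> hat (V m) - hat (V (Suc m)) - holes \<longleftrightarrow> m = hstage \<eta>" for m
      using hstage_iff[of \<eta> m] by blast
    then show ?thesis using True by (simp add: val_def)
  qed (auto simp: val_def holes_def)
  then have "{\<eta>\<in>Y. val j \<eta>} = ({\<eta>\<in>Y. hcol \<eta> = j} \<inter> holes) \<union>
      (\<Union>m. {\<eta>\<in>Y. hcol \<eta> = m mod k} \<inter> (hat (V m) - hat (V (Suc m)) - holes))" by blast
  moreover have "\<dots> \<in> sets \<nu>" using st holes_sets hcol_sets by auto
  ultimately show ?thesis by simp
qed

lemma act_measurable: "g \<in> carrier G \<Longrightarrow> act g \<in> measurable \<nu> \<nu>"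
  using invariant by (auto simp: invariant_prob_measure_def)

lemma phi_coordinate_sets: "h \<in> carrier G \<Longrightarrow> {\<xi>\<in>Y. phi j \<xi> h} \<in> sets \<nu>"
proof -
  assume h: "h \<in> carrier G"
  have "{\<xi>\<in>Y. phi j \<xi> h} = act h -` {\<eta>\<in>Y. val j \<eta>} \<inter> space \<nu>"
    using act_Y h by (auto simp: phi_apply space_\<nu>)
  then show ?thesis using measurable_sets[OF act_measurable[OF h] val_sets] by simp
qed

abbreviation XM where "XM \<equiv> borel_of XT"

lemma measurable_into_XM:
  assumes "f \<in> space M \<rightarrow> X" "\<And>h. h \<in> carrier G \<Longrightarrow> {\<omega>\<in>space M. f \<omega> h} \<in> sets M"
  shows "f \<in> measurable M XM"
  unfolding XT_eq
proof (rule measurable_into_discrete_product[OF assms(1) X_extensional countable_carrier])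
  fix h c assume h: "h \<in> carrier G"
  show "{x\<in>space M. f x h = c} \<in> sets M"
  proof (cases c)
    case True then show ?thesis using assms(2)[OF h] by simp
  next
    case False
    then have "{x\<in>space M. f x h = c} = space M - {x\<in>space M. f x h}" by auto
    then show ?thesis using assms(2)[OF h] by simp
  qed
qed (auto intro: countable_finite)

lemma phi_measurable: "j < k \<Longrightarrow> phi j \<in> measurable \<nu> XM"
  by (rule measurable_into_XM) (use phi_X phi_coordinate_sets space_\<nu> in auto)

lemma beta_measurable: "beta \<in> measurable XM YM"
  by (rule continuous_map_measurable_borel_of[OF beta_continuous])

lemma coordinate_sets: "h \<in> carrier G \<Longrightarrow> {x\<in>X. x h} \<in> sets XM"
proof -
  assume h: "h \<in> carrier G"
  have "openin XT {x\<in>X. x h}"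
    unfolding XT_eq openin_discrete_product_iff[OF X_extensional]
  proof (intro conjI ballI)
    fix x assume "x \<in> {x\<in>X. x h}"
    then show "\<exists>K. finite K \<and> K \<subseteq> carrier G \<and> {y\<in>X. \<forall>i\<in>K. y i = x i} \<subseteq> {x\<in>X. x h}"
      using h by (intro exI[of _ "{h}"]) auto
  qed auto
  then show ?thesis by (rule openin_borel_of)
qed

lemma shift_measurable: "g \<in> carrier G \<Longrightarrow> shift g \<in> measurable XM XM"
proof (rule measurable_into_XM)
  assume g: "g \<in> carrier G"
  then show "shift g \<in> space XM \<rightarrow> X" using shift_X by auto
  fix h assume h: "h \<in> carrier G"
  have "{\<omega>\<in>space XM. shift g \<omega> h} = {x\<in>X. x (h \<otimes> g)}" using h by (auto simp: shift_apply)
  then show "{\<omega>\<in>space XM. shift g \<omega> h} \<in> sets XM" using coordinate_sets g h by simp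
qed

text \<open>The images of the sections; they are invariant and carry the ergodic measures.\<close>

definition sect :: "nat \<Rightarrow> ('g \<Rightarrow> bool) set" where "sect j = phi j ` Y"

definition mu :: "nat \<Rightarrow> ('g \<Rightarrow> bool) measure" where "mu j = distr \<nu> XM (phi j)"

lemma sect_eq: assumes "j < k" shows "sect j = {x\<in>X. x = phi j (beta x)}"
proof (intro equalityI subsetI)
  fix x assume "x \<in> sect j"
  then obtain \<xi> where "\<xi> \<in> Y" "x = phi j \<xi>" by (auto simp: sect_def)
  then show "x \<in> {x\<in>X. x = phi j (beta x)}" using phi_X beta_phi assms by simp
next
  fix x assume "x \<in> {x\<in>X. x = phi j (beta x)}"
  then show "x \<in> sect j" unfolding sect_def using beta_Y by blast
qed

lemma sect_sets: assumes j: "j < k" shows "sect j \<in> sets XM"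
proof -
  have beta: "beta \<in> measurable XM \<nu>" using beta_measurable sets_\<nu> by (simp cong: measurable_cong_sets)
  have pre: "{x\<in>X. phi j (beta x) h} \<in> sets XM" if "h \<in> carrier G" for h
  proof -
    have "{x\<in>X. phi j (beta x) h} = beta -` {\<xi>\<in>Y. phi j \<xi> h} \<inter> space XM" using beta_Y by auto
    then show ?thesis using measurable_sets[OF beta phi_coordinate_sets[OF that]] by simp
  qed
  have "{x\<in>X. x h \<longleftrightarrow> phi j (beta x) h} \<in> sets XM" if h: "h \<in> carrier G" for h
  proof -
    have eq: "{x\<in>X. x h \<longleftrightarrow> phi j (beta x) h} =
      ({x\<in>X. x h} \<inter> {x\<in>X. phi j (beta x) h}) \<union> ((space XM - {x\<in>X. x h}) \<inter> (space XM - {x\<in>X. phi j (beta x) h}))"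
      by auto
    from pre[OF h] coordinate_sets[OF h] show ?thesis
      unfolding eq by (intro sets.Un sets.Int sets.compl_sets)
  qed
  then have "(\<Inter>h\<in>carrier G. {x\<in>X. x h \<longleftrightarrow> phi j (beta x) h}) \<in> sets XM"
    by (intro sets.countable_INT') (use countable_carrier one_closed in auto)
  also have "(\<Inter>h\<in>carrier G. {x\<in>X. x h \<longleftrightarrow> phi j (beta x) h}) = sect j"
  proof (intro equalityI subsetI)
    fix x assume x: "x \<in> (\<Inter>h\<in>carrier G. {x\<in>X. x h \<longleftrightarrow> phi j (beta x) h})"
    then have xX: "x \<in> X" using one_closed by blast
    have "x = phi j (beta x)"
      by (rule extensionalityI[OF _ phi_extensional]) (use x xX X_extensional in auto)
    then show "x \<in> sect j" using xX unfolding sect_eq[OF j] by blast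
  next
    fix x assume "x \<in> sect j"
    then have x: "x \<in> X" "x = phi j (beta x)" unfolding sect_eq[OF j] by blast+
    have "x h \<longleftrightarrow> phi j (beta x) h" for h using arg_cong[OF x(2), of "\<lambda>f. f h"] .
    then show "x \<in> (\<Inter>h\<in>carrier G. {x\<in>X. x h \<longleftrightarrow> phi j (beta x) h})" using x(1) by blast
  qed
  finally show ?thesis .
qed

lemma sect_shift: assumes "g \<in> carrier G" shows "shift g ` sect j = sect j"
proof (intro equalityI subsetI)
  fix x assume "x \<in> shift g ` sect j"
  then show "x \<in> sect j" using phi_act act_Y assms by (auto simp: sect_def)
next
  fix x assume "x \<in> sect j"
  then obtain \<xi> where \<xi>: "\<xi> \<in> Y" "x = phi j \<xi>" by (auto simp: sect_def)
  have "x = shift g (phi j (act (inv g) \<xi>))"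
    using phi_act[of "act (inv g) \<xi>" g j] act_Y \<xi> assms act_inv(2) by simp
  then show "x \<in> shift g ` sect j" using act_Y \<xi> assms by (auto simp: sect_def)
qed

lemma sect_shift_vimage: assumes "g \<in> carrier G" "j < k" shows "shift g -` sect j \<inter> X = sect j"
proof (intro equalityI subsetI)
  fix x assume x: "x \<in> shift g -` sect j \<inter> X"
  then have "shift (inv g) (shift g x) \<in> sect j" using sect_shift[of "inv g" j] assms by blast
  moreover have "shift (inv g) (shift g x) = x"
    using shift_mult[of x "inv g" g] shift_one X_extensional x assms by (simp add: subset_iff)
  ultimately show "x \<in> sect j" by simp
next
  fix x assume "x \<in> sect j"
  then show "x \<in> shift g -` sect j \<inter> X" using sect_shift[OF assms(1), of j] sect_eq[OF assms(2)] by blast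
qed

lemma X_cover: "X = (\<Union>j<k. sect j)"
proof (intro equalityI subsetI)
  fix x assume x: "x \<in> X"
  obtain j where "j < k" "x = phi j (beta x)" using fiber_phi[OF x] by blast
  then show "x \<in> (\<Union>j<k. sect j)" using x sect_eq[of j] by blast
next
  fix x assume "x \<in> (\<Union>j<k. sect j)"
  then show "x \<in> X" using sect_eq by blast
qed

abbreviation ergodic where "ergodic \<equiv> ergodic_prob_measure G XT shift"

lemma mu_sets [simp]: "sets (mu j) = sets XM" and mu_space [simp]: "space (mu j) = X"
  by (simp_all add: mu_def)

lemma mu_emeasure: "j < k \<Longrightarrow> B \<in> sets XM \<Longrightarrow> emeasure (mu j) B = emeasure \<nu> (phi j -` B \<inter> Y)"
  unfolding mu_def using phi_measurable space_\<nu> by (simp add: emeasure_distr)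

lemma mu_sect: "j < k \<Longrightarrow> emeasure (mu j) (sect j) = 1"
proof -
  assume j: "j < k"
  have "phi j -` sect j \<inter> Y = space \<nu>" by (auto simp: sect_def space_\<nu>)
  then show ?thesis using mu_emeasure[OF j sect_sets[OF j]] prob_space.emeasure_space_1[OF prob_\<nu>] by simp
qed

lemma mu_ergodic: assumes j: "j < k" shows "ergodic (mu j)"
  unfolding ergodic_prob_measure_def invariant_prob_measure_def
proof (intro conjI ballI impI)
  show "prob_space (mu j)" unfolding mu_def by (rule prob_space.prob_space_distr[OF prob_\<nu> phi_measurable[OF j]])
  show "sets (mu j) = sets XM" by simp
  fix g assume g: "g \<in> carrier G"
  show m: "shift g \<in> measurable (mu j) (mu j)" using shift_measurable[OF g] by (simp cong: measurable_cong_sets)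
  show "distr (mu j) (mu j) (shift g) = mu j"
  proof (rule measure_eqI)
    fix B assume "B \<in> sets (distr (mu j) (mu j) (shift g))"
    then have B: "B \<in> sets XM" by simp
    have pre: "phi j -` B \<inter> Y \<in> sets \<nu>" using measurable_sets[OF phi_measurable[OF j] B] space_\<nu> by simp
    have sB: "shift g -` B \<inter> X \<in> sets XM" using measurable_sets[OF shift_measurable[OF g] B] by simp
    have "emeasure (distr (mu j) (mu j) (shift g)) B = emeasure (mu j) (shift g -` B \<inter> X)"
      using m B by (simp add: emeasure_distr)
    also have "\<dots> = emeasure \<nu> (phi j -` (shift g -` B \<inter> X) \<inter> Y)" using mu_emeasure[OF j sB] .
    also have "phi j -` (shift g -` B \<inter> X) \<inter> Y = act g -` (phi j -` B \<inter> Y) \<inter> Y"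
      using phi_act[OF _ g, of _ j] phi_X[OF _ j] act_Y g by auto
    also have "emeasure \<nu> \<dots> = emeasure (distr \<nu> \<nu> (act g)) (phi j -` B \<inter> Y)"
      using act_measurable[OF g] pre space_\<nu> by (simp add: emeasure_distr)
    also have "distr \<nu> \<nu> (act g) = \<nu>" using invariant g by (auto simp: invariant_prob_measure_def)
    also have "emeasure \<nu> (phi j -` B \<inter> Y) = emeasure (mu j) B" using mu_emeasure[OF j B] by simp
    finally show "emeasure (distr (mu j) (mu j) (shift g)) B = emeasure (mu j) B" .
  qed simp
next
  fix B assume "B \<in> sets (mu j)" and inv: "\<forall>g\<in>carrier G. shift g -` B \<inter> space (mu j) = B"
  then have B: "B \<in> sets XM" by simp
  have pre: "phi j -` B \<inter> Y \<in> sets \<nu>" using measurable_sets[OF phi_measurable[OF j] B] space_\<nu> by simp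
  have "emeasure \<nu> (phi j -` B \<inter> Y) = 0 \<or> emeasure \<nu> (phi j -` B \<inter> Y) = 1"
  proof (rule inv_measure_ergodic[OF invariant pre])
    fix g assume g: "g \<in> carrier G"
    have "phi j (act g \<xi>) \<in> B \<longleftrightarrow> phi j \<xi> \<in> B" if "\<xi> \<in> Y" for \<xi>
    proof -
      have "shift g -` B \<inter> X = B" using inv g by simp
      then have "shift g (phi j \<xi>) \<in> B \<longleftrightarrow> phi j \<xi> \<in> B" using phi_X[OF that j] by blast
      then show ?thesis using phi_act[OF that g] by simp
    qed
    then show "act g -` (phi j -` B \<inter> Y) \<inter> Y = phi j -` B \<inter> Y" using act_Y g by auto
  qed
  then show "emeasure (mu j) B = 0 \<or> emeasure (mu j) B = 1" using mu_emeasure[OF j B] by simp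
qed

lemma distr_beta:
  assumes "invariant_prob_measure G XT shift \<mu>"
  shows "distr \<mu> YM beta = \<nu>"
  by (rule inv_measure_unique[OF inv_measure_distr[OF assms beta_continuous] invariant])
     (use beta_shift in simp)

text \<open>An ergodic measure charges one of the finitely many invariant sections; on that section it
  is the image of the unique invariant measure of the odometer.\<close>

lemma ergodic_imp_mu:
  assumes "ergodic \<mu>"
  shows "\<exists>j<k. \<mu> = mu j"
proof -
  have inv: "invariant_prob_measure G XT shift \<mu>" using assms by (simp add: ergodic_prob_measure_def)
  then have s: "sets \<mu> = sets XM" and p: "prob_space \<mu>" by (auto simp: invariant_prob_measure_def)
  have sp: "space \<mu> = X" using sets_eq_imp_space_eq[OF s] by simp
  have As: "sect j \<in> sets \<mu>" if "j < k" for j using sect_sets[OF that] s by simp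
  have "\<exists>j<k. emeasure \<mu> (sect j) \<noteq> 0"
  proof (rule ccontr)
    assume "\<not> ?thesis"
    then have "(\<Union>j<k. sect j) \<in> null_sets \<mu>" using As by (intro null_sets_UN') (auto simp: null_sets_def)
    then show False using X_cover sp prob_space.emeasure_space_1[OF p] by (simp add: null_sets_def)
  qed
  then obtain j where j: "j < k" "emeasure \<mu> (sect j) \<noteq> 0" by blast
  have shA: "\<forall>g\<in>carrier G. shift g -` sect j \<inter> space \<mu> = sect j" using sect_shift_vimage j(1) sp by simp
  have "\<forall>A\<in>sets \<mu>. (\<forall>g\<in>carrier G. shift g -` A \<inter> space \<mu> = A) \<longrightarrow> emeasure \<mu> A = 0 \<or> emeasure \<mu> A = 1"
    using assms unfolding ergodic_prob_measure_def by (rule conjunct2)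
  from bspec[OF this As[OF j(1)]] have A1: "emeasure \<mu> (sect j) = 1" using shA j(2) by blast
  have mb: "beta \<in> measurable \<mu> YM" using beta_measurable s by (simp cong: measurable_cong_sets)
  have mp: "phi j \<in> measurable YM XM" using phi_measurable[OF j(1)] sets_\<nu> by (simp cong: measurable_cong_sets)
  have "mu j = distr (distr \<mu> YM beta) XM (phi j)" by (simp add: mu_def distr_beta[OF inv])
  also have "\<dots> = distr \<mu> XM (phi j \<circ> beta)" by (rule distr_distr[OF mp mb])
  also have "\<dots> = \<mu>"
  proof (rule measure_eqI)
    fix B assume "B \<in> sets (distr \<mu> XM (phi j \<circ> beta))"
    then have B: "B \<in> sets \<mu>" using s by simp
    have mc: "phi j \<circ> beta \<in> measurable \<mu> XM" by (rule measurable_comp[OF mb mp])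
    have "emeasure (distr \<mu> XM (phi j \<circ> beta)) B = emeasure \<mu> ((phi j \<circ> beta) -` B \<inter> space \<mu>)"
      using mc B s by (simp add: emeasure_distr)
    also have "\<dots> = emeasure \<mu> B"
    proof (rule emeasure_eq_AE)
      have "AE x in \<mu>. x \<in> sect j"
        using prob_space.AE_in_set_eq_1[OF p As[OF j(1)]] A1 by (simp add: measure_def)
      then show "AE x in \<mu>. x \<in> (phi j \<circ> beta) -` B \<inter> space \<mu> \<longleftrightarrow> x \<in> B"
      proof eventually_elim
        case (elim x)
        then have "phi j (beta x) = x" "x \<in> X" unfolding sect_eq[OF j(1)] by simp_all
        then show ?case using sp by simp
      qed
      show "(phi j \<circ> beta) -` B \<inter> space \<mu> \<in> sets \<mu>" using measurable_sets[OF mc] B s by simp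
    qed (rule B)
    finally show "emeasure (distr \<mu> XM (phi j \<circ> beta)) B = emeasure \<mu> B" .
  qed (simp add: s)
  finally show ?thesis using j by blast
qed

text \<open>The set of points whose orbit meets \<open>holes\<close> in colour \<open>i\<close> is invariant and has positive measure, so
  ergodicity applies.\<close>

lemma AE_hits:
  assumes i: "i \<in> {1..<k}"
  shows "AE \<xi> in \<nu>. \<exists>h\<in>carrier G. act h \<xi> \<in> holes \<and> hcol (act h \<xi>) = i"
proof -
  interpret prob_space \<nu> by (rule prob_\<nu>)
  let ?C = "{\<eta>\<in>Y. hcol \<eta> = i} \<inter> holes"
  let ?H = "\<Union>h\<in>carrier G. act h -` ?C \<inter> space \<nu>"
  have C: "?C \<in> sets \<nu>" using hcol_sets holes_sets by blast
  have H: "?H \<in> sets \<nu>"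
    using measurable_sets[OF act_measurable C] by (intro sets.countable_UN' countable_carrier) auto
  have "?C = {\<xi>\<in>Y. (\<forall>m. \<xi> \<in> hat (V m)) \<and> \<xi> \<in> hat {x\<in>carrier G. col x = i}}"
    using hcol_hat by (auto simp: holes_def)
  then have "measure \<nu> ?C > 0" using col_positive[OF i] by simp
  moreover have "?C \<subseteq> ?H" 
  proof
    fix \<xi> assume \<xi>: "\<xi> \<in> ?C"
    then show "\<xi> \<in> ?H" using act_one[of \<xi>] by (intro UN_I[of \<one>]) (auto simp: space_\<nu>)
  qed
  then have "measure \<nu> ?C \<le> measure \<nu> ?H" by (rule finite_measure_mono[OF _ H])
  ultimately have "emeasure \<nu> ?H \<noteq> 0" by (simp add: emeasure_eq_measure)
  moreover have "act g -` ?H \<inter> Y = ?H" if g: "g \<in> carrier G" for g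
  proof (intro equalityI subsetI)
    fix \<xi> assume \<xi>: "\<xi> \<in> act g -` ?H \<inter> Y"
    then obtain h where h: "h \<in> carrier G" "act h (act g \<xi>) \<in> ?C" by blast
    then show "\<xi> \<in> ?H" using \<xi> act_mult[of \<xi> h g] g by (intro UN_I[of "h \<otimes> g"]) (auto simp: space_\<nu>)
  next
    fix \<xi> assume \<xi>: "\<xi> \<in> ?H"
    then obtain h where h: "h \<in> carrier G" "\<xi> \<in> Y" "act h \<xi> \<in> ?C" by (auto simp: space_\<nu>)
    have "act (h \<otimes> inv g) (act g \<xi>) = act h \<xi>"
      using act_mult[of "act g \<xi>" h "inv g"] act_inv(1)[OF h(2) g] act_Y h g by simp
    then have "act g \<xi> \<in> ?H" using h g act_Y by (intro UN_I[of "h \<otimes> inv g"]) (auto simp: space_\<nu>)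
    then show "\<xi> \<in> act g -` ?H \<inter> Y" using h by blast
  qed
  ultimately have "emeasure \<nu> ?H = 1" using inv_measure_ergodic[OF invariant H] by blast
  then have "AE \<xi> in \<nu>. \<xi> \<in> ?H" using AE_in_set_eq_1[OF H] by (simp add: emeasure_eq_measure)
  then show ?thesis by eventually_elim auto
qed

text \<open>Almost every orbit meets every set \<open>holes \<inter> {hcol = i}\<close>; there the patterns differ.\<close>

lemma AE_distinct:
  "AE \<xi> in \<nu>. \<forall>i<k. \<forall>j<k. i \<noteq> j \<longrightarrow> phi i \<xi> \<noteq> phi j \<xi>"
proof -
  have "AE \<xi> in \<nu>. \<forall>i\<in>{1..<k}. \<exists>h\<in>carrier G. act h \<xi> \<in> holes \<and> hcol (act h \<xi>) = i"
    using AE_hits by (intro AE_finite_allI) auto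
  then show ?thesis
  proof eventually_elim
    case (elim \<xi>)
    have ne: "phi i \<xi> \<noteq> phi j \<xi>" if ij: "i < k" "i \<noteq> 0" "i \<noteq> j" for i j
    proof
      assume eq: "phi i \<xi> = phi j \<xi>"
      have "i \<in> {1..<k}" using ij by simp
      then obtain h where h: "h \<in> carrier G" "act h \<xi> \<in> holes" "hcol (act h \<xi>) = i" using elim by blast
      then have "phi i \<xi> h" "\<not> phi j \<xi> h" using ij by (auto simp: phi_apply val_def)
      then show False using eq by simp
    qed
    show ?case
    proof (intro allI impI)
      fix i j assume "i < k" "j < k" "i \<noteq> j"
      then show "phi i \<xi> \<noteq> phi j \<xi>" using ne[of i j] ne[of j i] by (cases "i = 0") auto
    qed
  qed
qed

lemma AE_fiber_card: "AE \<xi> in \<nu>. finite (fiber XT beta \<xi>) \<and> card (fiber XT beta \<xi>) = k"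
proof -
  have "AE \<xi> in \<nu>. \<xi> \<in> Y" using AE_space[of \<nu>] space_\<nu> by simp
  with AE_distinct show ?thesis
  proof eventually_elim
    case (elim \<xi>)
    then have "inj_on (\<lambda>j. phi j \<xi>) {..<k}" by (auto simp: inj_on_def)
    then show ?case using fiber_beta[OF elim(2)] by (simp add: card_image)
  qed
qed

lemma mu_inj: "inj_on mu {..<k}"
proof (rule inj_onI)
  fix i j assume ij: "i \<in> {..<k}" "j \<in> {..<k}" "mu i = mu j"
  show "i = j"
  proof (rule ccontr)
    assume ne: "i \<noteq> j"
    have "1 = emeasure (mu i) (sect j)" using mu_sect[of j] ij by simp
    also have "\<dots> = emeasure \<nu> (phi i -` sect j \<inter> Y)"
      by (rule mu_emeasure) (use sect_sets ij in simp_all)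
    also have "phi i -` sect j \<inter> Y = {\<xi>\<in>space \<nu>. \<xi> \<in> phi i -` sect j \<inter> Y}" using space_\<nu> by auto
    also have "emeasure \<nu> \<dots> = 0"
    proof (rule emeasure_eq_0_AE)
      show "AE \<xi> in \<nu>. \<xi> \<notin> phi i -` sect j \<inter> Y"
        using AE_distinct
      proof eventually_elim
        case (elim \<xi>)
        show ?case
        proof
          assume "\<xi> \<in> phi i -` sect j \<inter> Y"
          then obtain \<eta> where \<eta>: "\<xi> \<in> Y" "\<eta> \<in> Y" "phi i \<xi> = phi j \<eta>" by (auto simp: sect_def)
          then have "\<xi> = \<eta>" using beta_phi[of \<xi> i] beta_phi[of \<eta> j] ij by simp
          then show False using elim \<eta> ij ne by auto
        qed
      qed
    qed
    finally show False by simp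
  qed
qed

lemma ergodic_measures: "{\<mu>. ergodic \<mu>} = mu ` {..<k}"
  using ergodic_imp_mu mu_ergodic by auto

lemma mu_isomorphism:
  assumes j: "j < k"
  shows "measure_isomorphism_via G shift (mu j) act \<nu> beta"
  unfolding measure_isomorphism_via_def
proof (intro conjI bexI[of _ "sect j"] bexI[of _ Y] ballI)
  show mb: "beta \<in> measurable (mu j) \<nu>"
    using beta_measurable sets_\<nu> by (simp cong: measurable_cong_sets)
  have "distr (mu j) \<nu> beta = distr (mu j) YM beta" by (rule distr_cong) (use sets_\<nu> in auto)
  also have "\<dots> = \<nu>" using distr_beta mu_ergodic[OF j] by (simp add: ergodic_prob_measure_def)
  finally show "distr (mu j) \<nu> beta = \<nu>" .
  show "emeasure (mu j) (sect j) = 1" by (rule mu_sect[OF j])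
  show "emeasure \<nu> Y = 1" using prob_space.emeasure_space_1[OF prob_\<nu>] space_\<nu> by simp
  show bij: "bij_betw beta (sect j) Y"
    by (rule bij_betw_byWitness[of _ "phi j"]) (use beta_phi[OF _ j] in \<open>auto simp: sect_def\<close>)
  have inv: "inv_into (sect j) beta \<xi> = phi j \<xi>" if "\<xi> \<in> Y" for \<xi>
    by (rule inv_into_f_eq[OF bij_betw_imp_inj_on[OF bij]]) (use that beta_phi[OF that j] in \<open>auto simp: sect_def\<close>)
  have "phi j \<in> measurable \<nu> (restrict_space (mu j) (sect j))"
    by (rule measurable_restrict_space2)
       (use phi_measurable[OF j] space_\<nu> in \<open>auto simp: sect_def cong: measurable_cong_sets\<close>)
  then have "inv_into (sect j) beta \<in> measurable \<nu> (restrict_space (mu j) (sect j))"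
    by (subst measurable_cong) (use inv space_\<nu> in auto)
  then show "inv_into (sect j) beta \<in> measurable (restrict_space \<nu> Y) (restrict_space (mu j) (sect j))"
    by (rule measurable_restrict_space1)
  fix g assume g: "g \<in> carrier G"
  show "shift g ` sect j = sect j" by (rule sect_shift[OF g])
  show "act g ` Y = Y" by (rule act_image_Y[OF g])
  fix x assume "x \<in> sect j"
  then have "x \<in> X" using sect_eq[OF j] by blast
  then show "beta (shift g x) = act g (beta x)" using beta_shift g by blast
next
  show "Y \<in> sets \<nu>" using space_\<nu> sets.top[of \<nu>] by simp
  show "sect j \<in> sets (mu j)" using sect_sets[OF j] by simp
qed

end


section \<open>Irregularity\<close>

context residual_chain
begin

text \<open>A finite index subgroup and a sufficiently deep \<open>\<Gamma>\<^sub>n\<close> generate a subgroup that no longer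
  depends on \<open>n\<close>: its closure in the odometer is open.\<close>

lemma finite_index_absorbs:
  assumes "finite_index_subgroup G H"
  shows "\<exists>n0. \<forall>n. \<forall>\<gamma>\<in>\<Gamma> n0. \<exists>\<eta>\<in>H. \<exists>\<delta>\<in>\<Gamma> n. \<gamma> = \<eta> \<otimes> \<delta>"
proof -
  have H: "subgroup H G" and fin: "finite (rcosets H)"
    using assms by (auto simp: finite_index_subgroup_def)
  have "\<exists>m. C \<inter> \<Gamma> m = {} \<or> (\<forall>n. C \<inter> \<Gamma> n \<noteq> {})" for C by blast
  then obtain f where f: "\<And>C. C \<inter> \<Gamma> (f C) = {} \<or> (\<forall>n. C \<inter> \<Gamma> n \<noteq> {})" by metis
  define n0 where "n0 = Max (insert 0 (f ` (rcosets H)))"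
  have "\<exists>\<eta>\<in>H. \<exists>\<delta>\<in>\<Gamma> n. \<gamma> = \<eta> \<otimes> \<delta>" if \<gamma>: "\<gamma> \<in> \<Gamma> n0" for n \<gamma>
  proof -
    have \<gamma>c: "\<gamma> \<in> carrier G" using \<gamma> chain_carrier by blast
    have "H #> \<gamma> \<in> rcosets H" using \<gamma>c by (auto simp: RCOSETS_def)
    then have "f (H #> \<gamma>) \<le> n0" using fin by (simp add: n0_def)
    then have "\<gamma> \<in> \<Gamma> (f (H #> \<gamma>))" using \<gamma> chain_antimono by blast
    moreover have "\<gamma> \<in> H #> \<gamma>" by (rule rcos_self[OF \<gamma>c H])
    ultimately have "(H #> \<gamma>) \<inter> \<Gamma> n \<noteq> {}" using f[of "H #> \<gamma>"] by blast
    then obtain \<eta> where \<eta>: "\<eta> \<in> H" "\<eta> \<otimes> \<gamma> \<in> \<Gamma> n" by (auto simp: r_coset_def)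
    have \<eta>c: "\<eta> \<in> carrier G" using subgroup.mem_carrier[OF H \<eta>(1)] .
    then have "\<gamma> = inv \<eta> \<otimes> (\<eta> \<otimes> \<gamma>)" using \<gamma>c by (simp add: m_assoc[symmetric])
    then show ?thesis using \<eta> subgroup.m_inv_closed[OF H \<eta>(1)] by blast
  qed
  then show ?thesis by blast
qed

text \<open>An ultrametric for the odometer that is invariant under the action.\<close>

definition first_diff :: "(nat \<Rightarrow> 'g set) \<Rightarrow> (nat \<Rightarrow> 'g set) \<Rightarrow> real" where
  "first_diff \<xi> \<eta> = (if \<xi> = \<eta> then 0 else 1 / real (Suc (LEAST n. \<xi> n \<noteq> \<eta> n)))"

lemma first_diff_less_iff: "first_diff \<xi> \<eta> < 1 / real (Suc n) \<longleftrightarrow> (\<forall>i\<le>n. \<xi> i = \<eta> i)"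
proof (cases "\<xi> = \<eta>")
  case False
  then obtain m where m: "\<xi> m \<noteq> \<eta> m" by blast
  let ?L = "LEAST n. \<xi> n \<noteq> \<eta> n"
  have L: "\<xi> ?L \<noteq> \<eta> ?L" using m by (rule LeastI)
  have "first_diff \<xi> \<eta> < 1 / real (Suc n) \<longleftrightarrow> n < ?L"
    using False by (simp add: first_diff_def field_simps)
  also have "\<dots> \<longleftrightarrow> (\<forall>i\<le>n. \<xi> i = \<eta> i)"
  proof
    assume n: "n < ?L"
    show "\<forall>i\<le>n. \<xi> i = \<eta> i"
    proof (intro allI impI)
      fix i assume "i \<le> n"
      then have "i < ?L" using n by simp
      from not_less_Least[OF this] show "\<xi> i = \<eta> i" by simp
    qed
  next
    assume "\<forall>i\<le>n. \<xi> i = \<eta> i"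
    then show "n < ?L" using L not_le by blast
  qed
  finally show ?thesis .
qed (simp add: first_diff_def)

lemma first_diff_triangle: "first_diff \<xi> \<zeta> \<le> first_diff \<xi> \<eta> + first_diff \<eta> \<zeta>"
proof (cases "\<xi> = \<zeta>")
  case False
  let ?L = "LEAST n. \<xi> n \<noteq> \<zeta> n"
  obtain m where "\<xi> m \<noteq> \<zeta> m" using False by blast
  then have "\<xi> ?L \<noteq> \<zeta> ?L" by (rule LeastI)
  then have "\<not> (\<xi> ?L = \<eta> ?L \<and> \<eta> ?L = \<zeta> ?L)" by metis
  then have "\<not> (first_diff \<xi> \<eta> < 1 / real (Suc ?L) \<and> first_diff \<eta> \<zeta> < 1 / real (Suc ?L))"
    unfolding first_diff_less_iff by blast
  moreover have "first_diff \<xi> \<zeta> = 1 / real (Suc ?L)" using False by (simp add: first_diff_def)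
  moreover have "first_diff \<xi> \<eta> \<ge> 0" "first_diff \<eta> \<zeta> \<ge> 0" by (simp_all add: first_diff_def)
  ultimately show ?thesis by linarith
qed (simp add: first_diff_def)

lemma act_coordinate_eq_iff:
  assumes "\<xi> \<in> Y" "\<eta> \<in> Y" "g \<in> carrier G"
  shows "act g \<xi> n = act g \<eta> n \<longleftrightarrow> \<xi> n = \<eta> n"
proof
  assume eq: "act g \<xi> n = act g \<eta> n"
  obtain a where a: "a \<in> \<xi> n" using Y_nonempty assms by blast
  have ac: "a \<in> carrier G" using Y_carrier[OF assms(1) a] .
  have "g \<otimes> a \<in> act g \<eta> n" using act_mem[of a \<xi> n g] a eq by simp
  then have "a \<in> \<eta> n"
    using act_mem_iff[OF assms(2,3), of "g \<otimes> a" n] ac assms(3) by (simp add: m_assoc[symmetric])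
  then show "\<xi> n = \<eta> n" using a Y_coset assms by metis
qed (simp add: odometer_action_def)

lemma first_diff_act:
  assumes "\<xi> \<in> Y" "\<eta> \<in> Y" "g \<in> carrier G"
  shows "first_diff (act g \<xi>) (act g \<eta>) = first_diff \<xi> \<eta>"
proof -
  have "act g \<xi> = act g \<eta> \<longleftrightarrow> \<xi> = \<eta>"
    using act_coordinate_eq_iff[OF assms] by (metis ext)
  then show ?thesis by (simp add: first_diff_def act_coordinate_eq_iff[OF assms])
qed

text \<open>The universal property of the maximal equicontinuous factor is tested on systems over a
  prescribed type, so the odometer is transported there along an injection \<open>e\<close>; the topology is the
  one of the transported ultrametric.\<close>

lemma equicontinuous_copy:
  assumes e: "inj_on e Y" and comp: "compact_space YT"
  defines "e' \<equiv> inv_into Y e"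
  obtains Z where "topspace Z = e ` Y" "continuous_map YT Z e" "continuous_map Z YT e'"
    "equicontinuous_system G Z (\<lambda>g z. e (act g (e' z)))"
proof -
  define d where "d a b = first_diff (e' a) (e' b)" for a b
  have e'e: "e' (e \<xi>) = \<xi>" if "\<xi> \<in> Y" for \<xi> using inv_into_f_f[OF e that] by (simp add: e'_def)
  have de: "d (e \<xi>) (e \<eta>) = first_diff \<xi> \<eta>" if "\<xi> \<in> Y" "\<eta> \<in> Y" for \<xi> \<eta>
    using that e'e by (simp add: d_def)
  interpret MS: Metric_space "e ` Y" d
  proof
    show "0 \<le> d x y" for x y by (simp add: d_def first_diff_def)
    show "d x y = d y x" for x y
    proof -
      have "(\<lambda>n. e' x n \<noteq> e' y n) = (\<lambda>n. e' y n \<noteq> e' x n)" by auto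
      then show ?thesis by (simp add: d_def first_diff_def)
    qed
    show "d x y = 0 \<longleftrightarrow> x = y" if "x \<in> e ` Y" "y \<in> e ` Y" for x y
      using that e'e by (auto simp: d_def first_diff_def)
    show "d x z \<le> d x y + d y z" for x y z by (simp add: d_def first_diff_triangle)
  qed
  let ?Z = "MS.mtopology"
  have eZ: "continuous_map YT ?Z e"
    unfolding continuous_map
  proof (intro conjI allI impI)
    fix U assume U: "openin ?Z U"
    show "openin YT {\<xi>\<in>topspace YT. e \<xi> \<in> U}"
      unfolding openin_YT_iff
    proof (intro conjI ballI)
      fix \<xi> assume "\<xi> \<in> {\<xi>\<in>topspace YT. e \<xi> \<in> U}"
      then have \<xi>: "\<xi> \<in> Y" "e \<xi> \<in> U" by auto
      then obtain r where r: "r > 0" "MS.mball (e \<xi>) r \<subseteq> U" using U MS.openin_mtopology by blast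
      obtain n where n: "1 / real (Suc n) < r" using r(1) nat_approx_posE by blast
      obtain g where g: "g \<in> \<xi> n" using Y_nonempty \<xi> by blast
      have "cyl n g \<subseteq> {\<xi>\<in>topspace YT. e \<xi> \<in> U}"
      proof
        fix \<eta> assume "\<eta> \<in> cyl n g"
        then have \<eta>: "\<eta> \<in> Y" "g \<in> \<eta> n" by (auto simp: cyl_def)
        have "\<xi> i = \<eta> i" if "i \<le> n" for i
        proof -
          have "g \<in> \<xi> i" "g \<in> \<eta> i" using g \<eta> \<xi>(1) Y_antimono that by blast+
          then show ?thesis using Y_coset \<eta>(1) \<xi>(1) by metis
        qed
        then have "first_diff \<xi> \<eta> < 1 / real (Suc n)" using first_diff_less_iff by blast
        then have "d (e \<xi>) (e \<eta>) < r" using de[OF \<xi>(1) \<eta>(1)] n by simp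
        then have "e \<eta> \<in> MS.mball (e \<xi>) r" using \<xi> \<eta> by (auto simp: MS.in_mball)
        then show "\<eta> \<in> {\<xi>\<in>topspace YT. e \<xi> \<in> U}" using r \<eta> by auto
      qed
      then show "\<exists>n. \<exists>g\<in>\<xi> n. cyl n g \<subseteq> {\<xi>\<in>topspace YT. e \<xi> \<in> U}" using g by blast
    qed auto
  qed auto
  have Ze: "continuous_map ?Z YT e'"
    unfolding continuous_map
  proof (intro conjI allI impI)
    show "e' ` topspace ?Z \<subseteq> topspace YT" using e'e by auto
    fix U assume U: "openin YT U"
    show "openin ?Z {z\<in>topspace ?Z. e' z \<in> U}"
      unfolding MS.openin_mtopology
    proof (intro conjI allI impI)
      fix z assume "z \<in> {z\<in>topspace ?Z. e' z \<in> U}"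
      then obtain \<xi> where \<xi>: "\<xi> \<in> Y" "z = e \<xi>" "\<xi> \<in> U" using e'e by auto
      then obtain n g where g: "g \<in> \<xi> n" "cyl n g \<subseteq> U" using U openin_YT_iff by blast
      have "MS.mball z (1 / real (Suc n)) \<subseteq> {z\<in>topspace ?Z. e' z \<in> U}"
      proof
        fix w assume "w \<in> MS.mball z (1 / real (Suc n))"
        then obtain \<eta> where \<eta>: "\<eta> \<in> Y" "w = e \<eta>" "d z w < 1 / real (Suc n)"
          by (auto simp: MS.in_mball)
        then have "\<xi> n = \<eta> n" using de \<xi> first_diff_less_iff by auto
        then have "\<eta> \<in> cyl n g" using g \<eta> by (simp add: cyl_def)
        then show "w \<in> {z\<in>topspace ?Z. e' z \<in> U}" using g \<eta> e'e by auto
      qed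
      then show "\<exists>r>0. MS.mball z r \<subseteq> {z\<in>topspace ?Z. e' z \<in> U}"
        by (intro exI[of _ "1 / real (Suc n)"]) simp
    qed auto
  qed
  have "equicontinuous_system G ?Z (\<lambda>g z. e (act g (e' z)))"
    unfolding equicontinuous_system_def
  proof (intro conjI)
    have "compactin ?Z (e ` topspace YT)"
      using comp eZ image_compactin unfolding compact_space_def by blast
    then show "compact_space ?Z" by (simp add: compact_space_def)
    show "continuous_action G ?Z (\<lambda>g z. e (act g (e' z)))"
      unfolding continuous_action_def
    proof (intro conjI ballI)
      fix g assume "g \<in> carrier G"
      then show "continuous_map ?Z ?Z (\<lambda>z. e (act g (e' z)))"
        using continuous_map_compose[OF continuous_map_compose[OF Ze continuous_act] eZ]
        by (simp add: comp_def)
    qed (auto simp: e'e act_one act_mult act_Y)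
    show "\<exists>d. Metric_space (topspace ?Z) d \<and> Metric_space.mtopology (topspace ?Z) d = ?Z \<and>
        (\<forall>\<epsilon>>0. \<exists>\<delta>>0. \<forall>x\<in>topspace ?Z. \<forall>y\<in>topspace ?Z. d x y < \<delta> \<longrightarrow>
           (\<forall>g\<in>carrier G. d (e (act g (e' x))) (e (act g (e' y))) < \<epsilon>))"
    proof (intro exI[of _ d] conjI allI impI)
      fix \<epsilon> :: real assume "\<epsilon> > 0"
      then show "\<exists>\<delta>>0. \<forall>x\<in>topspace ?Z. \<forall>y\<in>topspace ?Z. d x y < \<delta> \<longrightarrow>
           (\<forall>g\<in>carrier G. d (e (act g (e' x))) (e (act g (e' y))) < \<epsilon>)"
        by (intro exI[of _ \<epsilon>]) (auto simp: e'e de act_Y first_diff_act)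
    qed (use MS.Metric_space_axioms in auto)
  qed
  then show ?thesis using that[of ?Z] eZ Ze by simp
qed

end

context toeplitz_tower
begin

lemma x0_toeplitz: "toeplitz G x0"
  unfolding toeplitz_def
proof (intro conjI ballI)
  show "x0 \<in> topspace (full_shift G)" by (simp add: x0_def)
  fix g assume g: "g \<in> carrier G"
  have "finite_index_subgroup G (\<Gamma> (lv (Suc (stage g))))"
    using subgroup_chain finite_index by (simp add: finite_index_subgroup_def)
  then show "\<exists>H. finite_index_subgroup G H \<and> (\<forall>\<gamma>\<in>H. x0 (g \<otimes> \<gamma>) = x0 g)"
    using x0_mult[OF g] by blast
qed

text \<open>If \<open>h \<xi> \<in> holes\<close>, both values occur on nonempty open sets arbitrarily close to \<open>h \<xi>\<close>. The orbit
  of \<open>h \<xi>\<close> under a finite index subgroup is dense in a neighbourhood and reaches these sets, so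
  the position \<open>h\<close> has no period.\<close>

lemma toeplitz_avoids_holes:
  assumes y: "y \<in> X" "toeplitz G y" and h: "h \<in> carrier G"
  shows "act h (beta y) \<notin> holes"
proof
  define \<xi> where "\<xi> = beta y"
  have \<xi>: "\<xi> \<in> Y" using beta_Y y by (simp add: \<xi>_def)
  assume "act h (beta y) \<in> holes"
  then have hD: "act h \<xi> \<in> holes" by (simp add: \<xi>_def)
  \<comment> \<open>It suffices to find \<open>\<eta> \<in> H\<close> such that \<open>h \<otimes> \<eta>\<close> moves \<open>\<xi>\<close> into a small coset of a point \<open>a\<close>
    at which the array has the opposite value.\<close>
  obtain j where j: "j < k" "y = phi j \<xi>" using fiber_phi[OF y(1)] by (auto simp: \<xi>_def)
  obtain H where H: "finite_index_subgroup G H" "\<And>\<gamma>. \<gamma> \<in> H \<Longrightarrow> y (h \<otimes> \<gamma>) = y h"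
    using y(2) h unfolding toeplitz_def by meson
  obtain n0 where n0: "\<And>n \<gamma>. \<gamma> \<in> \<Gamma> n0 \<Longrightarrow> \<exists>\<eta>\<in>H. \<exists>\<delta>\<in>\<Gamma> n. \<gamma> = \<eta> \<otimes> \<delta>"
    using finite_index_absorbs[OF H(1)] by blast
  have Hc: "\<eta> \<in> carrier G" if "\<eta> \<in> H" for \<eta>
    using H(1) that subgroup.mem_carrier by (auto simp: finite_index_subgroup_def)
  obtain g1 where g1: "g1 \<in> \<xi> (lv n0)" using Y_nonempty \<xi> by blast
  have g1c: "g1 \<in> carrier G" using Y_carrier[OF \<xi> g1] .
  have hg1: "h \<otimes> g1 \<in> V n0" using holes_V[OF hD act_mem[of g1 \<xi> "lv n0" h]] g1 by simp
  have hcol: "hcol (act h \<xi>) = col (h \<otimes> g1)"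
    by (rule hcol_eq[OF act_Y[OF \<xi> h] act_mem[of g1 \<xi> "lv n0" h]]) (rule g1)
  have yh: "y h \<longleftrightarrow> col (h \<otimes> g1) = j" using j hD hcol h by (simp add: phi_apply val_def)
  obtain \<gamma>1 where \<gamma>1: "\<gamma>1 \<in> \<Gamma> (lv n0)" "x0 (h \<otimes> g1 \<otimes> \<gamma>1) \<noteq> y h"
    using x0_values[OF hg1, of "\<not> y h"] by blast
  have \<gamma>1c: "\<gamma>1 \<in> carrier G" using chain_carrier[OF \<gamma>1(1)] .
  define a where "a = h \<otimes> (g1 \<otimes> \<gamma>1)"
  have a: "a = h \<otimes> g1 \<otimes> \<gamma>1" "a \<in> carrier G" using h g1c \<gamma>1c by (simp_all add: a_def m_assoc)
  \<comment> \<open>At this level the coset of \<open>a\<close> determines its stage, hence the value of the array.\<close>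
  define n' where "n' = max n0 (Suc (stage a))"
  obtain g2 where g2: "g2 \<in> \<xi> (lv n')" using Y_nonempty \<xi> by blast
  have g2c: "g2 \<in> carrier G" using Y_carrier[OF \<xi> g2] .
  have "g2 \<in> \<xi> (lv n0)" using g2 Y_antimono[OF \<xi> lv_mono[of n0 n']] by (auto simp: n'_def)
  then obtain \<gamma>2 where \<gamma>2: "\<gamma>2 \<in> \<Gamma> (lv n0)" "g2 = g1 \<otimes> \<gamma>2" by (rule Y_memE[OF \<xi> g1])
  have \<gamma>2c: "\<gamma>2 \<in> carrier G" using chain_carrier[OF \<gamma>2(1)] .
  have "g1 \<otimes> (\<gamma>1 \<otimes> inv \<gamma>2) \<otimes> inv g1 \<in> \<Gamma> (lv n0)"
    using chain_conj[OF chain_mult[OF \<gamma>1(1) chain_inv[OF \<gamma>2(1)]] g1c] .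
  then have "g1 \<otimes> (\<gamma>1 \<otimes> inv \<gamma>2) \<otimes> inv g1 \<in> \<Gamma> n0" using chain_antimono[OF lv_ge[of n0]] by blast
  then obtain \<eta> \<delta> where \<eta>: "\<eta> \<in> H" "\<delta> \<in> \<Gamma> (lv n')" "g1 \<otimes> (\<gamma>1 \<otimes> inv \<gamma>2) \<otimes> inv g1 = \<eta> \<otimes> \<delta>"
    using n0 by meson
  have c: "\<eta> \<in> carrier G" "\<delta> \<in> carrier G" using Hc \<eta> chain_carrier by auto
  have "g1 \<otimes> \<gamma>1 = g1 \<otimes> (\<gamma>1 \<otimes> inv \<gamma>2) \<otimes> inv g1 \<otimes> g2"
    using \<gamma>2(2) g1c \<gamma>1c \<gamma>2c by (simp add: m_assoc inv_solve_left)
       (simp add: m_assoc[symmetric])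
  also have "\<dots> = \<eta> \<otimes> g2 \<otimes> (inv g2 \<otimes> \<delta> \<otimes> g2)"
    unfolding \<eta>(3) using c g2c by (simp add: m_assoc[symmetric]) (simp add: m_assoc)
  finally have g1\<gamma>1: "g1 \<otimes> \<gamma>1 = \<eta> \<otimes> g2 \<otimes> (inv g2 \<otimes> \<delta> \<otimes> g2)" .
  have "inv g2 \<otimes> \<delta> \<otimes> g2 \<in> \<Gamma> (lv n')" by (rule chain_conj'[OF \<eta>(2) g2c])
  moreover have h\<eta>: "h \<otimes> \<eta> \<in> carrier G" using h c by simp
  have "h \<otimes> \<eta> \<otimes> g2 \<in> act (h \<otimes> \<eta>) \<xi> (lv n')" using act_mem[of g2 \<xi> "lv n'" "h \<otimes> \<eta>"] g2 by simp
  ultimately have "h \<otimes> \<eta> \<otimes> g2 \<otimes> (inv g2 \<otimes> \<delta> \<otimes> g2) \<in> act (h \<otimes> \<eta>) \<xi> (lv n')"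
    using Y_mult[OF act_Y[OF \<xi> h\<eta>]] by blast
  moreover have "h \<otimes> \<eta> \<otimes> g2 \<otimes> (inv g2 \<otimes> \<delta> \<otimes> g2) = a"
    unfolding a_def g1\<gamma>1 using h c g2c by (simp add: m_assoc)
  ultimately have "a \<in> act (h \<otimes> \<eta>) \<xi> (lv n')" by simp
  then have "x0 a = val j (act (h \<otimes> \<eta>) \<xi>)"
    by (rule x0_val[OF act_Y[OF \<xi> h\<eta>]]) (simp add: n'_def)
  also have "\<dots> = y (h \<otimes> \<eta>)" using j phi_apply[OF h\<eta>] by simp
  also have "\<dots> = y h" by (rule H(2)[OF \<eta>(1)])
  finally show False using \<gamma>1(2) a by simp
qed

lemma compact_XT: "compact_space XT"
proof -
  have "compact_space (full_shift G)"
    unfolding full_shift_def by (simp add: compact_space_product_topology compact_space_discrete_topology)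
  then have "compactin (full_shift G) X"
    by (rule closedin_compact_space) (simp add: orbit_closure_def)
  then show ?thesis unfolding orbit_subshift_def by (simp add: compact_space_subtopology)
qed

lemma compact_YT: "compact_space YT"
proof -
  have "compactin YT (beta ` topspace XT)"
    using image_compactin[OF _ beta_continuous] compact_XT unfolding compact_space_def by blast
  then show ?thesis using beta_factor by (simp add: compact_space_def factor_map_def)
qed

text \<open>The odometer is a factor of every maximal equicontinuous factor, and the Toeplitz arrays lie
  over the null set of points whose orbits avoid \<open>holes\<close>.\<close>

lemma x0_not_regular: "\<not> regular_toeplitz G x0"
proof
  assume "regular_toeplitz G x0"
  then obtain \<Gamma>' \<pi> \<nu>' where mef: "maximal_equicontinuous_factor G XT shift (odometer_topology G \<Gamma>') act \<pi>"
    and \<nu>': "invariant_prob_measure G (odometer_topology G \<Gamma>') act \<nu>'"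
    and one: "emeasure \<nu>' (\<pi> ` {y\<in>X. toeplitz G y}) = 1"
    by (auto simp: regular_toeplitz_def)
  let ?W = "odometer_topology G \<Gamma>'"
  let ?e = "fiber XT beta"
  have e: "inj_on ?e Y"
  proof (rule inj_onI)
    fix \<xi> \<eta> assume *: "\<xi> \<in> Y" "\<eta> \<in> Y" "?e \<xi> = ?e \<eta>"
    have "phi 0 \<xi> \<in> ?e \<xi>" using fiber_beta[OF *(1)] k by force
    then have "phi 0 \<xi> \<in> ?e \<xi>" "phi 0 \<xi> \<in> ?e \<eta>" using *(3) by auto
    then show "\<xi> = \<eta>" by (simp add: fiber_def)
  qed
  let ?e' = "inv_into Y ?e"
  have e'e: "?e' (?e \<xi>) = \<xi>" if "\<xi> \<in> Y" for \<xi> using inv_into_f_f[OF e that] .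
  obtain Z where Z: "topspace Z = ?e ` Y" "continuous_map YT Z ?e" "continuous_map Z YT ?e'"
    "equicontinuous_system G Z (\<lambda>g z. ?e (act g (?e' z)))"
    using equicontinuous_copy[OF e compact_YT] .
  have fm: "factor_map G XT shift Z (\<lambda>g z. ?e (act g (?e' z))) (\<lambda>x. ?e (beta x))"
    unfolding factor_map_def
  proof (intro conjI ballI)
    show "continuous_map XT Z (\<lambda>x. ?e (beta x))"
      using continuous_map_compose[OF beta_continuous Z(2)] by (simp add: comp_def)
    have "beta ` X = Y" using beta_factor by (simp add: factor_map_def)
    then show "(\<lambda>x. ?e (beta x)) ` topspace XT = topspace Z"
      using Z(1) by (simp add: image_image[symmetric])
    fix g x assume "g \<in> carrier G" "x \<in> topspace XT"
    then show "?e (beta (shift g x)) = ?e (act g (?e' (?e (beta x))))"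
      using beta_shift e'e beta_Y by simp
  qed
  have "\<forall>(Z :: ('g \<Rightarrow> bool) set topology) c f.
      equicontinuous_system G Z c \<and> factor_map G XT shift Z c f \<longrightarrow>
      (\<exists>h. factor_map G ?W act Z c h \<and> (\<forall>x\<in>topspace XT. f x = h (\<pi> x)))"
    using mef unfolding maximal_equicontinuous_factor_def by (elim conjE)
  from this[rule_format, OF conjI, OF Z(4) fm]
  obtain q where q: "factor_map G ?W act Z (\<lambda>g z. ?e (act g (?e' z))) q"
    "\<forall>x\<in>X. ?e (beta x) = q (\<pi> x)"
    unfolding topspace_XT by (elim exE conjE)
  define p where "p w = ?e' (q w)" for w
  have pc: "continuous_map ?W YT p"
    using continuous_map_compose[OF _ Z(3), of ?W q] q(1) by (simp add: factor_map_def comp_def p_def[abs_def])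
  have peq: "p (act g w) = act g (p w)" if "g \<in> carrier G" "w \<in> topspace ?W" for g w
  proof -
    have "q ` topspace ?W = ?e ` Y" using q(1) Z(1) by (simp add: factor_map_def)
    then have "q w \<in> ?e ` Y" using that(2) by blast
    then have "?e' (q w) \<in> Y" using e'e by auto
    moreover have "q (act g w) = ?e (act g (?e' (q w)))" using q(1) that by (simp add: factor_map_def)
    ultimately show ?thesis using e'e act_Y that(1) by (simp add: p_def)
  qed
  have distr: "distr \<nu>' YM p = \<nu>"
    by (rule inv_measure_unique[OF inv_measure_distr[OF \<nu>' pc] invariant]) (rule peq)
  have s': "sets \<nu>' = sets (borel_of ?W)" using \<nu>' by (simp add: invariant_prob_measure_def)
  have sp': "space \<nu>' = topspace ?W" using sets_eq_imp_space_eq[OF s'] by simp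
  have pm: "p \<in> measurable \<nu>' YM"
    using continuous_map_measurable_borel_of[OF pc] s' by (simp cong: measurable_cong_sets)
  define N where "N = space \<nu> - (\<Union>h\<in>carrier G. act h -` holes \<inter> space \<nu>)"
  have Ns: "N \<in> sets \<nu>"
    unfolding N_def using measurable_sets[OF act_measurable holes_sets]
    by (intro sets.compl_sets sets.countable_UN' countable_carrier) auto
  have "emeasure \<nu> {\<xi>\<in>space \<nu>. \<xi> \<in> N} = 0"
  proof (rule emeasure_eq_0_AE)
    show "AE \<xi> in \<nu>. \<xi> \<notin> N"
      using AE_hits[of 1] k by (auto simp: N_def elim!: eventually_mono)
  qed
  moreover have "{\<xi>\<in>space \<nu>. \<xi> \<in> N} = N" by (auto simp: N_def)
  ultimately have "emeasure \<nu> N = 0" by simp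
  then have "emeasure \<nu>' (p -` N \<inter> space \<nu>') = 0"
    using emeasure_distr[OF pm, of N] Ns sets_\<nu> distr by simp
  moreover have "\<pi> ` {y\<in>X. toeplitz G y} \<subseteq> p -` N \<inter> space \<nu>'"
  proof
    fix w assume "w \<in> \<pi> ` {y\<in>X. toeplitz G y}"
    then obtain y where y: "y \<in> X" "toeplitz G y" "w = \<pi> y" by blast
    have "w \<in> topspace ?W"
      using mef y by (auto simp: maximal_equicontinuous_factor_def factor_map_def)
    moreover have "p w = beta y"
      using q(2) y e'e[OF beta_Y[OF y(1)]] by (metis p_def)
    moreover have "beta y \<in> N"
      using toeplitz_avoids_holes[OF y(1,2)] beta_Y[OF y(1)] by (auto simp: N_def space_\<nu>)
    ultimately show "w \<in> p -` N \<inter> space \<nu>'" by (simp add: sp')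
  qed
  then have "emeasure \<nu>' (\<pi> ` {y\<in>X. toeplitz G y}) \<le> emeasure \<nu>' (p -` N \<inter> space \<nu>')"
    by (rule emeasure_mono) (use measurable_sets[OF pm, of N] Ns sets_\<nu> in simp)
  ultimately show False using one by simp
qed

lemma fiber_one: "fiber XT beta \<one>\<^bsub>odometer_group G \<Gamma>\<^esub> = {x0}"
proof -
  have "\<one>\<^bsub>odometer_group G \<Gamma>\<^esub> = emb \<one>"
    using subgroup.subset[OF subgroup_chain] lcos_mult_one by (auto simp: odometer_group_def emb_def)
  moreover have "shift \<one> x0 = x0" using shift_one x0_X X_extensional by blast
  ultimately show ?thesis using fiber_emb[OF one_closed] by simp
qed

end

theorem theorem1p3:
  fixes G :: "('g, 'm) monoid_scheme"
    and \<Gamma> :: "nat \<Rightarrow> 'g set"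
    and \<nu> :: "(nat \<Rightarrow> 'g set) measure"
    and k :: nat
  assumes "group G"
    and "countable (carrier G)"
    and "infinite (carrier G)"
    and "amenable_group G"
    and "residually_finite_group G"
    and "decreasing_finite_index G \<Gamma>"
    and "\<And>n. \<Gamma> n \<lhd> G"
    and "(\<Inter>n. \<Gamma> n) = {\<one>\<^bsub>G\<^esub>}"
    and "normalized_haar_measure (odometer_group G \<Gamma>) (odometer_topology G \<Gamma>) \<nu>"
    and "k \<ge> 2"
  shows "\<exists>x\<^sub>0 \<beta>.
    irregular_toeplitz G x\<^sub>0 \<and>
    factor_map G (orbit_subshift G x\<^sub>0) (shift_action G) (odometer_topology G \<Gamma>) (odometer_action G) \<beta> \<and>
    almost_one_to_one (orbit_subshift G x\<^sub>0) \<beta> \<and>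
    fiber (orbit_subshift G x\<^sub>0) \<beta> \<one>\<^bsub>odometer_group G \<Gamma>\<^esub> = {x\<^sub>0} \<and>
    (\<forall>\<xi>\<in>odometer G \<Gamma>.
       finite (fiber (orbit_subshift G x\<^sub>0) \<beta> \<xi>) \<and> card (fiber (orbit_subshift G x\<^sub>0) \<beta> \<xi>) \<le> k) \<and>
    (AE \<xi> in \<nu>.
       finite (fiber (orbit_subshift G x\<^sub>0) \<beta> \<xi>) \<and> card (fiber (orbit_subshift G x\<^sub>0) \<beta> \<xi>) = k) \<and>
    finite {\<mu>. ergodic_prob_measure G (orbit_subshift G x\<^sub>0) (shift_action G) \<mu>} \<and>
    card {\<mu>. ergodic_prob_measure G (orbit_subshift G x\<^sub>0) (shift_action G) \<mu>} = k \<and>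
    (\<forall>\<mu>. ergodic_prob_measure G (orbit_subshift G x\<^sub>0) (shift_action G) \<mu> \<longrightarrow>
       measure_isomorphism_via G (shift_action G) \<mu> (odometer_action G) \<nu> \<beta>)"
proof -
  interpret group G by (rule assms(1))
  interpret residual_chain G \<Gamma>
    using assms(2,3,6-8)
    by (intro residual_chain.intro residual_chain_axioms.intro \<open>group G\<close>)
       (simp_all add: decreasing_finite_index_def finite_index_subgroup_def)
  have "inv_measure \<nu>" by (rule haar_invariant[OF assms(9)])
  then obtain lv V F col where "toeplitz_tower G \<Gamma> \<nu> k lv V F col"
    using toeplitz_tower_exists assms(4,10) by blast
  then interpret toeplitz_tower G \<Gamma> \<nu> k lv V F col .
  show ?thesis
  proof (intro exI[of _ x0] exI[of _ beta] conjI allI impI ballI)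
    show "irregular_toeplitz G x0"
      using x0_toeplitz x0_not_regular by (simp add: irregular_toeplitz_def)
    show "factor_map G XT shift YT act beta" by (rule beta_factor)
    show "almost_one_to_one XT beta" by (rule beta_almost_one_to_one)
    show "fiber XT beta \<one>\<^bsub>odometer_group G \<Gamma>\<^esub> = {x0}" by (rule fiber_one)
    fix \<xi> assume "\<xi> \<in> Y"
    then show "finite (fiber XT beta \<xi>)" "card (fiber XT beta \<xi>) \<le> k"
      using card_image_le[of "{..<k}" "\<lambda>j. phi j \<xi>"] by (auto simp: fiber_beta)
  next
    show "AE \<xi> in \<nu>. finite (fiber XT beta \<xi>) \<and> card (fiber XT beta \<xi>) = k"
      by (rule AE_fiber_card)
    show "finite {\<mu>. ergodic \<mu>}" "card {\<mu>. ergodic \<mu>} = k"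
      using ergodic_measures mu_inj by (auto simp: card_image)
    fix \<mu> assume "ergodic \<mu>"
    then show "measure_isomorphism_via G shift \<mu> act \<nu> beta"
      using ergodic_imp_mu mu_isomorphism by blast
  qed
qed

end
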